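(* Let $q$ be a real-valued, $1$-periodic function with $q\in L_1[0,1]$ and $\int_0^1 q(x)\,dx=0$. Let $\varepsilon>0$ be fixed, let $N$ be a sufficiently large positive integer, and let $\mathbb N_4(\varepsilon)$ be the set of all $n\in\mathbb N$ with $n>N$ and $$|q_{2n+1}-S_{2n+1}+2Q_0Q_{2n+1}|\ge\varepsilon n^{-2}.$$ Then the eigenvalues $\mu_{n,j}$ of the operator $L_\pi(q)$ for $n\in\mathbb N_4(\varepsilon)$ are simple and satisfy $$\mu_{n,j}=(2\pi n+\pi)^2+A_2((2\pi n+\pi)^2)+(-1)^j|q_{2n+1}-S_{2n+1}+2Q_0Q_{2n+1}|+o(n^{-2})$$ for $j=1,2$, as $n\to\infty$, $n\in\mathbb N_4(\varepsilon)$.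
   Context: $L_\pi(q)$ is the operator in $L_2[0,1]$ generated by $-y''+qy$ with antiperiodic boundary conditions $y(1)=-y(0)$, $y'(1)=-y'(0)$. Its large eigenvalues, counted with multiplicity, form two sequences $\mu_{n,1}\le\mu_{n,2}$ ($n\ge N_0$, $N_0$ a sufficiently large integer) with $\mu_{n,j}=(2\pi n+\pi)^2+O(n^{1/2})$. For a function $f$ put $f_k=\int_0^1f(x)e^{-2\pi ikx}dx$; this gives $q_k,Q_k,S_k$, where $Q(x)=\int_0^xq(t)\,dt$ and $S(x)=Q(x)^2$. Further $A_2((2\pi n+\pi)^2)$ is the sum of $$\sum_{k\ne0,2n+1}\frac{|q_k|^2}{(2\pi n+\pi)^2-(2\pi(n-k)+\pi)^2}$$ and $$\sum_{k,l}\frac{q_kq_lq_{-k-l}}{[(2\pi n+\pi)^2-(2\pi(n-k)+\pi)^2][(2\pi n+\pi)^2-(2\pi(n-k-l)+\pi)^2]},$$ the last sum being over integers $k,l$ with $l\ne0$, $k\neq0,2n+1$ and $k+l\ne0,2n+1$. How large $N$ must be may depend on $q$ and $\varepsilon$. *)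

theory Defs
  imports "HOL-Analysis.Analysis" "HOL-Library.Function_Algebras" "HOL-Library.Landau_Symbols"
begin

definition in_L2 :: "(real \<Rightarrow> complex) \<Rightarrow> bool" where
  "in_L2 f \<longleftrightarrow> f \<in> borel_measurable (lebesgue_on {0..1}) \<and>
     integrable (lebesgue_on {0..1}) (\<lambda>x. (norm (f x))\<^sup>2)"

(* f is absolutely continuous on [0,1] with (almost everywhere) derivative g, in the
   form "f is an indefinite integral of the Lebesgue integrable function g". *)
definition has_AC_derivative :: "(real \<Rightarrow> complex) \<Rightarrow> (real \<Rightarrow> complex) \<Rightarrow> bool" where
  "has_AC_derivative f g \<longleftrightarrow> g absolutely_integrable_on {0..1} \<and>
     (\<forall>x\<in>{0..1}. f x = f 0 + integral {0..x} g)"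

(* The graph of L_pi(q): y belongs to the domain and L_pi(q) y = f as elements of L_2[0,1].
   The domain consists of the y with y, y' absolutely continuous, - y'' + q y in L_2[0,1],
   and antiperiodic boundary values. *)
definition antiperiodic_op :: "(real \<Rightarrow> real) \<Rightarrow> (real \<Rightarrow> complex) \<Rightarrow> (real \<Rightarrow> complex) \<Rightarrow> bool" where
  "antiperiodic_op q y f \<longleftrightarrow> in_L2 f \<and>
     (\<exists>y' y''. (\<forall>x\<in>{0..1}. (y has_vector_derivative y' x) (at x within {0..1})) \<and>
        has_AC_derivative y' y'' \<and>
        (AE x in lebesgue_on {0..1}. f x = - y'' x + of_real (q x) * y x) \<and>
        y 1 = - y 0 \<and> y' 1 = - y' 0)"

(* Functions on [0,1] are represented by their extensions by 0, and an element of L_2[0,1]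
   in the domain by its continuous representative, so that distinct members of the
   eigenspace are distinct elements of L_2[0,1]. *)
definition eigenspace :: "(real \<Rightarrow> real) \<Rightarrow> complex \<Rightarrow> (real \<Rightarrow> complex) set" where
  "eigenspace q z =
     {y. (\<forall>x. x \<notin> {0..1} \<longrightarrow> y x = 0) \<and> antiperiodic_op q y (\<lambda>x. z * y x)}"

lemma vector_space_complex_fun:
  "vector_space (\<lambda>(c::complex) (f::real \<Rightarrow> complex) x. c * f x)"
  by unfold_locales (auto simp: fun_eq_iff algebra_simps)

(* Complex dimension of the eigenspace; the operator is self-adjoint for real q, so this is
   also the algebraic multiplicity. It is 0 when z is not an eigenvalue. *)
definition eig_mult :: "(real \<Rightarrow> real) \<Rightarrow> complex \<Rightarrow> nat" where
  "eig_mult q z =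
     vector_space.dim (\<lambda>(c::complex) (f::real \<Rightarrow> complex) x. c * f x) (eigenspace q z)"

definition lam :: "int \<Rightarrow> real" where
  "lam n = (2 * pi * of_int n + pi)\<^sup>2"

(* "The large eigenvalues, counted with multiplicity, form the two sequences
   \<mu> n 1 \<le> \<mu> n 2, n \<ge> N0": the multiset of the \<mu> n j equals the multiset of all eigenvalues
   exceeding some threshold R. The values \<mu> n j with n < N0 or j other than 1, 2 are irrelevant.
   The index sets below are finite since \<mu> n j tends to infinity. *)
definition large_eigenvalues :: "(real \<Rightarrow> real) \<Rightarrow> nat \<Rightarrow> (nat \<Rightarrow> nat \<Rightarrow> real) \<Rightarrow> bool" where
  "large_eigenvalues q N0 \<mu> \<longleftrightarrow>
     (\<forall>n\<ge>N0. \<mu> n 1 \<le> \<mu> n 2) \<and>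
     (\<exists>R. \<forall>t::real. card {(n, j). n \<ge> N0 \<and> j \<in> {1, 2} \<and> \<mu> n j = t} =
        (if t > R then eig_mult q (of_real t) else 0)) \<and>
     (\<forall>j\<in>{1, 2}. (\<lambda>n. \<mu> n j - lam (int n)) \<in> O(\<lambda>n. sqrt (real n)))"

definition fourier_coeff :: "(real \<Rightarrow> real) \<Rightarrow> int \<Rightarrow> complex" where
  "fourier_coeff f k =
     integral {0..1} (\<lambda>x. of_real (f x) * exp (- (2 * of_real pi * \<i> * of_int k * of_real x)))"

(* Only used for x in [0,1]. *)
definition prim :: "(real \<Rightarrow> real) \<Rightarrow> real \<Rightarrow> real" where
  "prim q x = integral {0..x} q"

definition gap_coeff :: "(real \<Rightarrow> real) \<Rightarrow> nat \<Rightarrow> complex" where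
  "gap_coeff q n = fourier_coeff q (2 * int n + 1)
     - fourier_coeff (\<lambda>x. (prim q x)\<^sup>2) (2 * int n + 1)
     + 2 * fourier_coeff (prim q) 0 * fourier_coeff (prim q) (2 * int n + 1)"

(* The value A_2((2 pi n + pi)^2). Both series converge absolutely, since the Fourier
   coefficients of q are bounded. *)
definition A2 :: "(real \<Rightarrow> real) \<Rightarrow> nat \<Rightarrow> complex" where
  "A2 q n =
     (\<Sum>\<^sub>\<infinity>k\<in>{k. k \<noteq> 0 \<and> k \<noteq> 2 * int n + 1}.
        of_real ((cmod (fourier_coeff q k))\<^sup>2 / (lam (int n) - lam (int n - k)))) +
     (\<Sum>\<^sub>\<infinity>(k, l)\<in>{(k, l). l \<noteq> 0 \<and> k \<noteq> 0 \<and> k \<noteq> 2 * int n + 1 \<and>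
                             k + l \<noteq> 0 \<and> k + l \<noteq> 2 * int n + 1}.
        fourier_coeff q k * fourier_coeff q l * fourier_coeff q (- k - l) /
        of_real ((lam (int n) - lam (int n - k)) * (lam (int n) - lam (int n - k - l))))"

definition N4 :: "(real \<Rightarrow> real) \<Rightarrow> real \<Rightarrow> nat \<Rightarrow> nat set" where
  "N4 q \<epsilon> N = {n. n > N \<and> cmod (gap_coeff q n) \<ge> \<epsilon> / (real n)\<^sup>2}"

end

theory Submission
  imports Defs
begin

text \<open>
  Put \<open>m = 2n + 1\<close> and let \<open>x\<^sub>k\<close> be the Fourier coefficients of an eigenfunction with respect to the
  antiperiodic exponentials, indexed so that the two resonant modes \<open>n\<close> and \<open>- n - 1\<close> are \<open>x\<^sub>0\<close> and \<open>x\<^sub>m\<close>.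
  With \<open>s\<close> the eigenvalue minus \<open>(2 \<pi> n + \<pi>)\<^sup>2\<close> and \<open>d\<^sub>k = 4 \<pi>\<^sup>2 k (m - k)\<close> the eigenvalue equation reads
  \<open>(s + d\<^sub>k) x\<^sub>k = \<Sum>\<^sub>j q\<^sub>j\<^sub>-\<^sub>k x\<^sub>j\<close>. Eliminating the nonresonant unknowns three times leaves an approximate eigenvalue
  problem for a Hermitian \<open>2 \<times> 2\<close> matrix with diagonal entries \<open>A\<^sub>2\<close> and off-diagonal entry \<open>B\<close>; the remainder is
  \<open>o(n\<^sup>-\<^sup>2)\<close> because \<open>\<Sum> 1 / \<bar>d\<^sub>k\<bar> = O(m powr (-3/4))\<close> and \<open>s = o(1)\<close>.

  The second order part of \<open>B\<close> is the Fourier coefficient of a product involving primitives of \<open>q\<close> and integration by parts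
  identifies it with \<open>2 Q\<^sub>0 Q\<^sub>m - S\<^sub>m\<close>. The third order part is only \<open>O(m powr (-3/2))\<close> by absolute
  estimates; it is \<open>o(m\<^sup>-\<^sup>2)\<close> because \<open>m\<close> times the operator with multiplier \<open>1 / d\<^sub>k\<close> converges, as a map from \<open>L\<^sub>1\<close>
  functions to bounded functions, so that the Riemann-Lebesgue lemma applies to a fixed limit.

  The hypothesis on the eigenvalues already provides two of them near \<open>(2 \<pi> n + \<pi>)\<^sup>2\<close>. Their resonant parts are nearly
  orthogonal (or can be chosen independent if the two eigenvalues coincide), so that the two values of \<open>s - A\<^sub>2\<close> have
  sum nearly zero and hence opposite signs.
\<close>

subsection \<open>Products of absolutely continuous functions\<close>

text \<open>The coefficients of a product are expanded only when one factor is continuous with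
  absolutely summable coefficients; the decay of 1 / d_k provides such a factor for eigenfunctions
  and for iterates of the multiplier alike.

  The number three comes from absolute estimates: the sum of 1 / |d_k| has true order log m / m, so
  its square is not o(m^-2) while its cube is. The square therefore has to be kept (on the diagonal,
  as the second sum in A_2) or treated by cancellation (off the diagonal). Replacing s + d_k by d_k
  costs |s| times the sum of 1 / d_k^2, that is |s| O(m^-2). This is why s = o(1) is required; it
  follows from q_m tending to 0 together with the smallness of the first sum.

  A single approximate eigenvector of the matrix determines only the modulus of s - A_2 and loses
  the sign, which is why two independent ones have to be compared.\<close>

lemmas AI_continuous = absolutely_integrable_continuous_real
lemmas HK_integral_add = Henstock_Kurzweil_Integration.integral_add
lemmas HK_integral_diff = Henstock_Kurzweil_Integration.integral_diff
lemmas HK_integral_cong = Henstock_Kurzweil_Integration.integral_cong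
lemmas HK_integral_combine = Henstock_Kurzweil_Integration.integral_combine
lemmas HK_integral_nonneg = Henstock_Kurzweil_Integration.integral_nonneg
lemmas HK_integral_restrict_Int = Henstock_Kurzweil_Integration.integral_restrict_Int

abbreviation (input) L1 :: "(real \<Rightarrow> 'a::euclidean_space) \<Rightarrow> bool" where
  "L1 f \<equiv> f absolutely_integrable_on {0..1}"

abbreviation (input) nrm1 :: "(real \<Rightarrow> complex) \<Rightarrow> real" where
  "nrm1 f \<equiv> integral {0..1} (\<lambda>x. norm (f x))"

section \<open>Periodic exponentials and elementary L_1 estimates\<close>

definition ch :: "int \<Rightarrow> real \<Rightarrow> complex" where
  "ch k x = cis (2 * pi * of_int k * x)"

text \<open>Complex-valued counterpart of \<open>fourier_coeff\<close>: eigenfunctions and products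
  with exponentials are not real.\<close>

definition fc :: "(real \<Rightarrow> complex) \<Rightarrow> int \<Rightarrow> complex" where
  "fc f k = integral {0..1} (\<lambda>x. f x * ch (- k) x)"

lemma norm_ch [simp]: "norm (ch k x) = 1"
  by (simp add: ch_def)

lemma ch_zero [simp]: "ch 0 x = 1" "ch k 0 = 1"
  by (simp_all add: ch_def)

lemma ch_one [simp]: "ch k 1 = 1"
  by (simp add: ch_def cis_multiple_2pi)

lemma ch_mult: "ch j x * ch k x = ch (j + k) x"
  by (simp add: ch_def cis_mult algebra_simps)

lemma ch_diff: "ch k (x - y) = ch k x * ch (- k) y"
  by (simp add: ch_def cis_mult algebra_simps)

lemma cnj_ch: "cnj (ch k x) = ch (- k) x"
  by (simp add: ch_def cis_cnj)

lemma continuous_on_ch [continuous_intros]: "continuous_on S (ch k)"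
  unfolding ch_def cis_conv_exp by (intro continuous_intros)

lemma has_vector_derivative_ch:
  "(ch k has_vector_derivative (2 * of_real pi * of_int k * \<i> * ch k x)) (at x within S)"
  unfolding ch_def cis_conv_exp
  by (rule has_vector_derivative_real_field derivative_eq_intros | simp add: algebra_simps)+

lemma fourier_coeff_eq: "fourier_coeff f k = fc (\<lambda>x. of_real (f x)) k"
  unfolding fourier_coeff_def fc_def ch_def cis_conv_exp
  by (simp add: algebra_simps)

lemma integrable_of_AI:
  fixes f :: "real \<Rightarrow> 'b::euclidean_space"
  shows "f absolutely_integrable_on S \<Longrightarrow> f integrable_on S"
  by (simp add: absolutely_integrable_on_def)

lemma integrable_norm_of_AI:
  fixes f :: "real \<Rightarrow> complex"
  shows "f absolutely_integrable_on S \<Longrightarrow> (\<lambda>x. norm (f x)) integrable_on S"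
  by (simp add: absolutely_integrable_on_def)

lemma AI_mult_cont:
  fixes f g :: "real \<Rightarrow> complex"
  assumes "f absolutely_integrable_on {a..b}" "continuous_on {a..b} g"
  shows "(\<lambda>x. f x * g x) absolutely_integrable_on {a..b}"
proof -
  have "(\<lambda>x. g x * f x) absolutely_integrable_on {a..b}"
  proof (rule absolutely_integrable_bounded_measurable_product[OF bilinear_times])
    show "g \<in> borel_measurable (lebesgue_on {a..b})"
      using assms(2) by (intro continuous_imp_measurable_on_sets_lebesgue) auto
    show "bounded (g ` {a..b})"
      using assms(2) compact_continuous_image compact_imp_bounded compact_Icc by blast
  qed (use assms in auto)
  then show ?thesis by (simp add: mult.commute)
qed

lemma norm_integral_mult_le:
  fixes f g :: "real \<Rightarrow> complex"
  assumes "f absolutely_integrable_on {a..b}" "continuous_on {a..b} g"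
    and "\<And>x. x \<in> {a..b} \<Longrightarrow> norm (g x) \<le> B"
  shows "norm (integral {a..b} (\<lambda>x. f x * g x)) \<le> B * integral {a..b} (\<lambda>x. norm (f x))"
proof -
  have "norm (integral {a..b} (\<lambda>x. f x * g x)) \<le> integral {a..b} (\<lambda>x. B * norm (f x))"
  proof (rule integral_norm_bound_integral)
    show "(\<lambda>x. f x * g x) integrable_on {a..b}"
      by (rule integrable_of_AI[OF AI_mult_cont[OF assms(1,2)]])
    show "(\<lambda>x. B * norm (f x)) integrable_on {a..b}"
      by (rule integrable_on_mult_right[OF integrable_norm_of_AI[OF assms(1)]])
    show "norm (f x * g x) \<le> B * norm (f x)" if "x \<in> {a..b}" for x
      using mult_left_mono[OF assms(3)[OF that] norm_ge_zero[of "f x"]] by (simp add: norm_mult mult.commute)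
  qed
  then show ?thesis by simp
qed

lemma integral_norm_nonneg:
  fixes f :: "real \<Rightarrow> complex"
  assumes "f absolutely_integrable_on S"
  shows "0 \<le> integral S (\<lambda>x. norm (f x))"
  by (rule integral_nonneg[OF integrable_norm_of_AI[OF assms]]) auto

lemma has_AC_derivative_AI: "has_AC_derivative f f' \<Longrightarrow> L1 f'"
  unfolding has_AC_derivative_def by (rule conjunct1)

lemma has_AC_derivative_eq:
  "has_AC_derivative f f' \<Longrightarrow> x \<in> {0..1} \<Longrightarrow> f x = f 0 + integral {0..x} f'"
  unfolding has_AC_derivative_def by (drule conjunct2) (rule bspec)

lemma has_AC_derivativeD:
  assumes "has_AC_derivative f f'" "0 \<le> a" "a \<le> b" "b \<le> 1"
  shows "f b - f a = integral {a..b} f'"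
proof -
  have ai: "L1 f'" using assms(1) by (rule has_AC_derivative_AI)
  have *: "f b = f 0 + integral {0..b} f'" "f a = f 0 + integral {0..a} f'"
    by (rule has_AC_derivative_eq[OF assms(1)]; use assms in simp)+
  have "f' integrable_on {0..b}"
    by (rule integrable_of_AI, rule absolutely_integrable_on_subinterval[OF ai]) (use assms in auto)
  then have "integral {0..a} f' + integral {a..b} f' = integral {0..b} f'"
    by (intro HK_integral_combine) (use assms in auto)
  then show ?thesis using * by (simp add: algebra_simps)
qed

lemma has_AC_derivative_continuous:
  assumes "has_AC_derivative f f'"
  shows "continuous_on {0..1} f"
proof -
  have "f' integrable_on {0..1}" by (rule integrable_of_AI[OF has_AC_derivative_AI[OF assms]])
  then have "continuous_on {0..1} (\<lambda>x. f 0 + integral {0..x} f')"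
    by (intro continuous_intros indefinite_integral_continuous_1)
  then show ?thesis
    by (rule continuous_on_eq) (rule has_AC_derivative_eq[OF assms, symmetric])
qed

lemma has_AC_derivative_cont_deriv:
  assumes "\<And>x. x \<in> {0..1} \<Longrightarrow> (f has_vector_derivative f' x) (at x within {0..1})"
    and "continuous_on {0..1} f'"
  shows "has_AC_derivative f f'"
  unfolding has_AC_derivative_def
proof (intro conjI ballI)
  show "L1 f'"
    by (rule AI_continuous[OF assms(2)])
  fix x :: real assume x: "x \<in> {0..1}"
  have "(f' has_integral f x - f 0) {0..x}"
    by (rule fundamental_theorem_of_calculus)
       (use x in \<open>auto intro!: has_vector_derivative_within_subset[OF assms(1)]\<close>)
  then show "f x = f 0 + integral {0..x} f'" by (simp add: integral_unique)
qed

lemma has_AC_derivative_integral: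
  assumes "L1 f"
  shows "has_AC_derivative (\<lambda>x. c + integral {0..x} f) f"
  using assms by (auto simp: has_AC_derivative_def)

text \<open>The defect of the product rule on an interval is at most the oscillation of the factors times the
  variation; refining the partition makes it vanish.\<close>

lemma has_AC_derivative_mult:
  assumes f: "has_AC_derivative f f'" and g: "has_AC_derivative g g'"
  shows "has_AC_derivative (\<lambda>x. f x * g x) (\<lambda>x. f' x * g x + f x * g' x)"
proof -
  have cf: "continuous_on {0..1} f" and cg: "continuous_on {0..1} g"
    by (rule has_AC_derivative_continuous[OF f] has_AC_derivative_continuous[OF g])+
  have af: "L1 f'" and ag: "L1 g'"
    by (rule has_AC_derivative_AI[OF f] has_AC_derivative_AI[OF g])+
  define h where "h = (\<lambda>x. f' x * g x + f x * g' x)"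
  have ah: "L1 h"
    unfolding h_def
    using set_integral_add(1)[OF AI_mult_cont[OF af cg] AI_mult_cont[OF ag cf]]
    by (simp add: mult.commute)
  define V where "V a b = integral {a..b} (\<lambda>x. norm (f' x)) + integral {a..b} (\<lambda>x. norm (g' x))" for a b
  define \<Phi> where "\<Phi> b = f b * g b - f 0 * g 0 - integral {0..b} h" for b
  have sub: "u absolutely_integrable_on {a..b}" if "L1 u" "0 \<le> a" "b \<le> 1"
    for u :: "real \<Rightarrow> complex" and a b
    by (rule absolutely_integrable_on_subinterval[OF that(1)]) (use that in auto)
  have nsub: "(\<lambda>x. norm (u x)) integrable_on {a..b}" if "L1 u" "0 \<le> a" "b \<le> 1"
    for u :: "real \<Rightarrow> complex" and a b
    by (rule integrable_norm_of_AI[OF sub[OF that]])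
  have step: "norm (\<Phi> b - \<Phi> a) \<le> w * V a b"
    if ab: "0 \<le> a" "a \<le> b" "b \<le> 1"
      and osc: "\<And>s t. s \<in> {a..b} \<Longrightarrow> t \<in> {a..b} \<Longrightarrow> norm (f s - f t) \<le> w \<and> norm (g s - g t) \<le> w" for a b w
  proof -
    have c1: "continuous_on {a..b} f" "continuous_on {a..b} g"
      using cf cg ab by (auto intro: continuous_on_subset)
    have 1: "integral {0..a} h + integral {a..b} h = integral {0..b} h"
      by (rule HK_integral_combine[OF ab(1,2)])
         (rule integrable_of_AI[OF sub[OF ah]]; use ab in simp)
    have af': "f' absolutely_integrable_on {a..b}" and ag': "g' absolutely_integrable_on {a..b}"
      by (rule sub[OF af ab(1,3)] sub[OF ag ab(1,3)])+
    have 2: "f b - f a = integral {a..b} f'" "g b - g a = integral {a..b} g'"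
      by (rule has_AC_derivativeD[OF f ab] has_AC_derivativeD[OF g ab])+
    have e1: "integral {a..b} (\<lambda>x. f' x * (g b - g x)) = integral {a..b} f' * g b - integral {a..b} (\<lambda>x. f' x * g x)"
    proof -
      have "integral {a..b} (\<lambda>x. f' x * g b - f' x * g x) = integral {a..b} (\<lambda>x. f' x * g b) - integral {a..b} (\<lambda>x. f' x * g x)"
        by (intro HK_integral_diff integrable_of_AI AI_mult_cont af' c1 continuous_intros)
      then show ?thesis by (simp add: algebra_simps)
    qed
    have e2: "integral {a..b} (\<lambda>x. g' x * (f a - f x)) = integral {a..b} g' * f a - integral {a..b} (\<lambda>x. g' x * f x)"
    proof -
      have "integral {a..b} (\<lambda>x. g' x * f a - g' x * f x) = integral {a..b} (\<lambda>x. g' x * f a) - integral {a..b} (\<lambda>x. g' x * f x)"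
        by (intro HK_integral_diff integrable_of_AI AI_mult_cont ag' c1 continuous_intros)
      then show ?thesis by (simp add: algebra_simps)
    qed
    have e3: "integral {a..b} h = integral {a..b} (\<lambda>x. f' x * g x) + integral {a..b} (\<lambda>x. g' x * f x)"
    proof -
      have "integral {a..b} (\<lambda>x. f' x * g x + g' x * f x) = integral {a..b} (\<lambda>x. f' x * g x) + integral {a..b} (\<lambda>x. g' x * f x)"
        by (intro HK_integral_add integrable_of_AI AI_mult_cont af' ag' c1)
      then show ?thesis by (simp add: h_def mult.commute)
    qed
    have "\<Phi> b - \<Phi> a = f b * g b - f a * g a - integral {a..b} h"
      using 1 by (simp add: \<Phi>_def algebra_simps)
    \<comment> \<open>Freezing \<open>g\<close> at the right end and \<open>f\<close> at the left
      end makes the increments add up exactly, so that only oscillations of \<open>f\<close> and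
      \<open>g\<close> on the interval remain.\<close>
    also have "f b * g b - f a * g a = (f b - f a) * g b + (g b - g a) * f a"
      by (simp add: algebra_simps)
    finally have eq: "\<Phi> b - \<Phi> a = integral {a..b} (\<lambda>x. f' x * (g b - g x)) + integral {a..b} (\<lambda>x. g' x * (f a - f x))"
      unfolding e1 e2 e3 2 by simp
    have "norm (integral {a..b} (\<lambda>x. f' x * (g b - g x))) \<le> w * integral {a..b} (\<lambda>x. norm (f' x))"
      by (intro norm_integral_mult_le af' continuous_intros c1) (use ab osc in auto)
    moreover have "norm (integral {a..b} (\<lambda>x. g' x * (f a - f x))) \<le> w * integral {a..b} (\<lambda>x. norm (g' x))"
      by (intro norm_integral_mult_le ag' continuous_intros c1) (use ab osc in auto)
    ultimately show ?thesis
      unfolding eq V_def using norm_triangle_ineq by (smt (verit) distrib_left)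
  qed
  have V0: "0 \<le> V a b" if "0 \<le> a" "b \<le> 1" for a b
    unfolding V_def using integral_norm_nonneg[OF sub[OF af that]] integral_norm_nonneg[OF sub[OF ag that]]
    by simp
  have Vadd: "V 0 a + V a b = V 0 b" if "0 \<le> a" "a \<le> b" "b \<le> 1" for a b
  proof -
    have "integral {0..a} (\<lambda>x. norm (f' x)) + integral {a..b} (\<lambda>x. norm (f' x)) = integral {0..b} (\<lambda>x. norm (f' x))"
      by (intro HK_integral_combine nsub af) (use that in auto)
    moreover have "integral {0..a} (\<lambda>x. norm (g' x)) + integral {a..b} (\<lambda>x. norm (g' x)) = integral {0..b} (\<lambda>x. norm (g' x))"
      by (intro HK_integral_combine nsub ag) (use that in auto)
    ultimately show ?thesis by (simp add: V_def)
  qed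
  have small: "norm (\<Phi> x) \<le> w * V 0 x" if x: "x \<in> {0..1}" and w: "w > 0" for x w
  proof -
    have "uniformly_continuous_on {0..1} f" "uniformly_continuous_on {0..1} g"
      using cf cg compact_uniformly_continuous by auto
    then obtain d1 d2 where d1: "d1 > 0" "\<And>s t. s \<in> {0..1} \<Longrightarrow> t \<in> {0..1} \<Longrightarrow> dist t s < d1 \<Longrightarrow> dist (f t) (f s) < w"
      and d2: "d2 > 0" "\<And>s t. s \<in> {0..1} \<Longrightarrow> t \<in> {0..1} \<Longrightarrow> dist t s < d2 \<Longrightarrow> dist (g t) (g s) < w"
      using w unfolding uniformly_continuous_on_def by metis
    define d where "d = min d1 d2 / 2"
    have d: "d > 0" "d < d1" "d < d2" using d1 d2 by (auto simp: d_def)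
    \<comment> \<open>Induction in steps of length \<open>d\<close> takes the place of an explicit
      partition; on each step both factors oscillate by at most \<open>w\<close>.\<close>
    have *: "\<forall>y\<in>{0..1}. y \<le> real N * d \<longrightarrow> norm (\<Phi> y) \<le> w * V 0 y" for N
    proof (induction N)
      case 0
      then show ?case using V0 w by (auto simp: \<Phi>_def)
    next
      case (Suc N)
      show ?case
      proof (intro ballI impI)
        fix y :: real assume y: "y \<in> {0..1}" "y \<le> real (Suc N) * d"
        define a where "a = max 0 (y - d)"
        have a: "0 \<le> a" "a \<le> y" "y \<le> 1" "a \<le> real N * d" "y - a \<le> d"
          using y d by (auto simp: a_def algebra_simps)
        have "norm (\<Phi> a) \<le> w * V 0 a" using Suc a by auto
        moreover have "norm (\<Phi> y - \<Phi> a) \<le> w * V a y"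
        proof (rule step)
          fix s t assume st: "s \<in> {a..y}" "t \<in> {a..y}"
          then have "dist s t < d1" "dist s t < d2" using a d by (auto simp: dist_real_def)
          then show "norm (f s - f t) \<le> w \<and> norm (g s - g t) \<le> w"
            using d1(2)[of t s] d2(2)[of t s] st a by (auto simp: dist_norm)
        qed (use a in auto)
        ultimately have "norm (\<Phi> y) \<le> w * (V 0 a + V a y)"
          using norm_triangle_ineq[of "\<Phi> y - \<Phi> a" "\<Phi> a"] by (simp add: distrib_left)
        then show "norm (\<Phi> y) \<le> w * V 0 y" using Vadd a by simp
      qed
    qed
    obtain N :: nat where "1 / d \<le> real N" using real_arch_simple by blast
    then have "1 \<le> real N * d" using d by (simp add: field_simps)
    then show ?thesis using *[of N] x by auto
  qed
  have zero: "\<Phi> x = 0" if x: "x \<in> {0..1}" for x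
  proof (rule ccontr)
    assume n: "\<Phi> x \<noteq> 0"
    have V: "V 0 x \<ge> 0" using V0 x by auto
    \<comment> \<open>This \<open>w\<close> leaves less than half of the norm on the right; the
      summand 1 covers the case of zero variation.\<close>
    then have "norm (\<Phi> x) \<le> (norm (\<Phi> x) / (2 * (V 0 x + 1))) * V 0 x"
      using small[OF x, of "norm (\<Phi> x) / (2 * (V 0 x + 1))"] n by (auto simp: field_simps)
    also have "\<dots> < norm (\<Phi> x)"
    proof -
      have "V 0 x / (2 * (V 0 x + 1)) < 1" using V by (simp add: field_simps)
      then have "norm (\<Phi> x) * (V 0 x / (2 * (V 0 x + 1))) < norm (\<Phi> x) * 1"
        using n by (intro mult_strict_left_mono) auto
      then show ?thesis by simp
    qed
    finally show False by simp
  qed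
  have "f x * g x = f 0 * g 0 + integral {0..x} h" if "x \<in> {0..1}" for x
  proof -
    have "f x * g x - (f 0 * g 0 + integral {0..x} h) = 0"
      using zero[OF that] unfolding \<Phi>_def by (simp only: diff_diff_eq)
    then show ?thesis by (simp only: right_minus_eq)
  qed
  then show ?thesis
    using ah unfolding has_AC_derivative_def h_def by blast
qed

subsection \<open>The Riemann-Lebesgue lemma\<close>

lemma AI_iff_integrable_lebesgue_on:
  fixes f :: "real \<Rightarrow> complex"
  shows "L1 f \<longleftrightarrow> integrable (lebesgue_on {0..1}) f"
  by (simp add: integrable_restrict_space set_integrable_def)

lemma AI_mult_ch:
  "f absolutely_integrable_on {a..b} \<Longrightarrow> (\<lambda>x. f x * ch k x) absolutely_integrable_on {a..b}"
  by (rule AI_mult_cont[OF _ continuous_on_ch])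

lemma integral_ch: "integral {0..1} (ch k) = (if k = 0 then 1 else 0)"
proof (cases "k = 0")
  case True
  then have "ch k = (\<lambda>x. 1)" by (auto simp: fun_eq_iff)
  then show ?thesis using True by simp
next
  case False
  let ?c = "2 * of_real pi * of_int k * \<i> :: complex"
  have "((\<lambda>x. ?c * ch k x) has_integral ch k 1 - ch k 0) {0..1}"
    by (rule fundamental_theorem_of_calculus) (auto intro: has_vector_derivative_ch)
  then have "integral {0..1} (\<lambda>x. ?c * ch k x) = ch k 1 - ch k 0"
    by (rule integral_unique)
  then show ?thesis using False by simp
qed

lemma fc_bound:
  assumes "L1 f"
  shows "norm (fc f k) \<le> nrm1 f"
  unfolding fc_def using norm_integral_mult_le[OF assms continuous_on_ch, where B=1 and k1="-k"] by simp

lemma fc_add: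
  assumes "L1 f" "L1 g"
  shows "fc (\<lambda>x. f x + g x) k = fc f k + fc g k"
  unfolding fc_def distrib_right
  by (rule HK_integral_add; rule integrable_of_AI; rule AI_mult_ch; fact)

lemma fc_diff:
  assumes "L1 f" "L1 g"
  shows "fc (\<lambda>x. f x - g x) k = fc f k - fc g k"
  unfolding fc_def left_diff_distrib
  by (rule HK_integral_diff; rule integrable_of_AI; rule AI_mult_ch; fact)

lemma fc_cmult: "fc (\<lambda>x. c * f x) k = c * fc f k"
  unfolding fc_def by (simp add: mult.assoc)

lemma fc_mult_ch: "fc (\<lambda>x. f x * ch j x) k = fc f (k - j)"
  unfolding fc_def by (simp add: mult.assoc ch_mult)

lemma fc_ch: "fc (ch j) k = (if j = k then 1 else 0)"
  unfolding fc_def by (simp add: ch_mult integral_ch)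

lemma fc_cong: "(\<And>x. x \<in> {0..1} \<Longrightarrow> f x = g x) \<Longrightarrow> fc f k = fc g k"
  unfolding fc_def by (rule HK_integral_cong) simp

text \<open>The starting case of Riemann-Lebesgue: indicators are bounded, and their linear
  combinations are dense in L_1. The inequality is the nonnegativity of the integral of |h - P|^2
  for the Fourier sum \<open>P\<close> over \<open>K\<close>.\<close>

lemma bessel_indicator:
  assumes A: "A \<in> sets lebesgue" "A \<subseteq> {0..1}" and K: "finite K"
  shows "(\<Sum>k\<in>K. (norm (fc (indicator A) k))\<^sup>2) \<le> 1"
proof -
  define h :: "real \<Rightarrow> complex" where "h = indicator A"
  define a where "a k = fc h k" for k
  define P where "P x = (\<Sum>k\<in>K. a k * ch k x)" for x
  have Al: "A \<in> lmeasurable"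
    using A bounded_subset[OF bounded_closed_interval] by (intro bounded_set_imp_lmeasurable) auto
  have Ai: "A \<inter> {0..1} \<in> lmeasurable" using Al A(2) by (simp add: Int_absorb2)
  have hI: "L1 h"
  proof -
    have "L1 (\<lambda>x. (if x \<in> A then 1 else 0) :: complex)"
    proof (rule absolutely_integrable_onI)
      show "(\<lambda>x. (if x \<in> A then 1 else 0) :: complex) integrable_on {0..1}"
        unfolding integrable_restrict_Int by (rule integrable_on_const[OF Ai])
      have "(\<lambda>x. (if x \<in> A then 1 else 0) :: real) integrable_on {0..1}"
        unfolding integrable_restrict_Int by (rule integrable_on_const[OF Ai])
      moreover have "(\<lambda>x. cmod (if x \<in> A then 1 else 0)) = (\<lambda>x. if x \<in> A then 1 else 0)" by auto
      ultimately show "(\<lambda>x. cmod (if x \<in> A then 1 else 0)) integrable_on {0..1}" by simp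
    qed
    moreover have "h = (\<lambda>x. if x \<in> A then 1 else 0)" by (auto simp: h_def indicator_def)
    ultimately show ?thesis by (simp only:)
  qed
  have Pc: "continuous_on {0..1} P" unfolding P_def by (intro continuous_intros)
  have cPc: "continuous_on {0..1} (\<lambda>x. cnj (P x))" by (intro continuous_intros Pc)
  have cnj_a: "integral {0..1} (\<lambda>x. h x * ch k x) = cnj (a k)" for k
  proof -
    have "cnj (a k) = integral {0..1} (\<lambda>x. cnj (h x * ch (-k) x))"
      unfolding a_def fc_def
      using integral_linear[OF integrable_of_AI[OF AI_mult_ch[OF hI]] bounded_linear_cnj] by (simp add: o_def)
    also have "(\<lambda>x. cnj (h x * ch (-k) x)) = (\<lambda>x. h x * ch k x)"
      by (auto simp: fun_eq_iff h_def indicator_def cnj_ch)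
    finally show ?thesis by simp
  qed
  have hch: "(\<lambda>x. h x * ch k x) integrable_on {0..1}" for k
    by (rule integrable_of_AI[OF AI_mult_ch[OF hI]])
  let ?S = "\<Sum>k\<in>K. a k * cnj (a k)"
  have i1: "integral {0..1} (\<lambda>x. h x * P x) = ?S"
  proof -
    have E: "(\<lambda>x. h x * P x) = (\<lambda>x. \<Sum>k\<in>K. a k * (h x * ch k x))"
      by (auto simp: P_def sum_distrib_left fun_eq_iff algebra_simps)
    have "integral {0..1} (\<lambda>x. h x * P x) = (\<Sum>k\<in>K. integral {0..1} (\<lambda>x. a k * (h x * ch k x)))"
      unfolding E by (rule integral_sum[OF K]) (intro integrable_on_mult_right hch)
    then show ?thesis using cnj_a by simp
  qed
  have i2: "integral {0..1} (\<lambda>x. h x * cnj (P x)) = ?S"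
  proof -
    have E: "(\<lambda>x. h x * cnj (P x)) = (\<lambda>x. \<Sum>k\<in>K. cnj (a k) * (h x * ch (-k) x))"
      by (auto simp: P_def sum_distrib_left fun_eq_iff algebra_simps cnj_ch)
    have "integral {0..1} (\<lambda>x. h x * cnj (P x)) = (\<Sum>k\<in>K. integral {0..1} (\<lambda>x. cnj (a k) * (h x * ch (-k) x)))"
      unfolding E by (rule integral_sum[OF K]) (intro integrable_on_mult_right hch)
    then show ?thesis by (simp add: a_def fc_def mult.commute)
  qed
  have i3: "integral {0..1} (\<lambda>x. P x * cnj (P x)) = ?S"
  proof -
    have E: "(\<lambda>x. P x * cnj (P x)) = (\<lambda>x. \<Sum>k\<in>K. \<Sum>j\<in>K. (a k * cnj (a j)) * ch (k-j) x)"
      by (auto simp: P_def sum_product fun_eq_iff cnj_ch intro!: sum.cong)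
         (metis (no_types, lifting) ab_group_add_class.ab_diff_conv_add_uminus ch_mult mult.assoc mult.commute)
    have "integral {0..1} (\<lambda>x. P x * cnj (P x)) = (\<Sum>k\<in>K. integral {0..1} (\<lambda>x. \<Sum>j\<in>K. (a k * cnj (a j)) * ch (k-j) x))"
      unfolding E by (rule integral_sum[OF K]) (intro integrable_continuous_real continuous_intros)
    also have "\<dots> = (\<Sum>k\<in>K. \<Sum>j\<in>K. integral {0..1} (\<lambda>x. (a k * cnj (a j)) * ch (k-j) x))"
      by (intro sum.cong refl integral_sum[OF K]) (intro integrable_continuous_real continuous_intros)
    also have "\<dots> = (\<Sum>k\<in>K. \<Sum>j\<in>K. if j = k then a k * cnj (a j) else 0)"
      by (intro sum.cong refl) (auto simp: integral_ch)
    also have "\<dots> = ?S" using K by simp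
    finally show ?thesis .
  qed
  \<comment> \<open>As \<open>h\<close> takes the values 0 and 1, \<open>h * cnj h\<close> equals
    \<open>h\<close>, whose integral is at most 1.\<close>
  have "integral {0..1} (\<lambda>x. (h x - P x) * cnj (h x - P x))
      = integral {0..1} (\<lambda>x. (h x - h x * cnj (P x)) - (h x * P x - P x * cnj (P x)))"
    by (rule HK_integral_cong) (auto simp: h_def indicator_def algebra_simps)
  also have "\<dots> = integral {0..1} (\<lambda>x. h x - h x * cnj (P x)) - integral {0..1} (\<lambda>x. h x * P x - P x * cnj (P x))"
    by (intro HK_integral_diff integrable_diff integrable_of_AI[OF hI] integrable_of_AI[OF AI_mult_cont[OF hI]]
        Pc cPc integrable_continuous_real continuous_intros)
  also have "\<dots> = (integral {0..1} h - ?S) - (?S - ?S)"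
    unfolding i1[symmetric]
    by (subst (1 2) HK_integral_diff)
      (intro HK_integral_diff integrable_diff integrable_of_AI[OF hI] integrable_of_AI[OF AI_mult_cont[OF hI]]
        Pc cPc integrable_continuous_real continuous_intros | simp add: i1 i2 i3)+
  finally have eq: "integral {0..1} (\<lambda>x. (h x - P x) * cnj (h x - P x)) = integral {0..1} h - ?S" by simp
  have int: "(\<lambda>x. (h x - P x) * cnj (h x - P x)) integrable_on {0..1}"
  proof -
    have "(\<lambda>x. (h x - h x * cnj (P x)) - (h x * P x - P x * cnj (P x))) integrable_on {0..1}"
      by (intro integrable_diff integrable_of_AI[OF hI] integrable_of_AI[OF AI_mult_cont[OF hI]]
        Pc cPc integrable_continuous_real continuous_intros)
    then show ?thesis
      by (rule integrable_eq) (auto simp: h_def indicator_def algebra_simps)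
  qed
  have "0 \<le> Re (integral {0..1} (\<lambda>x. (h x - P x) * cnj (h x - P x)))"
  proof -
    have "Re (integral {0..1} (\<lambda>x. (h x - P x) * cnj (h x - P x)))
        = integral {0..1} (\<lambda>x. Re ((h x - P x) * cnj (h x - P x)))"
      using integral_linear[OF int bounded_linear_Re] by (simp add: o_def)
    also have "\<dots> \<ge> 0"
    proof (rule HK_integral_nonneg[OF integrable_linear[OF int bounded_linear_Re, unfolded o_def]])
      show "0 \<le> Re ((h x - P x) * cnj (h x - P x))" for x
        by (subst complex_norm_square[symmetric]) simp
    qed
    finally show ?thesis .
  qed
  moreover have "Re ?S = (\<Sum>k\<in>K. (norm (a k))\<^sup>2)"
    by (simp add: complex_mult_cnj cmod_power2)
  moreover have "Re (integral {0..1} h) \<le> 1"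
  proof -
    have "norm (integral {0..1} h) \<le> integral {0..1::real} (\<lambda>x. 1::real)"
      by (rule integral_norm_bound_integral[OF integrable_of_AI[OF hI]]) (auto simp: h_def indicator_def)
    then show ?thesis using complex_Re_le_cmod[of "integral {0..1} h"] by simp
  qed
  ultimately show ?thesis using eq by (simp add: a_def h_def)
qed

text \<open>Riemann-Lebesgue in the form of finiteness, which covers both ends of the integers at
  once. Bessel settles indicators, since N coefficients of size d force N d^2 <= 1; the property
  passes to sums by halving \<open>e\<close>, and to L_1 limits because a coefficient moves by at
  most the L_1 distance.\<close>

lemma finite_large_fc:
  assumes "L1 f" "e > 0"
  shows "finite {k. norm (fc f k) \<ge> e}"
proof -
  have "integrable (lebesgue_on {0..1}) f" using assms AI_iff_integrable_lebesgue_on by simp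
  then have "\<forall>e>0. finite {k. norm (fc f k) \<ge> e}"
  proof (induction rule: integrable_induct)
    case (base A c)
    have A: "A \<in> sets lebesgue" "A \<subseteq> {0..1}"
      using base(1) by (auto simp: sets_restrict_space)
    show ?case
    proof (intro allI impI)
      fix e :: real assume e: "e > 0"
      have eq: "fc (\<lambda>x. indicator A x *\<^sub>R c) k = c * fc (indicator A) k" for k
        unfolding fc_cmult[symmetric] by (rule fc_cong) (simp add: indicator_def)
      show "finite {k. norm (fc (\<lambda>x. indicator A x *\<^sub>R c) k) \<ge> e}"
      proof (cases "c = 0")
        case True
        then show ?thesis using e unfolding eq by simp
      next
        case False
        define d where "d = e / norm c"
        have d: "d > 0" using e False by (simp add: d_def)
        have "finite {k. norm (fc (indicator A) k) \<ge> d}"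
        proof (rule ccontr)
          assume inf: "infinite {k. norm (fc (indicator A) k) \<ge> d}"
          obtain N :: nat where N: "1 / d\<^sup>2 < real N" using reals_Archimedean2 by blast
          obtain K where K: "finite K" "card K = N" "K \<subseteq> {k. norm (fc (indicator A) k) \<ge> d}"
            using infinite_arbitrarily_large[OF inf] by blast
          have "real N * d\<^sup>2 = (\<Sum>k\<in>K. d\<^sup>2)" using K by simp
          also have "\<dots> \<le> (\<Sum>k\<in>K. (norm (fc (indicator A) k))\<^sup>2)"
            using K d by (intro sum_mono power_mono) auto
          also have "\<dots> \<le> 1" by (rule bessel_indicator[OF A K(1)])
          finally show False using N d by (simp add: field_simps)
        qed
        moreover have "{k. norm (fc (\<lambda>x. indicator A x *\<^sub>R c) k) \<ge> e} \<subseteq> {k. norm (fc (indicator A) k) \<ge> d}"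
          using False by (auto simp: eq d_def norm_mult field_simps)
        ultimately show ?thesis using finite_subset by blast
      qed
    qed
  next
    case (add f g)
    have "L1 f" "L1 g"
      using add AI_iff_integrable_lebesgue_on by simp_all
    note eq = fc_add[OF this]
    show ?case
    proof (intro allI impI)
      fix e :: real assume e: "e > 0"
      have "{k. norm (fc (\<lambda>x. f x + g x) k) \<ge> e} \<subseteq> {k. norm (fc f k) \<ge> e/2} \<union> {k. norm (fc g k) \<ge> e/2}"
      proof
        fix k assume "k \<in> {k. norm (fc (\<lambda>x. f x + g x) k) \<ge> e}"
        then have "e \<le> norm (fc f k) + norm (fc g k)"
          using norm_triangle_ineq[of "fc f k" "fc g k"] by (simp add: eq)
        then show "k \<in> {k. norm (fc f k) \<ge> e/2} \<union> {k. norm (fc g k) \<ge> e/2}" by auto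
      qed
      moreover have "finite ({k. norm (fc f k) \<ge> e/2} \<union> {k. norm (fc g k) \<ge> e/2})"
        using add e by (meson finite_UnI half_gt_zero)
      ultimately show "finite {k. norm (fc (\<lambda>x. f x + g x) k) \<ge> e}" using finite_subset by blast
    qed
  next
    case (lim f s)
    have sI: "L1 (s i)" and fI: "L1 f" for i
      using lim AI_iff_integrable_lebesgue_on by simp_all
    have dI: "L1 (\<lambda>x. f x - s i x)" for i
      using set_integral_diff(1)[OF fI sI] .
    have "(\<lambda>i. integral\<^sup>L (lebesgue_on {0..1}) (\<lambda>x. norm (f x - s i x))) \<longlonglongrightarrow> integral\<^sup>L (lebesgue_on {0..1::real}) (\<lambda>x. 0::real)"
    \<comment> \<open>The induction principle supplies |s_i| <= 2 |f|, whence the majorant 3 |f| of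
      |f - s_i|.\<close>
    proof (rule integral_dominated_convergence[where w="\<lambda>x. 3 * norm (f x)"])
      show "AE x in lebesgue_on {0..1}. (\<lambda>i. norm (f x - s i x)) \<longlonglongrightarrow> 0"
      proof (rule AE_I2)
        fix x assume "x \<in> space (lebesgue_on {0..1::real})"
        then have "(\<lambda>i. f x - s i x) \<longlonglongrightarrow> f x - f x"
          using lim by (intro tendsto_diff tendsto_const) blast
        then show "(\<lambda>i. norm (f x - s i x)) \<longlonglongrightarrow> 0"
          using tendsto_norm_zero by fastforce
      qed
      show "AE x in lebesgue_on {0..1}. norm (norm (f x - s i x)) \<le> 3 * norm (f x)" for i
      proof (rule AE_I2)
        fix x assume "x \<in> space (lebesgue_on {0..1::real})"
        then have "norm (s i x) \<le> 2 * norm (f x)" using lim by blast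
        then show "norm (norm (f x - s i x)) \<le> 3 * norm (f x)"
          using norm_triangle_ineq4[of "f x" "s i x"] by simp
      qed
    qed (use lim in auto)
    moreover have "integral\<^sup>L (lebesgue_on {0..1}) (\<lambda>x. norm (f x - s i x)) = nrm1 (\<lambda>x. f x - s i x)" for i
      by (rule lebesgue_integral_eq_integral) (use lim in auto)
    ultimately have L: "(\<lambda>i. nrm1 (\<lambda>x. f x - s i x)) \<longlonglongrightarrow> 0" by simp
    show ?case
    proof (intro allI impI)
      fix e :: real assume e: "e > 0"
      obtain i where i: "nrm1 (\<lambda>x. f x - s i x) < e/2"
        using order_tendstoD(2)[OF L, of "e/2"] e by (auto simp: eventually_sequentially)
      have "{k. norm (fc f k) \<ge> e} \<subseteq> {k. norm (fc (s i) k) \<ge> e/2}"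
      proof
        fix k assume k: "k \<in> {k. norm (fc f k) \<ge> e}"
        have "norm (fc f k - fc (s i) k) < e/2"
          using fc_bound[OF dI, of i k] i by (simp add: fc_diff[OF fI sI])
        then show "k \<in> {k. norm (fc (s i) k) \<ge> e/2}"
          using k norm_triangle_ineq2[of "fc f k" "fc (s i) k"] by simp
      qed
      moreover have "finite {k. norm (fc (s i) k) \<ge> e/2}" using lim e half_gt_zero by blast
      ultimately show "finite {k. norm (fc f k) \<ge> e}" by (rule finite_subset)
    qed
  qed
  then show ?thesis using assms by blast
qed

text \<open>Truncating \<open>f\<close> at the points i / N gives finitely many L_1 functions, each
  with finitely many large coefficients. Between neighbouring points a partial integral changes by
  less than e / 2, by uniform continuity of the integral of |f|.\<close>

lemma finite_large_partial_fc:
  assumes f: "L1 f" and e: "e > 0"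
  shows "finite {k. \<exists>x\<in>{0..1}. norm (integral {0..x} (\<lambda>t. f t * ch (- k) t)) \<ge> e}"
proof -
  define V where "V x = integral {0..x} (\<lambda>x. norm (f x))" for x
  have nI: "(\<lambda>x. norm (f x)) integrable_on {0..1}" by (rule integrable_norm_of_AI[OF f])
  have "continuous_on {0..1} V"
    unfolding V_def by (rule indefinite_integral_continuous_1[OF nI])
  then have "uniformly_continuous_on {0..1} V" by (rule compact_uniformly_continuous) simp
  then obtain d where d: "d > 0" "\<And>s t. s \<in> {0..1} \<Longrightarrow> t \<in> {0..1} \<Longrightarrow> dist t s < d \<Longrightarrow> dist (V t) (V s) < e/2"
    using e unfolding uniformly_continuous_on_def by (metis half_gt_zero)
  obtain N :: nat where N: "1 / d < real N" using reals_Archimedean2 by blast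
  have N0: "real N > 0" using N d(1) by (meson divide_pos_pos less_trans zero_less_one)
  define F where "F c x = (if x \<in> {0..c} then f x else 0)" for c x :: real
  have FI: "L1 (F c)" if "c \<le> 1" for c
  proof (rule absolutely_integrable_onI)
    have sub: "{0..c} \<inter> {0..1} = {0..c}" using that by auto
    have fc: "f absolutely_integrable_on {0..c}"
      by (rule absolutely_integrable_on_subinterval[OF f]) (use that in auto)
    show "F c integrable_on {0..1}"
      unfolding F_def integrable_restrict_Int sub by (rule integrable_of_AI[OF fc])
    have "(\<lambda>x. norm (F c x)) = (\<lambda>x. if x \<in> {0..c} then norm (f x) else 0)"
      by (auto simp: F_def)
    then show "(\<lambda>x. norm (F c x)) integrable_on {0..1}"
      by (simp only: integrable_restrict_Int sub integrable_norm_of_AI[OF fc])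
  qed
  have Ffc: "fc (F c) k = integral {0..c} (\<lambda>t. f t * ch (- k) t)" if "c \<le> 1" for c k
  proof -
    have sub: "{0..c} \<inter> {0..1} = {0..c}" using that by auto
    have "fc (F c) k = integral {0..1} (\<lambda>x. if x \<in> {0..c} then f x * ch (- k) x else 0)"
      unfolding fc_def by (rule HK_integral_cong) (auto simp: F_def)
    then show ?thesis by (simp only: HK_integral_restrict_Int sub)
  qed
  have "{k. \<exists>x\<in>{0..1}. norm (integral {0..x} (\<lambda>t. f t * ch (- k) t)) \<ge> e}
      \<subseteq> (\<Union>i\<in>{..N}. {k. norm (fc (F (real i / real N)) k) \<ge> e/2})"
  proof
    fix k assume "k \<in> {k. \<exists>x\<in>{0..1}. norm (integral {0..x} (\<lambda>t. f t * ch (- k) t)) \<ge> e}"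
    then obtain x where x: "0 \<le> x" "x \<le> 1" "norm (integral {0..x} (\<lambda>t. f t * ch (- k) t)) \<ge> e" by auto
    define i where "i = nat \<lfloor>x * real N\<rfloor>"
    have i: "real i \<le> x * real N" "x * real N < real i + 1"
      using x(1) N0 by (auto simp: i_def)
    define c where "c = real i / real N"
    have "x < (real i + 1) / real N" using i N0 by (simp add: pos_less_divide_eq)
    then have c: "0 \<le> c" "c \<le> x" "x - c < 1 / real N"
      using i N0 by (auto simp: c_def pos_divide_le_eq add_divide_distrib)
    have "1 / real N < d" using N N0 d(1) by (simp add: field_simps)
    then have "dist x c < d" using c by (simp add: dist_real_def)
    then have "dist (V x) (V c) < e/2" using d(2)[of c x] c x by auto
    moreover have "V c + integral {c..x} (\<lambda>x. norm (f x)) = V x"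
      unfolding V_def by (rule HK_integral_combine[OF c(1,2)])
        (rule integrable_subinterval_real[OF nI]; use x in auto)
    ultimately have "integral {c..x} (\<lambda>x. norm (f x)) < e/2"
      unfolding dist_real_def by linarith
    moreover have "norm (integral {c..x} (\<lambda>t. f t * ch (- k) t)) \<le> 1 * integral {c..x} (\<lambda>x. norm (f x))"
      by (rule norm_integral_mult_le[OF absolutely_integrable_on_subinterval[OF f] continuous_on_ch])
         (use c x in auto)
    moreover have "integral {0..c} (\<lambda>t. f t * ch (- k) t) + integral {c..x} (\<lambda>t. f t * ch (- k) t)
        = integral {0..x} (\<lambda>t. f t * ch (- k) t)"
      by (rule HK_integral_combine[OF c(1,2)],
          rule integrable_of_AI, rule AI_mult_ch, rule absolutely_integrable_on_subinterval[OF f])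
         (use x in auto)
    ultimately have "norm (integral {0..c} (\<lambda>t. f t * ch (- k) t)) \<ge> e/2"
      using x(3) norm_triangle_ineq[of "integral {0..c} (\<lambda>t. f t * ch (- k) t)" "integral {c..x} (\<lambda>t. f t * ch (- k) t)"]
      by simp
    then have "norm (fc (F c) k) \<ge> e/2" using Ffc c x by simp
    moreover have "i \<le> N"
    proof -
      have "x * real N \<le> 1 * real N" using x by (intro mult_right_mono) auto
      then have "real i \<le> real N" using i(1) by linarith
      then show ?thesis by simp
    qed
    ultimately show "k \<in> (\<Union>i\<in>{..N}. {k. norm (fc (F (real i / real N)) k) \<ge> e/2})"
      unfolding c_def by auto
  qed
  moreover have "finite (\<Union>i\<in>{..N}. {k. norm (fc (F (real i / real N)) k) \<ge> e/2})"
  proof (intro finite_UN_I finite_atMost finite_large_fc FI)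
    fix i assume "i \<in> {..N}" then show "real i / real N \<le> 1" using N0 by (simp add: field_simps)
  qed (use e in simp)
  ultimately show ?thesis by (rule finite_subset)
qed

lemma fc_tendsto_zero:
  assumes "L1 f" "inj r"
  shows "(\<lambda>n::nat. fc f (r n)) \<longlonglongrightarrow> 0"
proof (rule LIMSEQ_I)
  fix e :: real assume "e > 0"
  then have "finite (r -` {k. norm (fc f k) \<ge> e})"
    by (intro finite_vimageI finite_large_fc assms)
  then obtain N where "\<forall>n\<in>r -` {k. norm (fc f k) \<ge> e}. n < N"
    using finite_nat_set_iff_bounded by blast
  then show "\<exists>no. \<forall>n\<ge>no. norm (fc f (r n) - 0) < e"
    by (intro exI[of _ N]) (force simp: not_le)
qed

subsection \<open>Fourier inversion for absolutely summable coefficients\<close>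

lemma has_AC_derivative_ch:
  "has_AC_derivative (ch k) (\<lambda>x. 2 * of_real pi * of_int k * \<i> * ch k x)"
  by (rule has_AC_derivative_cont_deriv) (intro has_vector_derivative_ch continuous_intros)+

lemma integral_by_parts_AC:
  assumes f: "has_AC_derivative f f'" and g: "has_AC_derivative g g'"
  shows "integral {0..1} (\<lambda>x. f' x * g x) = f 1 * g 1 - f 0 * g 0 - integral {0..1} (\<lambda>x. g' x * f x)"
proof -
  have 1: "(\<lambda>x. f' x * g x) integrable_on {0..1}" "(\<lambda>x. g' x * f x) integrable_on {0..1}"
    by (rule integrable_of_AI[OF AI_mult_cont]; rule has_AC_derivative_AI[OF f] has_AC_derivative_AI[OF g]
        has_AC_derivative_continuous[OF f] has_AC_derivative_continuous[OF g])+
  have "f 1 * g 1 - f 0 * g 0 = integral {0..1} (\<lambda>x. f' x * g x + f x * g' x)"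
    by (rule has_AC_derivativeD[OF has_AC_derivative_mult[OF f g]]) auto
  also have "(\<lambda>x. f' x * g x + f x * g' x) = (\<lambda>x. f' x * g x + g' x * f x)"
    by (simp add: mult.commute)
  also have "integral {0..1} \<dots> = integral {0..1} (\<lambda>x. f' x * g x) + integral {0..1} (\<lambda>x. g' x * f x)"
    by (rule HK_integral_add[OF 1])
  finally show ?thesis by simp
qed

lemma fc_AC_derivative:
  assumes "has_AC_derivative f f'"
  shows "fc f' k = f 1 - f 0 + 2 * of_real pi * of_int k * \<i> * fc f k"
proof -
  have "fc f' k = f 1 - f 0 - integral {0..1} (\<lambda>x. (2 * of_real pi * of_int (-k) * \<i> * ch (-k) x) * f x)"
    unfolding fc_def using integral_by_parts_AC[OF assms has_AC_derivative_ch, of "-k"] by simp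
  also have "(\<lambda>x. (2 * of_real pi * of_int (-k) * \<i> * ch (-k) x) * f x)
      = (\<lambda>x. - (2 * of_real pi * of_int k * \<i>) * (f x * ch (-k) x))"
    by (auto simp: fun_eq_iff)
  finally show ?thesis by (simp add: fc_def)
qed

lemma has_vector_derivative_imp_quotient_tendsto:
  fixes f :: "real \<Rightarrow> complex"
  assumes "(f has_vector_derivative D) (at x within S)"
  shows "((\<lambda>y. (f y - f x) / of_real (y - x)) \<longlongrightarrow> D) (at x within S)"
proof -
  have "((\<lambda>y. (1 / norm (y - x)) *\<^sub>R (f y - (f x + (y - x) *\<^sub>R D))) \<longlongrightarrow> 0) (at x within S)"
    using assms unfolding has_vector_derivative_def has_derivative_within by blast
  then have "((\<lambda>y. norm ((1 / norm (y - x)) *\<^sub>R (f y - (f x + (y - x) *\<^sub>R D)))) \<longlongrightarrow> 0) (at x within S)"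
    by (rule tendsto_norm_zero)
  then have "((\<lambda>y. norm ((f y - f x) / of_real (y - x) - D)) \<longlongrightarrow> 0) (at x within S)"
  proof (rule Lim_transform_eventually)
    have "norm ((1 / norm (y - x)) *\<^sub>R (f y - (f x + (y - x) *\<^sub>R D))) = norm ((f y - f x) / of_real (y - x) - D)"
      if "y \<noteq> x" for y
    proof -
      have "(f y - f x) / of_real (y - x) - D = (f y - (f x + (y - x) *\<^sub>R D)) / of_real (y - x)"
        using that by (simp add: diff_divide_distrib add_divide_distrib scaleR_conv_of_real)
      then show ?thesis by (simp add: norm_divide del: of_real_diff)
    qed
    then show "\<forall>\<^sub>F y in at x within S. norm ((1 / norm (y - x)) *\<^sub>R (f y - (f x + (y - x) *\<^sub>R D))) = norm ((f y - f x) / of_real (y - x) - D)"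
      by (auto simp: eventually_at_filter)
  qed
  then show ?thesis using LIM_zero_cancel tendsto_norm_zero_iff by blast
qed

lemma ch_eq_one_iff: "\<bar>t\<bar> < 1 \<Longrightarrow> ch 1 t = 1 \<longleftrightarrow> t = 0"
proof
  assume t: "\<bar>t\<bar> < 1" and "ch 1 t = 1"
  then have "Re (ch 1 t) = 1" by simp
  then have "cos (2 * pi * t) = 1" by (simp add: ch_def)
  then obtain n :: int where "2 * pi * t = of_int n * 2 * pi" by (auto simp: cos_one_2pi_int)
  then have "t = of_int n" by simp
  then show "t = 0" using t by auto
qed simp

text \<open>Chernoff's argument: dividing \<open>H - H x\<^sub>0\<close> by \<open>ch 1 (x - x\<^sub>0) - 1\<close> leaves a continuous function, whose
  coefficients telescope to those of \<open>H\<close>.\<close>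

lemma fc_zero_imp_constant:
  assumes H: "\<And>x. x \<in> {0..1} \<Longrightarrow> (H has_vector_derivative h x) (at x within {0..1})"
    and z: "\<And>k. k \<noteq> 0 \<Longrightarrow> fc H k = 0" and x0: "0 < x0" "x0 < 1"
  shows "H x0 = fc H 0"
proof -
  have Hc: "continuous_on {0..1} H"
    using H has_vector_derivative_continuous continuous_on_eq_continuous_within by blast
  \<comment> \<open>The value at \<open>x0\<close> is the quotient of the derivatives of numerator
    and denominator, which makes \<open>g\<close> continuous there.\<close>
  define g where "g x = (if x = x0 then h x0 / (2 * of_real pi * \<i>) else (H x - H x0) / (ch 1 (x - x0) - 1))" for x
  have ne: "ch 1 (x - x0) - 1 \<noteq> 0" if "x \<in> {0..1}" "x \<noteq> x0" for x
  proof -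
    have "\<bar>x - x0\<bar> < 1" using that x0 by (auto simp: abs_less_iff)
    then show ?thesis using ch_eq_one_iff[of "x - x0"] that by simp
  qed
  have gc: "continuous_on {0..1} g"
    unfolding continuous_on_eq_continuous_within
  proof
    fix x :: real assume x: "x \<in> {0..1}"
    show "continuous (at x within {0..1}) g"
    proof (cases "x = x0")
      case False
      have "continuous_on ({0..1} - {x0}) (\<lambda>x. (H x - H x0) / (ch 1 (x - x0) - 1))"
        by (intro continuous_intros continuous_on_subset[OF Hc] continuous_on_compose2[OF continuous_on_ch[of UNIV 1]])
           (use ne in auto)
      then have "continuous_on ({0..1} - {x0}) g"
        by (rule continuous_on_eq) (auto simp: g_def)
      then have "continuous (at x within ({0..1} - {x0})) g"
        using False x by (auto simp: continuous_on_eq_continuous_within)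
      moreover have "at x within ({0..1} - {x0}) = at x within {0..1}"
        by (rule at_within_nhd[of _ "- {x0}"]) (use False in auto)
      ultimately show ?thesis by simp
    next
      case True
      have 1: "((\<lambda>y. (H y - H x0) / of_real (y - x0)) \<longlongrightarrow> h x0) (at x0 within {0..1})"
        by (rule has_vector_derivative_imp_quotient_tendsto[OF H]) (use x0 in auto)
      have "((\<lambda>y. ch 1 y * ch (-1) x0) has_vector_derivative (2 * of_real pi * of_int 1 * \<i> * ch 1 x0) * ch (-1) x0) (at x0 within {0..1})"
        by (rule has_vector_derivative_mult_left[OF has_vector_derivative_ch])
      moreover have "(2 * of_real pi * of_int 1 * \<i> * ch 1 x0) * ch (-1) x0 = 2 * of_real pi * \<i>"
        by (simp add: mult.assoc ch_mult)
      ultimately have "((\<lambda>y. ch 1 y * ch (-1) x0) has_vector_derivative 2 * of_real pi * \<i>) (at x0 within {0..1})"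
        by (simp only:)
      from has_vector_derivative_imp_quotient_tendsto[OF this]
      have 2: "((\<lambda>y. (ch 1 (y - x0) - 1) / of_real (y - x0)) \<longlongrightarrow> 2 * of_real pi * \<i>) (at x0 within {0..1})"
        by (simp add: ch_mult ch_diff)
      have "((\<lambda>y. ((H y - H x0) / of_real (y - x0)) / ((ch 1 (y - x0) - 1) / of_real (y - x0))) \<longlongrightarrow> h x0 / (2 * of_real pi * \<i>)) (at x0 within {0..1})"
        by (rule tendsto_divide[OF 1 2]) simp
      then have "(g \<longlongrightarrow> h x0 / (2 * of_real pi * \<i>)) (at x0 within {0..1})"
      proof (rule Lim_transform_eventually)
        have "((H y - H x0) / of_real (y - x0)) / ((ch 1 (y - x0) - 1) / of_real (y - x0)) = g y" if "y \<noteq> x0" for y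
          using that by (simp add: g_def del: of_real_diff)
        then show "\<forall>\<^sub>F y in at x0 within {0..1}. ((H y - H x0) / of_real (y - x0)) / ((ch 1 (y - x0) - 1) / of_real (y - x0)) = g y"
          by (auto simp: eventually_at_filter)
      qed
      then show ?thesis using True by (simp add: continuous_within g_def)
    qed
  qed
  have gI: "L1 g" by (rule AI_continuous[OF gc])
  have HI: "L1 H" by (rule AI_continuous[OF Hc])
  \<comment> \<open>The phase turns the recursion for the coefficients of \<open>g\<close> into a
    pure difference.\<close>
  define G where "G k = fc g k * ch k x0" for k
  have rel: "G (k - 1) - G k = (fc H k - (if k = 0 then H x0 else 0)) * ch k x0" for k
  proof -
    have "fc (\<lambda>x. H x - H x0) k = fc (\<lambda>x. ch (-1) x0 * (g x * ch 1 x) - g x) k"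
    proof (rule fc_cong)
      fix x :: real assume x: "x \<in> {0..1}"
      have "H x - H x0 = g x * (ch 1 (x - x0) - 1)"
        using ne[OF x] by (cases "x = x0") (auto simp: g_def)
      then show "H x - H x0 = ch (-1) x0 * (g x * ch 1 x) - g x"
        by (simp add: ch_diff algebra_simps)
    qed
    also have "\<dots> = ch (-1) x0 * fc g (k - 1) - fc g k"
      by (subst fc_diff[OF _ gI]) (auto simp: fc_cmult fc_mult_ch intro!: set_integrable_mult_right AI_mult_ch gI)
    finally have 1: "fc (\<lambda>x. H x - H x0) k = ch (-1) x0 * fc g (k - 1) - fc g k" .
    have "fc (\<lambda>x. H x - H x0) k = fc H k - fc (\<lambda>x. H x0 * ch 0 x) k"
      by (subst fc_diff[symmetric, OF HI]) (auto intro!: AI_continuous continuous_intros)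
    also have "\<dots> = fc H k - (if k = 0 then H x0 else 0)"
      unfolding fc_cmult fc_ch by simp
    finally have "fc H k - (if k = 0 then H x0 else 0) = ch (-1) x0 * fc g (k - 1) - fc g k"
      unfolding 1 by (rule sym)
    then have "(fc H k - (if k = 0 then H x0 else 0)) * ch k x0 = (ch (-1) x0 * fc g (k - 1) - fc g k) * ch k x0"
      by (simp only:)
    also have "\<dots> = (ch (-1) x0 * ch k x0) * fc g (k - 1) - fc g k * ch k x0"
      by (simp add: algebra_simps)
    finally have "(fc H k - (if k = 0 then H x0 else 0)) * ch k x0 = (ch (-1) x0 * ch k x0) * fc g (k - 1) - fc g k * ch k x0" .
    then show ?thesis by (simp add: ch_mult G_def mult.commute)
  qed
  have lim: "(\<lambda>n::nat. norm (G (r n))) \<longlonglongrightarrow> 0" if "inj r" for r :: "nat \<Rightarrow> int"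
    using tendsto_norm_zero[OF fc_tendsto_zero[OF gI that]] by (simp add: G_def norm_mult)
  \<comment> \<open>The right side of \<open>rel\<close> vanishes for k \<noteq> 0, so
    \<open>G\<close> is constant on the nonnegative and on the negative integers. Riemann-Lebesgue
    makes both constants zero, and \<open>rel\<close> at 0 gives the claim.\<close>
  have "G (int n) = G 0" for n
  proof (induction n)
    case (Suc n)
    then show ?case using rel[of "int (Suc n)"] z[of "int (Suc n)"] by simp
  qed simp
  then have "G 0 = 0" using lim[of int] by (simp add: LIMSEQ_const_iff)
  moreover have "G (- 1 - int n) = G (- 1)" for n
  proof (induction n)
    case (Suc n)
    have "- 1 - int (Suc n) = - 1 - int n - 1" by simp
    then show ?case using Suc rel[of "- 1 - int n"] z[of "- 1 - int n"] by simp
  qed simp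
  then have "G (- 1) = 0" using lim[of "\<lambda>n. - 1 - int n"] by (simp add: LIMSEQ_const_iff inj_on_def)
  ultimately show ?thesis using rel[of 0] by simp
qed

text \<open>The preceding argument needs a derivative, so it is applied to the primitive
  \<open>H\<close> of \<open>h\<close>. The zero mean of \<open>h\<close> makes the end values of
  \<open>H\<close> agree, hence the coefficients of \<open>H\<close> away from 0 vanish. Then
  \<open>H\<close> is constant in the interior, and continuity carries h = 0 to the end
  points.\<close>

lemma fc_zero_imp_zero:
  assumes hc: "continuous_on {0..1} h" and z: "\<And>k. fc h k = 0" and x: "x \<in> {0..1}"
  shows "h x = 0"
proof -
  define H where "H x = integral {0..x} h" for x
  have hI: "L1 h" by (rule AI_continuous[OF hc])
  have AC: "has_AC_derivative H h"
    using has_AC_derivative_integral[OF hI, of 0] by (simp add: H_def[abs_def])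
  have D: "(H has_vector_derivative h x) (at x within {0..1})" if "x \<in> {0..1}" for x
    unfolding H_def using integral_has_vector_derivative[OF hc that] .
  have "H 1 - H 0 = 0" using z[of 0] by (simp add: H_def fc_def)
  then have "fc H k = 0" if "k \<noteq> 0" for k
    using fc_AC_derivative[OF AC, of k] z that by simp
  from fc_zero_imp_constant[OF D this]
  have const: "H y = fc H 0" if "0 < y" "y < 1" for y using that by blast
  have "h y = 0" if y: "y \<in> {0<..<1}" for y
  proof -
    have "(H has_vector_derivative h y) (at y)"
    proof -
      have "(H has_vector_derivative h y) (at y within {0<..<1})"
        by (rule has_vector_derivative_within_subset[OF D]) (use y in auto)
      then show ?thesis using at_within_open[OF y] by simp
    qed
    moreover have "(H has_vector_derivative 0) (at y)"
      by (rule has_vector_derivative_transform_within_open[of "\<lambda>_. fc H 0" _ _ "{0<..<1}"])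
         (use y const in auto)
    ultimately show ?thesis by (rule vector_derivative_unique_at)
  qed
  moreover have "continuous_on (closure {0<..<1::real}) h" using hc by simp
  ultimately show ?thesis
    using continuous_constant_on_closure[of "{0<..<1}" h 0 x] x by simp
qed

lemma abs_summable_trig:
  fixes a :: "int \<Rightarrow> complex"
  assumes "(\<lambda>k. norm (a k)) summable_on UNIV"
  shows "uniform_limit {0..1} (\<lambda>F x. \<Sum>k\<in>F. a k * ch k x) (\<lambda>x. \<Sum>\<^sub>\<infinity>k. a k * ch k x) (finite_subsets_at_top UNIV)"
  by (rule Weierstrass_m_test_general[OF _ assms]) (simp add: norm_mult)

lemma continuous_on_trig:
  fixes a :: "int \<Rightarrow> complex"
  assumes "(\<lambda>k. norm (a k)) summable_on UNIV"
  shows "continuous_on {0..1} (\<lambda>x. \<Sum>\<^sub>\<infinity>k. a k * ch k x)"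
  by (rule uniform_limit_theorem[OF _ abs_summable_trig[OF assms]])
     (auto intro!: always_eventually continuous_intros)

text \<open>Uniform convergence against an integrable factor permits termwise integration; absolute
  summability is asked of one factor, integrability of the other.\<close>

lemma fc_mult_trig_has_sum:
  fixes a :: "int \<Rightarrow> complex"
  assumes a: "(\<lambda>k. norm (a k)) summable_on UNIV" and f: "L1 f"
  shows "((\<lambda>k. a k * fc f (j - k)) has_sum fc (\<lambda>x. f x * (\<Sum>\<^sub>\<infinity>k. a k * ch k x)) j) UNIV"
  unfolding has_sum_def
proof (rule tendstoI)
  fix e :: real assume e: "e > 0"
  define A where "A x = (\<Sum>\<^sub>\<infinity>k. a k * ch k x)" for x
  define M where "M = nrm1 f"
  have M: "M \<ge> 0" unfolding M_def by (rule integral_norm_nonneg[OF f])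
  define d where "d = e / (M + 1)"
  have d: "d > 0" using M e by (simp add: d_def)
  have Ac: "continuous_on {0..1} A" unfolding A_def by (rule continuous_on_trig[OF a])
  have "\<forall>\<^sub>F F in finite_subsets_at_top UNIV. \<forall>x\<in>{0..1}. dist (\<Sum>k\<in>F. a k * ch k x) (A x) < d"
    unfolding A_def by (rule uniform_limitD[OF abs_summable_trig[OF a] d])
  moreover have "\<forall>\<^sub>F F in finite_subsets_at_top UNIV. finite (F :: int set)"
    by (rule eventually_finite_subsets_at_top_weakI)
  ultimately show "\<forall>\<^sub>F F in finite_subsets_at_top UNIV. dist (\<Sum>k\<in>F. a k * fc f (j - k)) (fc (\<lambda>x. f x * A x) j) < e"
    unfolding A_def[symmetric]
  proof (eventually_elim)
    case (elim F)
    define S where "S x = (\<Sum>k\<in>F. a k * ch k x)" for x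
    have Sc: "continuous_on {0..1} S" unfolding S_def by (intro continuous_intros)
    have "fc (\<lambda>x. f x * S x) j = integral {0..1} (\<lambda>x. \<Sum>k\<in>F. a k * (f x * ch k x * ch (-j) x))"
      unfolding fc_def S_def by (rule arg_cong[where f="integral {0..1}"]) (auto simp: fun_eq_iff sum_distrib_left sum_distrib_right algebra_simps)
    also have "\<dots> = (\<Sum>k\<in>F. integral {0..1} (\<lambda>x. a k * (f x * ch k x * ch (-j) x)))"
      by (rule integral_sum[OF elim(2)]) (intro integrable_on_mult_right integrable_of_AI AI_mult_ch f)
    also have "\<dots> = (\<Sum>k\<in>F. a k * fc f (j - k))"
      by (simp add: fc_mult_ch fc_def[symmetric])
    finally have 1: "fc (\<lambda>x. f x * S x) j = (\<Sum>k\<in>F. a k * fc f (j - k))" .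
    have "fc (\<lambda>x. f x * S x) j - fc (\<lambda>x. f x * A x) j = fc (\<lambda>x. f x * S x - f x * A x) j"
      by (rule fc_diff[symmetric]; rule AI_mult_cont[OF f]; fact)
    also have "\<dots> = integral {0..1} (\<lambda>x. f x * ((S x - A x) * ch (-j) x))"
      unfolding fc_def by (simp add: algebra_simps)
    also have "norm \<dots> \<le> d * M"
      unfolding M_def
      by (rule norm_integral_mult_le[OF f]) (use elim(1) in \<open>auto intro!: continuous_intros Sc Ac simp: norm_mult S_def dist_norm less_imp_le\<close>)
    also have "\<dots> < e" using M e by (simp add: d_def field_simps)
    finally show ?case unfolding 1 by (simp add: dist_norm)
  qed
qed

lemma fc_trig:
  fixes a :: "int \<Rightarrow> complex"
  assumes a: "(\<lambda>k. norm (a k)) summable_on UNIV"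
  shows "fc (\<lambda>x. \<Sum>\<^sub>\<infinity>k. a k * ch k x) j = a j"
proof -
  have "((\<lambda>k. a k * fc (ch 0) (j - k)) has_sum fc (\<lambda>x. ch 0 x * (\<Sum>\<^sub>\<infinity>k. a k * ch k x)) j) UNIV"
    by (rule fc_mult_trig_has_sum[OF a]) (intro AI_continuous continuous_intros)
  moreover have "((\<lambda>k. a k * fc (ch 0) (j - k)) has_sum a j) UNIV"
    by (rule has_sum_finite_neutralI[of "{j}"]) (auto simp: fc_ch)
  ultimately show ?thesis using has_sum_unique by fastforce
qed

text \<open>Both sides are continuous with equal coefficients, so uniqueness applies. Summability
  excludes a jump between the values at 0 and 1, since the series is periodic.\<close>

lemma fourier_inversion:
  assumes G: "continuous_on {0..1} G" and s: "(\<lambda>k. norm (fc G k)) summable_on UNIV" and x: "x \<in> {0..1}"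
  shows "G x = (\<Sum>\<^sub>\<infinity>k. fc G k * ch k x)"
proof -
  let ?A = "\<lambda>x. \<Sum>\<^sub>\<infinity>k. fc G k * ch k x"
  have Ac: "continuous_on {0..1} ?A" by (rule continuous_on_trig[OF s])
  have "fc (\<lambda>x. G x - ?A x) k = 0" for k
    by (subst fc_diff) (auto simp: fc_trig[OF s] intro!: AI_continuous G Ac)
  then have "G x - ?A x = 0"
    by (intro fc_zero_imp_zero[OF continuous_on_diff[OF G Ac]]) (use x in auto)
  then show ?thesis by simp
qed

text \<open>The bridge between products of functions and convolutions of sequences: \<open>f\<close>
  will be the potential, and \<open>G\<close> an eigenfunction or a function produced by
  \<open>resolv\<close>.\<close>

lemma fc_mult_has_sum:
  assumes G: "continuous_on {0..1} G" and s: "(\<lambda>k. norm (fc G k)) summable_on UNIV"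
    and f: "L1 f"
  shows "((\<lambda>k. fc G k * fc f (j - k)) has_sum fc (\<lambda>x. f x * G x) j) UNIV"
proof -
  have "fc (\<lambda>x. f x * G x) j = fc (\<lambda>x. f x * (\<Sum>\<^sub>\<infinity>k. fc G k * ch k x)) j"
    by (rule fc_cong) (simp add: fourier_inversion[OF G s])
  then show ?thesis using fc_mult_trig_has_sum[OF s f, of j] by simp
qed

subsection \<open>The nonresonant multiplier\<close>

text \<open>Subtracting the mean makes the primitive vanish at both ends, so that integration by
  parts leaves no boundary terms.\<close>

definition primit :: "(real \<Rightarrow> complex) \<Rightarrow> real \<Rightarrow> complex" where
  "primit g x = integral {0..x} g - of_real x * fc g 0"

text \<open>Removing the mean of the primitive as well yields the multiplier 1 / (2 pi i k), with
  value 0 at k = 0.\<close>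

definition primit0 :: "(real \<Rightarrow> complex) \<Rightarrow> real \<Rightarrow> complex" where
  "primit0 g x = primit g x - fc (primit g) 0"

lemma AI_const: "(\<lambda>x. c::complex) absolutely_integrable_on {0..1::real}"
  by (intro AI_continuous continuous_intros)

lemma fc_const: "fc (\<lambda>x. c) k = (if k = 0 then c else 0)"
proof -
  have "fc (\<lambda>x. c * ch 0 x) k = (if k = 0 then c else 0)" unfolding fc_cmult fc_ch by simp
  then show ?thesis by simp
qed

lemma has_AC_derivative_primit:
  assumes g: "L1 g"
  shows "has_AC_derivative (primit g) (\<lambda>x. g x - fc g 0)"
  unfolding has_AC_derivative_def
proof (intro conjI ballI)
  show "L1 (\<lambda>x. g x - fc g 0)"
    by (rule set_integral_diff(1)[OF g AI_const])
  fix x :: real assume x: "x \<in> {0..1}"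
  have "integral {0..x} (\<lambda>x. g x - fc g 0) = integral {0..x} g - integral {0..x} (\<lambda>x. fc g 0)"
    by (rule HK_integral_diff)
       (use x in \<open>auto intro: integrable_subinterval_real[OF integrable_of_AI[OF g]]\<close>)
  then show "primit g x = primit g 0 + integral {0..x} (\<lambda>x. g x - fc g 0)"
    using x by (simp add: primit_def scaleR_conv_of_real)
qed

lemma primit_ends: "primit g 0 = 0" "primit g 1 = 0"
  by (simp_all add: primit_def fc_def)

lemma continuous_on_primit: "L1 g \<Longrightarrow> continuous_on {0..1} (primit g)"
  by (rule has_AC_derivative_continuous[OF has_AC_derivative_primit])

lemma continuous_on_primit0: "L1 g \<Longrightarrow> continuous_on {0..1} (primit0 g)"
  unfolding primit0_def by (intro continuous_intros continuous_on_primit)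

lemma fc_primit0:
  assumes g: "L1 g"
  shows "fc (primit0 g) k = (if k = 0 then 0 else fc g k / (2 * of_real pi * \<i> * of_int k))"
proof -
  have 1: "fc (primit0 g) k = fc (primit g) k - (if k = 0 then fc (primit g) 0 else 0)"
    unfolding primit0_def
    by (subst fc_diff[OF AI_continuous[OF continuous_on_primit[OF g]] AI_const])
       (simp add: fc_const)
  have 2: "fc (\<lambda>x. g x - fc g 0) k = 2 * of_real pi * of_int k * \<i> * fc (primit g) k"
    using fc_AC_derivative[OF has_AC_derivative_primit[OF g], of k] by (simp add: primit_ends)
  have 3: "fc (\<lambda>x. g x - fc g 0) k = fc g k - (if k = 0 then fc g 0 else 0)"
    by (subst fc_diff[OF g AI_const]) (simp add: fc_const)
  show ?thesis
  proof (cases "k = 0")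
    case False
    then have "fc g k = (2 * of_real pi * \<i> * of_int k) * fc (primit g) k"
      using 2 3 by (simp add: mult_ac)
    then show ?thesis using 1 False by simp
  next
    case True
    then show ?thesis using 1 by simp
  qed
qed

text \<open>The hypothesis bounds partial integrals and not the L_1 norm: for the oscillating
  integrand in \<open>resolv_tendsto\<close> the former become small while the latter stays
  fixed.\<close>

lemma norm_primit_le:
  assumes e: "\<And>x. x \<in> {0..1} \<Longrightarrow> norm (integral {0..x} g) \<le> e" and x: "x \<in> {0..1}"
  shows "norm (primit g x) \<le> 2 * e"
proof -
  have "norm (fc g 0) \<le> e" using e[of 1] by (simp add: fc_def)
  then have "\<bar>x\<bar> * norm (fc g 0) \<le> 1 * e" using x by (intro mult_mono) auto
  then have "norm (of_real x * fc g 0) \<le> e" by (simp add: norm_mult)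
  then show ?thesis
    using e[OF x] norm_triangle_ineq4[of "integral {0..x} g" "of_real x * fc g 0"] by (simp add: primit_def)
qed

lemma norm_primit0_le:
  assumes g: "L1 g"
    and e: "\<And>x. x \<in> {0..1} \<Longrightarrow> norm (integral {0..x} g) \<le> e" and x: "x \<in> {0..1}"
  shows "norm (primit0 g x) \<le> 4 * e"
proof -
  have c: "continuous_on {0..1} (primit g)" by (rule continuous_on_primit[OF g])
  have "norm (fc (primit g) 0) = norm (integral {0..1} (\<lambda>x. (1::complex) * primit g x))"
    by (simp add: fc_def)
  also have "\<dots> \<le> 2 * e * integral {0..1::real} (\<lambda>x. norm (1::complex))"
    by (rule norm_integral_mult_le[OF AI_const c norm_primit_le[OF e]])
  finally have "norm (fc (primit g) 0) \<le> 2 * e" by simp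
  then show ?thesis
    using norm_primit_le[OF e x] norm_triangle_ineq4[of "primit g x" "fc (primit g) 0"] by (simp add: primit0_def)
qed

lemma norm_integral_le_L1:
  fixes g :: "real \<Rightarrow> complex"
  assumes g: "L1 g" and x: "x \<in> {0..1}"
  shows "norm (integral {0..x} g) \<le> nrm1 g"
proof -
  have 1: "g absolutely_integrable_on {0..x}"
    by (rule absolutely_integrable_on_subinterval[OF g]) (use x in auto)
  have "norm (integral {0..x} g) \<le> integral {0..x} (\<lambda>x. norm (g x))"
    by (rule integral_norm_bound_integral[OF integrable_of_AI[OF 1] integrable_norm_of_AI[OF 1]]) simp
  also have "\<dots> \<le> nrm1 g"
    by (rule integral_subset_le[OF _ integrable_norm_of_AI[OF 1] integrable_norm_of_AI[OF g]]) (use x in auto)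
  finally show ?thesis .
qed

lemma primit_diff:
  assumes "L1 f" "L1 g" "x \<in> {0..1}"
  shows "primit (\<lambda>x. f x - g x) x = primit f x - primit g x"
proof -
  have "integral {0..x} (\<lambda>x. f x - g x) = integral {0..x} f - integral {0..x} g"
    by (rule HK_integral_diff)
       (use assms in \<open>auto intro: integrable_subinterval_real[OF integrable_of_AI]\<close>)
  then show ?thesis by (simp add: primit_def fc_diff assms algebra_simps)
qed

lemma primit0_diff:
  assumes "L1 f" "L1 g" "x \<in> {0..1}"
  shows "primit0 (\<lambda>x. f x - g x) x = primit0 f x - primit0 g x"
proof -
  have "fc (primit (\<lambda>x. f x - g x)) 0 = fc (\<lambda>x. primit f x - primit g x) 0"
    by (rule fc_cong) (rule primit_diff[OF assms(1,2)])
  also have "\<dots> = fc (primit f) 0 - fc (primit g) 0"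
    by (intro fc_diff AI_continuous continuous_on_primit assms)
  finally show ?thesis by (simp add: primit0_def primit_diff[OF assms])
qed

lemma primit0_cmult: "primit0 (\<lambda>x. c * f x) x = c * primit0 f x"
proof -
  have "primit (\<lambda>x. c * f x) = (\<lambda>x. c * primit f x)"
    by (simp add: primit_def fc_cmult fun_eq_iff algebra_simps)
  then show ?thesis by (simp add: primit0_def fc_cmult algebra_simps)
qed

section \<open>The multiplier 1 / \<open>dd m k\<close> as an operator on functions\<close>

definition dd :: "int \<Rightarrow> int \<Rightarrow> real" where
  "dd m k = 4 * pi\<^sup>2 * of_int k * of_int (m - k)"

text \<open>Partial fractions \<open>m / (k (m - k)) = 1 / k + 1 / (m - k)\<close> turn the multiplier \<open>1 / dd m k\<close> on the
  coefficients with \<open>k \<noteq> 0, m\<close> into two integrations.\<close>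

definition resolv :: "int \<Rightarrow> (real \<Rightarrow> complex) \<Rightarrow> real \<Rightarrow> complex" where
  "resolv m f x = (2 * of_real pi * \<i> * (primit0 f x - primit0 (\<lambda>x. f x * ch (- m) x) x * ch m x)
     - fc f 0 / of_int m - fc f m / of_int m * ch m x) / (4 * of_real pi ^ 2 * of_int m)"

lemma continuous_on_resolv:
  assumes f: "L1 f"
  shows "continuous_on {0..1} (resolv m f)"
  unfolding resolv_def divide_inverse
  by (intro continuous_intros continuous_on_primit0 f AI_mult_ch)

text \<open>Each primitive removes only its own resonant mode, k = 0 or k = m, and leaves a
  coefficient at the other one; the terms with \<open>fc f 0\<close> and \<open>fc f m\<close> in
  \<open>resolv\<close> cancel these two leftovers.\<close>

lemma fc_resolv:
  assumes f: "L1 f" and m: "m \<noteq> 0"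
  shows "fc (resolv m f) k = (if k = 0 \<or> k = m then 0 else fc f k / of_real (dd m k))"
proof -
  define g where "g x = f x * ch (- m) x" for x
  have g: "L1 g" unfolding g_def by (rule AI_mult_ch[OF f])
  have I1: "L1 (primit0 f)"
    by (rule AI_continuous[OF continuous_on_primit0[OF f]])
  have I2: "L1 (\<lambda>x. primit0 g x * ch m x)"
    by (rule AI_continuous) (intro continuous_intros continuous_on_primit0[OF g])
  have I3: "L1 (\<lambda>x. 2 * of_real pi * \<i> * (primit0 f x - primit0 g x * ch m x))"
    by (rule AI_continuous) (intro continuous_intros continuous_on_primit0[OF g] continuous_on_primit0[OF f])
  have I4: "L1 (\<lambda>x. 2 * of_real pi * \<i> * (primit0 f x - primit0 g x * ch m x) - fc f 0 / of_int m)"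
    by (rule AI_continuous) (intro continuous_intros continuous_on_primit0[OF g] continuous_on_primit0[OF f])
  have I5: "L1 (\<lambda>x. fc f m / of_int m * ch m x)"
    by (rule AI_continuous) (intro continuous_intros)
  let ?c = "1 / (4 * of_real pi ^ 2 * of_int m) :: complex"
  have "resolv m f = (\<lambda>x. ?c * (2 * of_real pi * \<i> * (primit0 f x - primit0 g x * ch m x)
     - fc f 0 / of_int m - fc f m / of_int m * ch m x))"
    by (simp add: resolv_def g_def[abs_def] fun_eq_iff)
  then have "fc (resolv m f) k = ?c * (2 * of_real pi * \<i> * (fc (primit0 f) k - fc (primit0 g) (k - m))
     - (if k = 0 then fc f 0 / of_int m else 0) - fc f m / of_int m * (if m = k then 1 else 0))"
    by (simp only: fc_cmult fc_diff[OF I4 I5] fc_diff[OF I3 AI_const] fc_diff[OF I1 I2] fc_mult_ch fc_ch fc_const)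
  also have "fc (primit0 g) (k - m) = (if k = m then 0 else fc f k / (2 * of_real pi * \<i> * of_int (k - m)))"
  proof -
    have "fc g (k - m) = fc f k" unfolding g_def by (simp add: fc_mult_ch)
    then show ?thesis using fc_primit0[OF g, of "k - m"] by simp
  qed
  also have "fc (primit0 f) k = (if k = 0 then 0 else fc f k / (2 * of_real pi * \<i> * of_int k))"
    by (rule fc_primit0[OF f])
  finally have E: "fc (resolv m f) k = ?c * (2 * of_real pi * \<i> *
     ((if k = 0 then 0 else fc f k / (2 * of_real pi * \<i> * of_int k)) - (if k = m then 0 else fc f k / (2 * of_real pi * \<i> * of_int (k - m))))
     - (if k = 0 then fc f 0 / of_int m else 0) - fc f m / of_int m * (if m = k then 1 else 0))" .
  show ?thesis
  proof (cases "k = 0 \<or> k = m")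
    case True
    then show ?thesis unfolding E using m by auto
  next
    case False
    then have nz: "of_int k \<noteq> (0::complex)" "of_int m - of_int k \<noteq> (0::complex)" "of_int m \<noteq> (0::complex)"
      using m by (auto simp flip: of_int_diff)
    have "fc (resolv m f) k = ?c * (2 * of_real pi * \<i> *
       (fc f k / (2 * of_real pi * \<i> * of_int k) - fc f k / (2 * of_real pi * \<i> * of_int (k - m))))"
      unfolding E using False by auto
    also have "\<dots> = ?c * (fc f k / of_int k - fc f k / of_int (k - m))"
    proof -
      have "c * (a / (c * y) - a / (c * z)) = a / y - a / z" if "c \<noteq> 0" for a c y z :: complex
        using that by (simp add: right_diff_distrib)
      from this[of "2 * of_real pi * \<i>"] show ?thesis by simp
    qed
    also have "fc f k / of_int k - fc f k / of_int (k - m) = fc f k / of_int k + fc f k / (of_int m - of_int k)"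
      using minus_divide_right[of "fc f k" "of_int k - of_int m"] by simp
    also have "\<dots> = fc f k * of_int m / (of_int k * (of_int m - of_int k))"
      using nz(1,2) by (simp add: add_divide_eq_iff divide_add_eq_iff field_simps)
    also have "?c * \<dots> = fc f k / of_real (dd m k)"
      using nz by (simp add: dd_def mult_ac)
    finally show ?thesis using False by simp
  qed
qed

lemma resolv_diff:
  assumes f: "L1 f" and g: "L1 g" and x: "x \<in> {0..1}"
  shows "resolv m (\<lambda>x. f x - g x) x = resolv m f x - resolv m g x"
proof -
  have 1: "primit0 (\<lambda>x. f x - g x) x = primit0 f x - primit0 g x" by (rule primit0_diff[OF f g x])
  have 2: "primit0 (\<lambda>x. (f x - g x) * ch (- m) x) x = primit0 (\<lambda>x. f x * ch (- m) x) x - primit0 (\<lambda>x. g x * ch (- m) x) x"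
    unfolding left_diff_distrib by (rule primit0_diff[OF AI_mult_ch[OF f] AI_mult_ch[OF g] x])
  show ?thesis
    unfolding resolv_def 1 2 fc_diff[OF f g] by (simp add: diff_divide_distrib[symmetric] algebra_simps add_divide_distrib[symmetric])
qed

lemma resolv_cmult: "resolv m (\<lambda>x. c * f x) x = c * resolv m f x"
  unfolding resolv_def primit0_cmult fc_cmult mult.assoc[of c] by (simp add: algebra_simps)

lemma four_pi_sq_ge: "1 \<le> 4 * pi\<^sup>2"
proof -
  have "1 * 1 \<le> pi * pi" using pi_gt3 by (intro mult_mono) auto
  then show ?thesis by (simp add: power2_eq_square)
qed

lemma resolv_bound:
  assumes f: "L1 f" and x: "x \<in> {0..1}" and m: "m > 0"
  shows "norm (of_int m * resolv m f x) \<le> 60 * nrm1 f"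
proof -
  define L where "L = nrm1 f"
  have L: "L \<ge> 0" unfolding L_def by (rule integral_norm_nonneg[OF f])
  have a: "norm (primit0 f x) \<le> 4 * L"
    unfolding L_def by (rule norm_primit0_le[OF f norm_integral_le_L1[OF f] x])
  have "(\<lambda>x. norm (f x * ch (-m) x)) = (\<lambda>x. norm (f x))" by (simp add: norm_mult)
  then have b: "norm (primit0 (\<lambda>x. f x * ch (- m) x) x) \<le> 4 * L"
    using norm_primit0_le[OF AI_mult_ch[OF f, of "-m"] norm_integral_le_L1[OF AI_mult_ch[OF f, of "-m"]] x] by (simp only: L_def)
  have c: "norm (fc f k / of_int m) \<le> L" for k
  proof -
    have "norm (fc f k) / real_of_int m \<le> norm (fc f k) / 1"
      using m by (intro divide_left_mono) auto
    then show ?thesis using fc_bound[OF f, of k] m by (simp add: norm_divide L_def)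
  qed
  define X where "X = 2 * of_real pi * \<i> * (primit0 f x - primit0 (\<lambda>x. f x * ch (- m) x) x * ch m x)
     - fc f 0 / of_int m - fc f m / of_int m * ch m x"
  have "norm (2 * of_real pi * \<i> * (primit0 f x - primit0 (\<lambda>x. f x * ch (- m) x) x * ch m x)) \<le> 2 * pi * (8 * L)"
  proof -
    have "norm (primit0 f x - primit0 (\<lambda>x. f x * ch (- m) x) x * ch m x) \<le> 8 * L"
      using norm_triangle_ineq4[of "primit0 f x" "primit0 (\<lambda>x. f x * ch (- m) x) x * ch m x"] a b
      by (simp add: norm_mult)
    then show ?thesis by (simp add: norm_mult)
  qed
  moreover have "norm (fc f m / of_int m * ch m x) \<le> L" using c[of m] by (simp add: norm_mult norm_divide)
  ultimately have X: "norm X \<le> 2 * pi * (8 * L) + L + L"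
    unfolding X_def using c[of 0] norm_triangle_ineq4 by (smt (verit))
  have "of_int m * resolv m f x = X / (4 * of_real pi ^ 2)"
    unfolding resolv_def X_def[symmetric] using m by simp
  then have "norm (of_int m * resolv m f x) = norm X / (4 * pi\<^sup>2)"
    by (simp add: norm_divide norm_mult norm_power)
  also have "\<dots> \<le> norm X / 1"
    using four_pi_sq_ge by (intro divide_left_mono) auto
  also have "\<dots> \<le> 60 * L"
  proof -
    \<comment> \<open>The bound on \<open>X\<close> is (16 pi + 2) L, below 60 L for pi <= 3.2; the
      divisor 4 pi^2 is only estimated from below by 1.\<close>
    have "pi * L \<le> 3.2 * L" using L pi_less_4 by (intro mult_right_mono) (use pi_approx in auto)
    then show ?thesis using X L by simp
  qed
  finally show ?thesis by (simp add: L_def)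
qed

text \<open>For fixed k, m / \<open>dd m k\<close> tends to 1 / (4 pi^2 k), and 1 / k is 2 pi i
  times integration without mean.\<close>

definition resolv_lim :: "(real \<Rightarrow> complex) \<Rightarrow> real \<Rightarrow> complex" where
  "resolv_lim f x = 2 * of_real pi * \<i> * primit0 f x / (4 * of_real pi ^ 2)"

text \<open>The part of \<open>resolv\<close> belonging to the mode m is a primitive of
  \<open>f * ch (- m)\<close>, uniformly small by \<open>finite_large_partial_fc\<close>; the two
  correction terms carry a further factor 1 / m.\<close>

lemma resolv_tendsto:
  assumes f: "L1 f" and e: "e > 0"
  shows "\<exists>N. \<forall>m\<ge>N. \<forall>x\<in>{0..1}. norm (of_int m * resolv m f x - resolv_lim f x) \<le> e"
proof -
  define L where "L = nrm1 f"
  have L: "L \<ge> 0" unfolding L_def by (rule integral_norm_nonneg[OF f])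
  define w where "w = e / 60"
  have w: "w > 0" using e by (simp add: w_def)
  have "finite {k. \<exists>x\<in>{0..1}. norm (integral {0..x} (\<lambda>t. f t * ch (- k) t)) \<ge> w}"
    by (rule finite_large_partial_fc[OF f w])
  then obtain N1 where N1: "\<And>k. k \<in> {k. \<exists>x\<in>{0..1}. norm (integral {0..x} (\<lambda>t. f t * ch (- k) t)) \<ge> w} \<Longrightarrow> k \<le> N1"
    by (meson bdd_above_finite bdd_above.unfold)
  \<comment> \<open>The first entry makes the oscillating partial integrals small, the second gives
    L / m <= w for the correction terms.\<close>
  define N where "N = max (N1 + 1) (\<lceil>L / w\<rceil> + 1)"
  show ?thesis
  proof (intro exI[of _ N] allI impI ballI)
    fix m x assume m: "N \<le> m" and x: "x \<in> {0..1::real}"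
    have mL: "L / w \<le> real_of_int m" using m unfolding N_def by linarith
    moreover have "L / w \<ge> 0" using L w by simp
    moreover have "0 < m" using m \<open>L / w \<ge> 0\<close> unfolding N_def by linarith
    ultimately have m0: "0 < m" by simp
    have "m > N1" using m by (auto simp: N_def)
    then have u: "norm (integral {0..x} (\<lambda>t. f t * ch (- m) t)) \<le> w" if "x \<in> {0..1}" for x
      using N1[of m] that by force
    have b: "norm (primit0 (\<lambda>x. f x * ch (- m) x) x) \<le> 4 * w"
      by (rule norm_primit0_le[OF AI_mult_ch[OF f] u x])
    have c: "norm (fc f k / of_int m) \<le> w" for k
    proof -
      have "L \<le> w * of_int m" using mL w by (simp add: field_simps)
      then have "norm (fc f k) \<le> w * of_int m" using fc_bound[OF f, of k] by (simp add: L_def)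
      then show ?thesis using m0 by (simp add: norm_divide field_simps)
    qed
    define X where "X = 2 * of_real pi * \<i> * (primit0 (\<lambda>x. f x * ch (- m) x) x * ch m x)
     + fc f 0 / of_int m + fc f m / of_int m * ch m x"
    have "norm (2 * of_real pi * \<i> * (primit0 (\<lambda>x. f x * ch (- m) x) x * ch m x)) \<le> 2 * pi * (4 * w)"
      using b by (simp add: norm_mult)
    moreover have "norm (fc f m / of_int m * ch m x) \<le> w" using c[of m] by (simp add: norm_mult norm_divide)
    ultimately have X: "norm X \<le> 2 * pi * (4 * w) + w + w"
      unfolding X_def using c[of 0] norm_triangle_ineq by (smt (verit))
    have "of_int m * resolv m f x - resolv_lim f x = - X / (4 * of_real pi ^ 2)"
      unfolding resolv_def X_def resolv_lim_def using m0 by (simp add: diff_divide_distrib add_divide_distrib right_diff_distrib mult.commute[of "of_int m"])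
    then have "norm (of_int m * resolv m f x - resolv_lim f x) = norm X / (4 * pi\<^sup>2)"
      by (simp add: norm_divide norm_mult norm_power)
    also have "\<dots> \<le> norm X / 1"
      using four_pi_sq_ge by (intro divide_left_mono) auto
    also have "\<dots> \<le> 60 * w"
    proof -
      have "pi * w \<le> 4 * w" using w pi_less_4 by (intro mult_right_mono) auto
      moreover have "2 * pi * (4 * w) = 8 * (pi * w)" by simp
      ultimately have "norm X \<le> 60 * w" using X w by linarith
      then show ?thesis by simp
    qed
    finally show "norm (of_int m * resolv m f x - resolv_lim f x) \<le> e" by (simp add: w_def)
  qed
qed

lemma continuous_on_resolv_lim:
  "L1 f \<Longrightarrow> continuous_on {0..1} (resolv_lim f)"
  unfolding resolv_lim_def divide_inverse by (intro continuous_intros continuous_on_primit0)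

lemma norm_fc_mult_le:
  assumes f: "L1 f" and g: "continuous_on {0..1} g"
    and B: "\<And>x. x \<in> {0..1} \<Longrightarrow> norm (g x) \<le> B"
  shows "norm (fc (\<lambda>x. f x * g x) k) \<le> B * nrm1 f"
proof -
  have "norm (integral {0..1} (\<lambda>x. f x * (g x * ch (- k) x))) \<le> B * nrm1 f"
    by (rule norm_integral_mult_le[OF f]) (auto intro!: continuous_intros g simp: norm_mult B)
  then show ?thesis by (simp add: fc_def mult.assoc)
qed

lemma fc_finite_int_bound:
  assumes "L1 f" "e > 0"
  shows "\<exists>N. \<forall>m\<ge>N. norm (fc f m) \<le> e"
proof -
  obtain N where N: "\<And>k. k \<in> {k. norm (fc f k) \<ge> e} \<Longrightarrow> k \<le> N"
    using finite_large_fc[OF assms] by (meson bdd_above_finite bdd_above.unfold)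
  have "norm (fc f m) \<le> e" if "m \<ge> N + 1" for m
  proof (rule ccontr)
    assume "\<not> norm (fc f m) \<le> e"
    then have "m \<le> N" using N[of m] by simp
    then show False using that by simp
  qed
  then show ?thesis by blast
qed

text \<open>Each of the two multipliers takes one factor m. The limit function is merely integrable,
  so Riemann-Lebesgue gives no rate and the outcome is an o(m^-2) bound.\<close>

lemma resolv_twice_small:
  assumes q: "L1 q" and e: "e > 0"
  shows "\<exists>N. \<forall>m\<ge>N. norm (of_int m ^ 2 * fc (\<lambda>x. q x * resolv m (\<lambda>x. q x * resolv m q x) x) m) \<le> e"
proof -
  define L where "L = nrm1 q"
  have L: "L \<ge> 0" unfolding L_def by (rule integral_norm_nonneg[OF q])
  define f where "f x = q x * resolv_lim q x" for x
  have fI: "L1 f" unfolding f_def by (rule AI_mult_cont[OF q continuous_on_resolv_lim[OF q]])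
  have qfI: "L1 (\<lambda>x. q x * resolv_lim f x)"
    by (rule AI_mult_cont[OF q continuous_on_resolv_lim[OF fI]])
  \<comment> \<open>The final errors are 60 L^2 d from the inner replacement, L d from the outer
    one, and d from the fixed limit.\<close>
  define d where "d = e / ((60 * L * L + L) + 1)"
  have d: "d > 0" using e L by (simp add: d_def add_nonneg_pos)
  obtain N1 where N1: "\<And>m x. m \<ge> N1 \<Longrightarrow> x \<in> {0..1} \<Longrightarrow> norm (of_int m * resolv m q x - resolv_lim q x) \<le> d"
    using resolv_tendsto[OF q d] by blast
  obtain N2 where N2: "\<And>m x. m \<ge> N2 \<Longrightarrow> x \<in> {0..1} \<Longrightarrow> norm (of_int m * resolv m f x - resolv_lim f x) \<le> d"
    using resolv_tendsto[OF fI d] by blast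
  obtain N3 where N3: "\<And>m. m \<ge> N3 \<Longrightarrow> norm (fc (\<lambda>x. q x * resolv_lim f x) m) \<le> d"
    using fc_finite_int_bound[OF qfI d] by blast
  show ?thesis
  proof (intro exI[of _ "max (max N1 N2) (max N3 1)"] allI impI)
    fix m assume "max (max N1 N2) (max N3 1) \<le> m"
    then have m: "m \<ge> N1" "m \<ge> N2" "m \<ge> N3" "m > 0" by auto
    define g where "g x = q x * (of_int m * resolv m q x)" for x
    have cm: "continuous_on {0..1} (\<lambda>x. of_int m * resolv m q x)"
      by (intro continuous_intros continuous_on_resolv q)
    have gI: "L1 g" unfolding g_def by (rule AI_mult_cont[OF q cm])
    have dI: "L1 (\<lambda>x. g x - f x)" by (rule set_integral_diff(1)[OF gI fI])
    have "nrm1 (\<lambda>x. g x - f x) \<le> integral {0..1} (\<lambda>x. d * norm (q x))"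
    proof (rule integral_le[OF integrable_norm_of_AI[OF dI]])
      show "(\<lambda>x. d * norm (q x)) integrable_on {0..1}"
        by (rule integrable_on_mult_right[OF integrable_norm_of_AI[OF q]])
      fix x :: real assume x: "x \<in> {0..1}"
      have "g x - f x = (of_int m * resolv m q x - resolv_lim q x) * q x"
        by (simp add: g_def f_def algebra_simps)
      then show "norm (g x - f x) \<le> d * norm (q x)"
        using mult_right_mono[OF N1[OF m(1) x], of "norm (q x)"] by (simp add: norm_mult)
    qed
    then have gf: "nrm1 (\<lambda>x. g x - f x) \<le> d * L" by (simp add: L_def)
    \<comment> \<open>\<open>resolv_bound\<close> converts L_1 closeness of \<open>g\<close> and
      \<open>f\<close> into uniform closeness after the outer multiplier; the limit is then taken
      for the fixed function \<open>f\<close>.\<close>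
    have close: "norm (of_int m * resolv m g x - resolv_lim f x) \<le> 60 * (d * L) + d" if x: "x \<in> {0..1}" for x
    proof -
      have "of_int m * resolv m g x - resolv_lim f x
          = of_int m * resolv m (\<lambda>x. g x - f x) x + (of_int m * resolv m f x - resolv_lim f x)"
        unfolding resolv_diff[OF gI fI x] by (simp add: algebra_simps)
      moreover have "norm (of_int m * resolv m (\<lambda>x. g x - f x) x) \<le> 60 * (d * L)"
        using resolv_bound[OF dI x m(4)] gf by linarith
      moreover have "norm (of_int m * resolv m f x - resolv_lim f x) \<le> d" by (rule N2[OF m(2) x])
      ultimately show ?thesis
        by (simp only:) (intro norm_triangle_le add_mono)
    qed
    have c2: "continuous_on {0..1} (\<lambda>x. of_int m * resolv m g x - resolv_lim f x)"
      by (intro continuous_intros continuous_on_resolv gI continuous_on_resolv_lim fI)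
    have "of_int m ^ 2 * fc (\<lambda>x. q x * resolv m (\<lambda>x. q x * resolv m q x) x) m = fc (\<lambda>x. q x * (of_int m * resolv m g x)) m"
    proof -
      have "resolv m g x = of_int m * resolv m (\<lambda>x. q x * resolv m q x) x" for x
        unfolding resolv_cmult[symmetric] g_def by (simp add: mult_ac)
      then have "(\<lambda>x. q x * (of_int m * resolv m g x)) = (\<lambda>x. of_int m ^ 2 * (q x * resolv m (\<lambda>x. q x * resolv m q x) x))"
        by (simp add: fun_eq_iff power2_eq_square mult_ac)
      then show ?thesis by (simp only: fc_cmult)
    qed
    also have "\<dots> = fc (\<lambda>x. q x * (of_int m * resolv m g x - resolv_lim f x)) m + fc (\<lambda>x. q x * resolv_lim f x) m"
      unfolding fc_add[OF AI_mult_cont[OF q c2] qfI, symmetric] by (simp add: algebra_simps)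
    also have "norm \<dots> \<le> (60 * (d * L) + d) * L + d"
      by (intro norm_triangle_le add_mono N3[OF m(3)]) (use norm_fc_mult_le[OF q c2 close] in \<open>simp add: L_def\<close>)
    also have "\<dots> = d * ((60 * L * L + L) + 1)" by (simp add: algebra_simps)
    also have "\<dots> = e" using L by (simp add: d_def add_nonneg_eq_0_iff)
    finally show "norm (of_int m ^ 2 * fc (\<lambda>x. q x * resolv m (\<lambda>x. q x * resolv m q x) x) m) \<le> e" .
  qed
qed

text \<open>Both primitives in \<open>resolv\<close> lead to the coefficient of
  \<open>q * Q\<close>: that of \<open>q\<close> directly, that of \<open>q * ch (- m)\<close> after
  moving the integration back onto \<open>q\<close>. As \<open>q * Q\<close> is half the derivative
  of the square of \<open>Q\<close>, and zero mean makes \<open>Q\<close> vanish at both ends, the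
  identity carries no error term.\<close>

lemma fc_mult_resolv_gap:
  assumes q: "L1 q" and q0: "fc q 0 = 0" and m: "m \<noteq> 0"
    and Q: "Q = (\<lambda>x. integral {0..x} q)"
  shows "fc (\<lambda>x. q x * resolv m q x) m = 2 * fc Q 0 * fc Q m - fc (\<lambda>x. (Q x)\<^sup>2) m"
proof -
  define g where "g x = q x * ch (- m) x" for x
  have g: "L1 g" unfolding g_def by (rule AI_mult_ch[OF q])
  have AQ: "has_AC_derivative Q q" unfolding Q using has_AC_derivative_integral[OF q, of 0] by simp
  have Qc: "continuous_on {0..1} Q" by (rule has_AC_derivative_continuous[OF AQ])
  have QI: "L1 Q" by (rule AI_continuous[OF Qc])
  have Q01: "Q 0 = 0" "Q 1 = 0" using q0 by (simp_all add: Q fc_def)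
  have pQ: "primit q = Q" using q0 by (simp add: Q primit_def fun_eq_iff)
  have fcqm: "fc q m = 2 * of_real pi * of_int m * \<i> * fc Q m"
    using fc_AC_derivative[OF AQ, of m] Q01 by simp
  have sq: "2 * fc (\<lambda>x. q x * Q x) m = 2 * of_real pi * of_int m * \<i> * fc (\<lambda>x. (Q x)\<^sup>2) m"
  proof -
    have "has_AC_derivative (\<lambda>x. Q x * Q x) (\<lambda>x. q x * Q x + Q x * q x)"
      by (rule has_AC_derivative_mult[OF AQ AQ])
    then have "has_AC_derivative (\<lambda>x. (Q x)\<^sup>2) (\<lambda>x. 2 * (q x * Q x))"
      by (simp add: power2_eq_square mult.commute)
    then show ?thesis using fc_AC_derivative[of _ _ m] Q01 fc_cmult by fastforce
  qed
  have gm: "fc g 0 = fc q m" unfolding g_def by (simp add: fc_mult_ch)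
  have prim: "integral {0..1} (\<lambda>x. q x * primit g x) = fc q m * fc Q 0 - fc (\<lambda>x. q x * Q x) m"
  proof -
    have "integral {0..1} (\<lambda>x. q x * primit g x) = - integral {0..1} (\<lambda>x. (g x - fc g 0) * Q x)"
      using integral_by_parts_AC[OF AQ has_AC_derivative_primit[OF g]] Q01 by simp
    also have "integral {0..1} (\<lambda>x. (g x - fc g 0) * Q x) = integral {0..1} (\<lambda>x. g x * Q x) - integral {0..1} (\<lambda>x. fc g 0 * Q x)"
      unfolding left_diff_distrib
      by (rule HK_integral_diff[OF integrable_of_AI[OF AI_mult_cont[OF g Qc]] integrable_on_mult_right[OF integrable_of_AI[OF QI]]])
    also have "(\<lambda>x. g x * Q x) = (\<lambda>x. q x * Q x * ch (- m) x)" by (simp add: g_def fun_eq_iff mult_ac)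
    finally have "integral {0..1} (\<lambda>x. q x * primit g x) = fc g 0 * integral {0..1} Q - integral {0..1} (\<lambda>x. q x * Q x * ch (- m) x)"
      by simp
    then show ?thesis unfolding gm by (simp add: fc_def)
  qed
  have p0: "fc (\<lambda>x. q x * primit0 h x) k = fc (\<lambda>x. q x * primit h x) k - fc (primit h) 0 * fc q k"
    if h: "L1 h" for h k
  proof -
    have "(\<lambda>x. q x * primit0 h x) = (\<lambda>x. q x * primit h x - fc (primit h) 0 * q x)"
      by (simp add: primit0_def fun_eq_iff algebra_simps)
    moreover have "fc (\<lambda>x. q x * primit h x - fc (primit h) 0 * q x) k = fc (\<lambda>x. q x * primit h x) k - fc (\<lambda>x. fc (primit h) 0 * q x) k"
      by (rule fc_diff[OF AI_mult_cont[OF q continuous_on_primit[OF h]]]) (rule set_integrable_mult_right, rule q)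
    ultimately show ?thesis by (simp add: fc_cmult)
  qed
  have A1: "fc (\<lambda>x. q x * primit0 q x) m = fc (\<lambda>x. q x * Q x) m - fc Q 0 * fc q m"
    using p0[OF q] pQ by simp
  \<comment> \<open>Frequency 0 occurs because this primitive is multiplied by \<open>ch m\<close>
    in \<open>resolv\<close>, which shifts the index m to 0.\<close>
  have A2: "fc (\<lambda>x. q x * primit0 g x) 0 = fc q m * fc Q 0 - fc (\<lambda>x. q x * Q x) m"
    using p0[OF g, of 0] prim q0 by (simp add: fc_def)
  let ?c = "1 / (4 * of_real pi ^ 2 * of_int m) :: complex"
  let ?t = "2 * of_real pi * \<i> :: complex"
  have I1: "L1 (\<lambda>x. q x * primit0 q x)"
    by (rule AI_mult_cont[OF q continuous_on_primit0[OF q]])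
  have I2: "L1 (\<lambda>x. q x * primit0 g x * ch m x)"
    by (rule AI_mult_ch[OF AI_mult_cont[OF q continuous_on_primit0[OF g]]])
  have I3: "L1 (\<lambda>x. ?t * (q x * primit0 q x - q x * primit0 g x * ch m x))"
    by (rule set_integrable_mult_right) (rule set_integral_diff(1)[OF I1 I2])
  have I4: "L1 (\<lambda>x. fc q m / of_int m * (q x * ch m x))"
    by (rule set_integrable_mult_right) (rule AI_mult_ch[OF q])
  have "(\<lambda>x. q x * resolv m q x) = (\<lambda>x. ?c * (?t * (q x * primit0 q x - q x * primit0 g x * ch m x) - fc q m / of_int m * (q x * ch m x)))"
  proof (rule ext)
    fix x
    have gen: "a * ((t * (A - B * C) - 0 / mm - r * C) / D) = 1 / D * (t * (a * A - a * B * C) - r * (a * C))"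
      for a t A B C r D mm :: complex
    proof -
      have "a * (t * (A - B * C) - 0 / mm - r * C) = t * (a * A - a * B * C) - r * (a * C)"
        by (simp add: algebra_simps)
      then show ?thesis by simp
    qed
    show "q x * resolv m q x = ?c * (?t * (q x * primit0 q x - q x * primit0 g x * ch m x) - fc q m / of_int m * (q x * ch m x))"
      unfolding resolv_def q0 g_def by (rule gen)
  qed
  then have "fc (\<lambda>x. q x * resolv m q x) m
      = ?c * (?t * (fc (\<lambda>x. q x * primit0 q x) m - fc (\<lambda>x. q x * primit0 g x) (m - m)) - fc q m / of_int m * fc q (m - m))"
    by (simp only: fc_cmult fc_diff[OF I3 I4] fc_diff[OF I1 I2] fc_mult_ch)
  also have "\<dots> = ?c * (?t * (2 * fc (\<lambda>x. q x * Q x) m - 2 * fc Q 0 * fc q m))"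
    by (simp add: A1 A2 q0)
  also have "\<dots> = ?c * (?t * (?t * of_int m * (fc (\<lambda>x. (Q x)\<^sup>2) m - 2 * fc Q 0 * fc Q m)))"
    unfolding sq fcqm by (simp add: algebra_simps)
  also have "\<dots> = (?c * (?t * (?t * of_int m))) * (fc (\<lambda>x. (Q x)\<^sup>2) m - 2 * fc Q 0 * fc Q m)"
    by (simp only: mult.assoc)
  also have "?c * (?t * (?t * of_int m)) = -1"
    using m by (simp add: field_simps power2_eq_square)
  finally show ?thesis by simp
qed

subsection \<open>Elimination of the nonresonant modes\<close>

lemma summable_on_int_powr:
  assumes "a > 1"
  shows "(\<lambda>k::int. \<bar>of_int k\<bar> powr (- a) :: real) summable_on UNIV"
proof -
  have n: "(\<lambda>n::nat. real n powr (- a)) summable_on UNIV"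
    using assms by (subst summable_on_UNIV_nonneg_real_iff) (auto simp: summable_real_powr_iff)
  have "(\<lambda>k::int. \<bar>of_int k\<bar> powr (- a) :: real) summable_on (range int)"
    using n by (subst summable_on_reindex) (auto simp: o_def)
  moreover have "(\<lambda>k::int. \<bar>of_int k\<bar> powr (- a) :: real) summable_on (range (\<lambda>n. - int n))"
    using n by (subst summable_on_reindex) (auto simp: o_def inj_on_def)
  ultimately have "(\<lambda>k::int. \<bar>of_int k\<bar> powr (- a) :: real) summable_on (range int \<union> range (\<lambda>n. - int n))"
    by (rule summable_on_union)
  moreover have "range int \<union> range (\<lambda>n. - int n) = UNIV"
  proof -
    have "k \<in> range int \<union> range (\<lambda>n. - int n)" for k
      by (cases k rule: int_cases2) auto
    then show ?thesis by blast
  qed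
  ultimately show ?thesis by simp
qed

definition offres :: "int \<Rightarrow> int set" where
  "offres m = {k. k \<noteq> 0 \<and> k \<noteq> m}"

text \<open>Factor gained by one elimination; \<open>tau\<close> below is the price, per unit of
  \<open>s\<close>, for replacing \<open>s + dd m k\<close> by \<open>dd m k\<close>.\<close>

definition sig :: "int \<Rightarrow> real" where
  "sig m = (\<Sum>\<^sub>\<infinity>k\<in>offres m. 1 / \<bar>dd m k\<bar>)"

definition tau :: "int \<Rightarrow> real" where
  "tau m = (\<Sum>\<^sub>\<infinity>k\<in>offres m. 1 / (dd m k)\<^sup>2)"

lemma abs_dd_ge: "\<bar>dd m k\<bar> \<ge> \<bar>of_int k\<bar> * \<bar>of_int (m - k)\<bar>"
proof -
  have "1 * (\<bar>real_of_int k\<bar> * \<bar>real_of_int (m - k)\<bar>) \<le> (4 * pi\<^sup>2) * (\<bar>of_int k\<bar> * \<bar>of_int (m - k)\<bar>)"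
    by (rule mult_right_mono[OF four_pi_sq_ge]) simp
  then show ?thesis by (simp add: dd_def abs_mult mult.assoc)
qed

lemma dd_zero [simp]: "dd m 0 = 0"
  by (simp add: dd_def)

lemma dd_refl: "dd m (m - k) = dd m k"
  by (simp add: dd_def mult_ac)

lemma dd_nonzero: "k \<in> offres m \<Longrightarrow> dd m k \<noteq> 0"
  by (simp add: dd_def offres_def)

text \<open>The first bound interpolates \<open>\<bar>k\<bar> + \<bar>m - k\<bar> \<ge> m powr (3/4) * \<bar>k\<bar> powr (1/4)\<close> in the partial fraction
  decomposition; the exponent \<open>3/4 > 2/3\<close> is what makes the cube of the sum \<open>o(m\<^sup>-\<^sup>2)\<close>.\<close>

lemma inverse_dd_bounds:
  assumes k: "k \<in> offres m" and m: "m > 0"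
  shows "1 / \<bar>dd m k\<bar> \<le> of_int m powr (- 3/4) * (\<bar>of_int k\<bar> powr (- (5/4)) + \<bar>of_int (m - k)\<bar> powr (- (5/4)))"
    and "1 / (dd m k)\<^sup>2 \<le> 2 / (of_int m)\<^sup>2 * (\<bar>of_int k\<bar> powr (- 2) + \<bar>of_int (m - k)\<bar> powr (- 2))"
proof -
  define a b :: real where "a = \<bar>of_int k\<bar>" and "b = \<bar>of_int (m - k)\<bar>"
  have a: "a \<ge> 1" and b: "b \<ge> 1" using k by (auto simp: a_def b_def offres_def)
  have ab: "a + b \<ge> of_int m" by (simp add: a_def b_def)
  have m1: "real_of_int m \<ge> 1" using m by simp
  have d: "\<bar>dd m k\<bar> \<ge> a * b" using abs_dd_ge[of k m] by (simp add: a_def b_def)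
  have abp: "a * b > 0" using a b by simp
  have inv: "1 / (a * b) = 1 / (a * (a + b)) + 1 / (b * (a + b))"
  proof -
    have "1 / a + 1 / b = (a + b) / (a * b)" using a b by (simp add: field_simps)
    moreover have "1 / (a * (a + b)) + 1 / (b * (a + b)) = (1 / a + 1 / b) / (a + b)"
      by (simp add: add_divide_distrib)
    ultimately show ?thesis using a b by simp
  qed
  have half: "1 / (c * (a + b)) \<le> of_int m powr (- 3/4) * c powr (- (5/4))" if c: "c \<ge> 1" "c \<le> a + b" for c
  proof -
    have "of_int m powr (3/4) * c powr (1/4) \<le> (a + b) powr (3/4) * (a + b) powr (1/4)"
      using ab c m1 by (intro mult_mono powr_mono2) auto
    also have "\<dots> = a + b" using a b by (simp flip: powr_add)
    finally have 1: "of_int m powr (3/4) * c powr (1/4) \<le> a + b" .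
    have pos: "of_int m powr (3/4) * c powr (1/4) > 0" using m1 c by simp
    have "1 / (c * (a + b)) \<le> 1 / (c * (of_int m powr (3/4) * c powr (1/4)))"
      using c 1 pos a b by (intro divide_left_mono mult_left_mono mult_pos_pos) auto
    also have "c * (of_int m powr (3/4) * c powr (1/4)) = of_int m powr (3/4) * c powr (5/4)"
    proof -
      have "c powr (5/4) = c powr 1 * c powr (1/4)" using powr_add[of c 1 "1/4"] by simp
      then show ?thesis using c by simp
    qed
    also have "1 / (of_int m powr (3/4) * c powr (5/4)) = of_int m powr (- 3/4) * c powr (- (5/4))"
      using powr_minus_divide[of "real_of_int m" "3/4"] powr_minus_divide[of c "5/4"] by simp
    finally show ?thesis .
  qed
  have "1 / \<bar>dd m k\<bar> \<le> 1 / (a * b)" using d abp by (intro divide_left_mono) auto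
  also have "\<dots> \<le> of_int m powr (- 3/4) * a powr (- (5/4)) + of_int m powr (- 3/4) * b powr (- (5/4))"
    unfolding inv using a b by (intro add_mono half) auto
  finally show "1 / \<bar>dd m k\<bar> \<le> of_int m powr (- 3/4) * (\<bar>of_int k\<bar> powr (- (5/4)) + \<bar>of_int (m - k)\<bar> powr (- (5/4)))"
    by (simp add: a_def b_def distrib_left)
  have "1 / (dd m k)\<^sup>2 = (1 / \<bar>dd m k\<bar>)\<^sup>2" by (simp add: power_divide)
  also have "\<dots> \<le> (1 / (a * b))\<^sup>2" using d abp by (intro power_mono divide_left_mono) auto
  also have "\<dots> \<le> (1 / (of_int m) * (1 / a + 1 / b))\<^sup>2"
  proof (intro power_mono)
    have "1 / (a * b) = 1 / (a + b) * (1 / a + 1 / b)" unfolding inv by (simp add: distrib_left mult.commute)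
    also have "\<dots> \<le> 1 / (of_int m) * (1 / a + 1 / b)"
      using ab m1 a b by (intro mult_right_mono divide_left_mono) auto
    finally show "1 / (a * b) \<le> 1 / (of_int m) * (1 / a + 1 / b)" .
  qed (use a b in auto)
  also have "\<dots> = 1 / (of_int m)\<^sup>2 * (1 / a + 1 / b)\<^sup>2" by (simp only: power_mult_distrib power_one_over)
  also have "\<dots> \<le> 1 / (of_int m)\<^sup>2 * (2 * ((1 / a)\<^sup>2 + (1 / b)\<^sup>2))"
    by (intro mult_left_mono) (use sum_squares_bound[of "1/a" "1/b"] in \<open>simp_all add: power2_sum\<close>)
  also have "\<dots> = 2 / (of_int m)\<^sup>2 * (a powr (- 2) + b powr (- 2))"
    using a b by (simp add: powr_minus_divide power_divide)
  finally show "1 / (dd m k)\<^sup>2 \<le> 2 / (of_int m)\<^sup>2 * (\<bar>of_int k\<bar> powr (- 2) + \<bar>of_int (m - k)\<bar> powr (- 2))"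
    by (simp add: a_def b_def)
qed

lemma has_sum_int_powr_refl:
  assumes "a > 1"
  shows "((\<lambda>k. \<bar>of_int k\<bar> powr (- a) + \<bar>of_int (m - k)\<bar> powr (- a)) has_sum 2 * (\<Sum>\<^sub>\<infinity>k::int. \<bar>of_int k\<bar> powr (- a) :: real)) UNIV"
proof -
  have 1: "((\<lambda>k::int. \<bar>of_int k\<bar> powr (- a) :: real) has_sum (\<Sum>\<^sub>\<infinity>k::int. \<bar>of_int k\<bar> powr (- a))) UNIV"
    by (rule has_sum_infsum[OF summable_on_int_powr[OF assms]])
  have "bij_betw (\<lambda>k. m - k) UNIV UNIV"
    by (rule bij_betwI[where g="\<lambda>k. m - k"]) auto
  from has_sum_reindex_bij_betw[OF this, of "\<lambda>k. \<bar>of_int k\<bar> powr (- a) :: real"] 1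
  have "((\<lambda>k::int. \<bar>of_int (m - k)\<bar> powr (- a) :: real) has_sum (\<Sum>\<^sub>\<infinity>k::int. \<bar>of_int k\<bar> powr (- a))) UNIV" by simp
  from has_sum_add[OF 1 this] show ?thesis by simp
qed

lemma summable_inverse_dd:
  assumes m: "m > 0"
  shows "(\<lambda>k. 1 / \<bar>dd m k\<bar>) summable_on offres m" and "(\<lambda>k. 1 / (dd m k)\<^sup>2) summable_on offres m"
proof -
  have s: "(\<lambda>k. c * (\<bar>of_int k\<bar> powr (- a) + \<bar>of_int (m - k)\<bar> powr (- a)) :: real) summable_on offres m" if "a > 1" for a c
    by (rule summable_on_subset[OF summable_on_cmult_right[OF has_sum_imp_summable[OF has_sum_int_powr_refl[OF that]]]]) auto
  show "(\<lambda>k. 1 / \<bar>dd m k\<bar>) summable_on offres m"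
    by (rule summable_on_comparison_test[OF s inverse_dd_bounds(1)[OF _ m]]) auto
  show "(\<lambda>k. 1 / (dd m k)\<^sup>2) summable_on offres m"
    by (rule summable_on_comparison_test[OF s inverse_dd_bounds(2)[OF _ m]]) auto
qed

lemma sig_tau_bounds:
  "\<exists>C. \<forall>m>0. sig m \<le> C * of_int m powr (- 3/4) \<and> tau m \<le> C / (of_int m)\<^sup>2"
proof -
  define S :: "real \<Rightarrow> real" where "S a = (\<Sum>\<^sub>\<infinity>k::int. \<bar>of_int k\<bar> powr (- a))" for a
  define C where "C = max (2 * S (5/4)) (4 * S 2)"
  have gen: "(\<Sum>\<^sub>\<infinity>k\<in>offres m. f k) \<le> c * (2 * S a)"
    if "f summable_on offres m" "\<And>k. k \<in> offres m \<Longrightarrow> f k \<le> c * (\<bar>of_int k\<bar> powr (- a) + \<bar>of_int (m - k)\<bar> powr (- a))"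
      "c \<ge> 0" "a > 1" for f c a m
  proof -
    have h: "((\<lambda>k. c * (\<bar>of_int k\<bar> powr (- a) + \<bar>of_int (m - k)\<bar> powr (- a))) has_sum (c * (2 * S a))) UNIV"
      unfolding S_def by (rule has_sum_cmult_right[OF has_sum_int_powr_refl[OF that(4)]])
    show ?thesis
      by (rule has_sum_mono_neutral[OF has_sum_infsum[OF that(1)] h]) (use that in auto)
  qed
  show ?thesis
  proof (intro exI[of _ C] allI impI conjI)
    fix m :: int assume m: "m > 0"
    have "sig m \<le> of_int m powr (- 3/4) * (2 * S (5/4))"
      unfolding sig_def by (rule gen[OF summable_inverse_dd(1)[OF m] inverse_dd_bounds(1)[OF _ m]]) auto
    also have "\<dots> \<le> of_int m powr (- 3/4) * C" by (intro mult_left_mono) (auto simp: C_def)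
    finally show "sig m \<le> C * of_int m powr (- 3/4)" by (simp add: mult.commute)
    have "tau m \<le> 2 / (of_int m)\<^sup>2 * (2 * S 2)"
      unfolding tau_def by (rule gen[OF summable_inverse_dd(2)[OF m] inverse_dd_bounds(2)[OF _ m]]) auto
    also have "\<dots> \<le> C / (of_int m)\<^sup>2" by (simp add: C_def divide_right_mono)
    finally show "tau m \<le> C / (of_int m)\<^sup>2" .
  qed
qed

lemma sig_nonneg: "sig m \<ge> 0" and tau_nonneg: "tau m \<ge> 0"
  unfolding sig_def tau_def by (rule infsum_nonneg; simp)+

lemma infsum_diff_complex:
  fixes f g :: "'a \<Rightarrow> complex"
  assumes "f summable_on A" "g summable_on A"
  shows "infsum (\<lambda>x. f x - g x) A = infsum f A - infsum g A"
  using infsum_add[OF assms(1) summable_on_uminus[THEN iffD2, OF assms(2)]] by (simp add: infsum_uminus)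

lemma summable_on_times:
  fixes f :: "'a \<Rightarrow> real" and g :: "'b \<Rightarrow> real"
  assumes f: "f summable_on A" "\<And>a. a \<in> A \<Longrightarrow> f a \<ge> 0" and g: "g summable_on B" "\<And>b. b \<in> B \<Longrightarrow> g b \<ge> 0"
  shows "(\<lambda>(a, b). f a * g b) summable_on A \<times> B"
proof -
  have "(\<lambda>p. norm (f (fst p) * g (snd p))) summable_on A \<times> B"
    unfolding Infinite_Sum.abs_summable_on_Sigma_iff
  proof (intro conjI ballI)
    fix a assume a: "a \<in> A"
    have "(\<lambda>b. f a * g b) summable_on B" by (rule summable_on_cmult_right[OF g(1)])
    then show "(\<lambda>b. norm (f (fst (a, b)) * g (snd (a, b)))) summable_on B"
      by (rule summable_on_cong[THEN iffD1, rotated]) (use a f(2) g(2) in \<open>simp add: abs_mult\<close>)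
  next
    have "(\<lambda>a. f a * infsum g B) summable_on A" by (rule summable_on_cmult_left[OF f(1)])
    moreover have "f a * infsum g B = norm (\<Sum>\<^sub>\<infinity>b\<in>B. norm (f (fst (a, b)) * g (snd (a, b))))" if a: "a \<in> A" for a
    proof -
      have "(\<Sum>\<^sub>\<infinity>b\<in>B. norm (f (fst (a, b)) * g (snd (a, b)))) = (\<Sum>\<^sub>\<infinity>b\<in>B. f a * g b)"
        by (rule infsum_cong) (use a f(2) g(2) in \<open>simp add: abs_mult\<close>)
      also have "\<dots> = f a * infsum g B" by (rule infsum_cmult_right) (rule g(1))
      finally show ?thesis using a f(2) infsum_nonneg[of B g] g(2) by simp
    qed
    ultimately show "(\<lambda>a. norm (\<Sum>\<^sub>\<infinity>b\<in>B. norm (f (fst (a, b)) * g (snd (a, b))))) summable_on A"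
      by (rule summable_on_cong[THEN iffD1, rotated])
  qed
  then have "(\<lambda>p. f (fst p) * g (snd p)) summable_on A \<times> B" by (rule abs_summable_summable)
  then show ?thesis by (simp add: case_prod_unfold)
qed

text \<open>One elimination with \<open>s\<close> set to zero in the denominators, so that its
  iterates do not depend on the eigenvalue.\<close>

definition Kop :: "(int \<Rightarrow> complex) \<Rightarrow> int \<Rightarrow> (int \<Rightarrow> complex) \<Rightarrow> int \<Rightarrow> complex" where
  "Kop c m w j = (\<Sum>\<^sub>\<infinity>i\<in>offres m. c (i - j) * w i / of_real (dd m i))"

lemma dominated_by_summable:
  fixes f :: "int \<Rightarrow> complex"
  assumes "\<And>i. i \<in> A \<Longrightarrow> norm (f i) \<le> C * g i" "g summable_on A"
  shows "f summable_on A" and "(\<lambda>i. norm (f i)) summable_on A" and "norm (infsum f A) \<le> C * infsum g A"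
proof -
  have g: "(\<lambda>i. C * g i) summable_on A" by (rule summable_on_cmult_right[OF assms(2)])
  show 1: "(\<lambda>i. norm (f i)) summable_on A"
    by (rule summable_on_comparison_test[OF g]) (use assms(1) in auto)
  show "f summable_on A" by (rule abs_summable_summable[OF 1])
  have "norm (infsum f A) \<le> infsum (\<lambda>i. norm (f i)) A" by (rule norm_infsum_bound[OF 1])
  also have "\<dots> \<le> infsum (\<lambda>i. C * g i) A" by (rule infsum_mono[OF 1 g]) (use assms(1) in auto)
  also have "\<dots> = C * infsum g A" using assms(2) by (rule infsum_cmult_right)
  finally show "norm (infsum f A) \<le> C * infsum g A" .
qed

lemma norm_times_inverse:
  fixes w z :: complex and d :: real
  assumes "norm w \<le> M" "norm z \<le> W"
  shows "norm (w * z / of_real d) \<le> M * W * (1 / \<bar>d\<bar>)"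
proof -
  have "M \<ge> 0" using assms(1) norm_ge_zero order_trans by blast
  then have "norm w * norm z \<le> M * W" using assms by (intro mult_mono) auto
  then show ?thesis by (simp add: norm_mult norm_divide divide_right_mono)
qed

text \<open>The elimination estimates rest on boundedness alone; keeping them apart from the
  symmetry of the coefficients lets them be applied to the conjugate sequence as well.\<close>

locale bounded_seq =
  fixes c :: "int \<Rightarrow> complex" and M :: real and m :: int
  assumes c_bound: "\<And>k. norm (c k) \<le> M" and m_pos: "m > 0"
begin

lemma M_nonneg: "M \<ge> 0"
  using c_bound[of 0] norm_ge_zero[of "c 0"] by linarith

lemma Kop_summable:
  assumes "\<And>i. norm (w i) \<le> W"
  shows "(\<lambda>i. c (i - j) * w i / of_real (dd m i)) summable_on offres m"
  by (rule dominated_by_summable(1)[OF norm_times_inverse[OF c_bound assms] summable_inverse_dd(1)[OF m_pos]])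

lemma Kop_bound:
  assumes "\<And>i. norm (w i) \<le> W"
  shows "norm (Kop c m w j) \<le> M * sig m * W"
proof -
  have "norm (Kop c m w j) \<le> (M * W) * sig m"
    unfolding Kop_def sig_def
    by (rule dominated_by_summable(3)[OF norm_times_inverse[OF c_bound assms] summable_inverse_dd(1)[OF m_pos]])
  then show ?thesis by (simp only: mult_ac)
qed

lemma Kop_add:
  assumes "\<And>i. norm (w i) \<le> W" "\<And>i. norm (w' i) \<le> W'"
  shows "Kop c m (\<lambda>i. w i + w' i) j = Kop c m w j + Kop c m w' j"
  unfolding Kop_def distrib_left add_divide_distrib
  by (rule infsum_add[OF Kop_summable[OF assms(1)] Kop_summable[OF assms(2)]])

lemma Kop_cmult: "Kop c m (\<lambda>i. w i * a) j = Kop c m w j * a"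
  unfolding Kop_def infsum_cmult_left'[symmetric] by (simp add: mult_ac)

end

abbreviation (input) shifted_sum :: "(int \<Rightarrow> complex) \<Rightarrow> int \<Rightarrow> real \<Rightarrow> (int \<Rightarrow> complex) \<Rightarrow> int \<Rightarrow> complex" where
  "shifted_sum c m s w k \<equiv> (\<Sum>\<^sub>\<infinity>j\<in>offres m. c (j - k) * w j / of_real (s + dd m j))"

definition sol :: "(int \<Rightarrow> complex) \<Rightarrow> int \<Rightarrow> real \<Rightarrow> (int \<Rightarrow> complex) \<Rightarrow> bool" where
  "sol c m s x \<longleftrightarrow> (\<lambda>k. norm (x k)) summable_on UNIV \<and>
     (\<forall>k. of_real (s + dd m k) * x k = (\<Sum>\<^sub>\<infinity>j. c (j - k) * x j))"

context bounded_seq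
begin

lemma conv_summable:
  assumes "(\<lambda>k. norm (x k)) summable_on UNIV"
  shows "(\<lambda>j. c (j - k) * x j) summable_on UNIV"
    and "norm (\<Sum>\<^sub>\<infinity>j. c (j - k) * x j) \<le> M * (\<Sum>\<^sub>\<infinity>j. norm (x j))"
proof -
  have b: "norm (c (j - k) * x j) \<le> M * norm (x j)" for j
    by (simp add: norm_mult mult_right_mono c_bound)
  show "(\<lambda>j. c (j - k) * x j) summable_on UNIV" "norm (\<Sum>\<^sub>\<infinity>j. c (j - k) * x j) \<le> M * (\<Sum>\<^sub>\<infinity>j. norm (x j))"
    by (rule dominated_by_summable[OF b assms])+
qed

text \<open>The condition on \<open>s\<close> keeps the denominators away from zero, so each
  nonresonant \<open>x j\<close> can be expressed through \<open>z j\<close>; the two resonant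
  unknowns stay explicit.\<close>

lemma sol_split:
  assumes x: "sol c m s x" and s: "\<And>k. k \<in> offres m \<Longrightarrow> 2 * \<bar>s\<bar> \<le> \<bar>dd m k\<bar>"
  defines "z \<equiv> \<lambda>k. \<Sum>\<^sub>\<infinity>j. c (j - k) * x j"
  shows "z k = c (- k) * x 0 + c (m - k) * x m + shifted_sum c m s z k"
proof -
  have sm: "(\<lambda>j. c (j - k) * x j) summable_on UNIV" for k
    using x conv_summable by (auto simp: sol_def)
  have xj: "x j = z j / of_real (s + dd m j)" if "j \<in> offres m" for j
  proof -
    have "s + dd m j \<noteq> 0" using s[OF that] dd_nonzero[OF that] by linarith
    moreover have "of_real (s + dd m j) * x j = z j" using x by (simp add: sol_def z_def)
    ultimately show ?thesis by (metis nonzero_mult_div_cancel_left of_real_eq_0_iff)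
  qed
  have U: "UNIV = {0, m} \<union> offres m" by (auto simp: offres_def)
  have "z k = (\<Sum>\<^sub>\<infinity>j\<in>{0, m} \<union> offres m. c (j - k) * x j)" unfolding z_def using U by simp
  also have "\<dots> = (\<Sum>\<^sub>\<infinity>j\<in>{0, m}. c (j - k) * x j) + (\<Sum>\<^sub>\<infinity>j\<in>offres m. c (j - k) * x j)"
    by (rule infsum_Un_disjoint) (use summable_on_subset[OF sm] in \<open>auto simp: offres_def\<close>)
  also have "(\<Sum>\<^sub>\<infinity>j\<in>{0, m}. c (j - k) * x j) = c (- k) * x 0 + c (m - k) * x m"
    using m_pos by simp
  also have "(\<Sum>\<^sub>\<infinity>j\<in>offres m. c (j - k) * x j) = shifted_sum c m s z k"
    by (rule infsum_cong) (simp add: xj)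
  finally show ?thesis .
qed

lemma shifted_dd:
  assumes s: "\<And>k. k \<in> offres m \<Longrightarrow> 2 * \<bar>s\<bar> \<le> \<bar>dd m k\<bar>" and j: "j \<in> offres m"
  shows "s + dd m j \<noteq> 0" "1 / \<bar>s + dd m j\<bar> \<le> 2 * (1 / \<bar>dd m j\<bar>)"
proof -
  have 1: "\<bar>dd m j\<bar> > 0" using dd_nonzero[OF j] by simp
  have 2: "\<bar>s + dd m j\<bar> \<ge> \<bar>dd m j\<bar> / 2" using s[OF j] by linarith
  then show nz: "s + dd m j \<noteq> 0" using 1 by linarith
  have "1 / \<bar>s + dd m j\<bar> \<le> 1 / (\<bar>dd m j\<bar> / 2)" using 1 2 nz by (intro divide_left_mono mult_pos_pos) auto
  then show "1 / \<bar>s + dd m j\<bar> \<le> 2 * (1 / \<bar>dd m j\<bar>)" by simp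
qed

text \<open>The second bound uses 1 / (s + d) - 1 / d = - s / ((s + d) d), which trades
  \<open>sig\<close> for |s| times \<open>tau\<close>.\<close>

lemma shifted_sum_bound:
  assumes s: "\<And>k. k \<in> offres m \<Longrightarrow> 2 * \<bar>s\<bar> \<le> \<bar>dd m k\<bar>" and w: "\<And>k. norm (w k) \<le> W"
  shows "norm (shifted_sum c m s w k) \<le> 2 * M * sig m * W"
    and "norm (shifted_sum c m s w k - Kop c m w k) \<le> 2 * M * \<bar>s\<bar> * tau m * W"
proof -
  have MW: "0 \<le> M * W" using M_nonneg w[of 0] norm_ge_zero[of "w 0"] by (metis mult_nonneg_nonneg order_trans)
  have b: "norm (c (j - k) * w j / of_real (s + dd m j)) \<le> (2 * M * W) * (1 / \<bar>dd m j\<bar>)" if "j \<in> offres m" for j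
  proof -
    have "norm (c (j - k) * w j / of_real (s + dd m j)) \<le> M * W * (1 / \<bar>s + dd m j\<bar>)"
      by (rule norm_times_inverse[OF c_bound w])
    also have "\<dots> \<le> M * W * (2 * (1 / \<bar>dd m j\<bar>))"
      by (rule mult_left_mono[OF shifted_dd(2)[OF s that] MW])
    finally show ?thesis by (simp only: mult_ac)
  qed
  note B = dominated_by_summable[OF b summable_inverse_dd(1)[OF m_pos]]
  show "norm (shifted_sum c m s w k) \<le> 2 * M * sig m * W"
    using B(3) by (simp add: sig_def mult_ac)
  have eq: "shifted_sum c m s w k - Kop c m w k
      = (\<Sum>\<^sub>\<infinity>j\<in>offres m. c (j - k) * w j / of_real (s + dd m j) - c (j - k) * w j / of_real (dd m j))"
    unfolding Kop_def by (rule infsum_diff_complex[OF B(1) Kop_summable[OF w], symmetric])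
  have d: "norm (c (j - k) * w j / of_real (s + dd m j) - c (j - k) * w j / of_real (dd m j)) \<le> (2 * M * \<bar>s\<bar> * W) * (1 / (dd m j)\<^sup>2)"
    if j: "j \<in> offres m" for j
  proof -
    have nz: "s + dd m j \<noteq> 0" "dd m j \<noteq> 0" using shifted_dd(1)[OF s j] dd_nonzero[OF j] by auto
    have "1 / complex_of_real (s + dd m j) - 1 / of_real (dd m j) = of_real (1 / (s + dd m j) - 1 / dd m j)" by simp
    also have "1 / (s + dd m j) - 1 / dd m j = - s / ((s + dd m j) * dd m j)"
      using nz by (simp add: field_simps)
    finally have e: "1 / complex_of_real (s + dd m j) - 1 / of_real (dd m j) = of_real (- s / ((s + dd m j) * dd m j))" .
    have "c (j - k) * w j / of_real (s + dd m j) - c (j - k) * w j / of_real (dd m j)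
        = c (j - k) * w j * (1 / of_real (s + dd m j) - 1 / of_real (dd m j))"
      by (simp add: right_diff_distrib)
    also have "norm \<dots> = norm (c (j - k)) * norm (w j) * (\<bar>s\<bar> * (1 / \<bar>s + dd m j\<bar>) * (1 / \<bar>dd m j\<bar>))"
      unfolding e norm_mult norm_of_real by (simp add: abs_mult)
    also have "\<dots> \<le> M * W * (\<bar>s\<bar> * (2 * (1 / \<bar>dd m j\<bar>)) * (1 / \<bar>dd m j\<bar>))"
      using MW by (intro mult_mono mult_left_mono mult_right_mono c_bound w shifted_dd(2)[OF s j] M_nonneg) auto
    also have "\<dots> = (2 * M * \<bar>s\<bar> * W) * (1 / (dd m j)\<^sup>2)"
      by (simp add: power2_eq_square)
    finally show ?thesis .
  qed
  show "norm (shifted_sum c m s w k - Kop c m w k) \<le> 2 * M * \<bar>s\<bar> * tau m * W"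
    unfolding eq using dominated_by_summable(3)[OF d summable_inverse_dd(2)[OF m_pos]] by (simp add: tau_def mult_ac)
qed

end

lemma offres_refl: "(\<lambda>k. m - k) ` offres m = offres m"
proof -
  have "k \<in> (\<lambda>k. m - k) ` offres m" if "k \<in> offres m" for k
    by (rule image_eqI[of _ _ "m - k"]) (use that in \<open>auto simp: offres_def\<close>)
  then show ?thesis by (auto simp: offres_def)
qed

text \<open>Truncated Neumann series: \<open>Acoef\<close> and \<open>Bcoef\<close> are the
  responses in mode 0 to unit amplitudes of the modes 0 and m. The leading diagonal term would be
  \<open>c 0\<close>, which is zero for the potential.\<close>

definition Acoef :: "(int \<Rightarrow> complex) \<Rightarrow> int \<Rightarrow> complex" where
  "Acoef c m = Kop c m (\<lambda>j. c (- j)) 0 + Kop c m (Kop c m (\<lambda>j. c (- j))) 0"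

definition Bcoef :: "(int \<Rightarrow> complex) \<Rightarrow> int \<Rightarrow> complex" where
  "Bcoef c m = c m + Kop c m (\<lambda>j. c (m - j)) 0 + Kop c m (Kop c m (\<lambda>j. c (m - j))) 0"

text \<open>The first summand pays for setting s = 0 in the denominators, directly and after one
  \<open>Kop\<close>; the second bounds what three eliminations leave over.\<close>

definition err :: "real \<Rightarrow> int \<Rightarrow> real \<Rightarrow> real" where
  "err M m r = 4 * M\<^sup>2 * r * tau m * (1 + M * sig m) + 4 * M ^ 4 * sig m ^ 3"

context bounded_seq
begin

text \<open>Estimating the convolution \<open>z\<close> instead of \<open>x\<close> closes the
  argument: its supremum satisfies Z <= M W + 2 M sig Z, and small \<open>sig\<close> absorbs the
  last term. Dividing by \<open>s + dd m k\<close> then bounds the nonresonant \<open>x k\<close>,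
  and iterating z = (resonant terms) + \<open>Kop\<close> z + e gives the last estimate.\<close>

lemma sol_bounds:
  assumes x: "sol c m s x" and s: "\<And>k. k \<in> offres m \<Longrightarrow> 2 * \<bar>s\<bar> \<le> \<bar>dd m k\<bar>"
    and small: "4 * M * sig m \<le> 1"
  defines "z \<equiv> \<lambda>k. \<Sum>\<^sub>\<infinity>j. c (j - k) * x j" and "W \<equiv> norm (x 0) + norm (x m)"
  shows "norm (z k) \<le> 2 * M * W"
    and "k \<in> offres m \<Longrightarrow> norm (x k) \<le> 4 * M * W * (1 / \<bar>dd m k\<bar>)"
    and "norm (z k - (c (- k) * x 0 + c (m - k) * x m)) \<le> 4 * M\<^sup>2 * sig m * W"
    and "\<bar>s\<bar> \<le> r \<Longrightarrow> c 0 = 0 \<Longrightarrow> norm (of_real s * x 0 - (Acoef c m * x 0 + Bcoef c m * x m)) \<le> err M m r * W"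
proof -
  have xs: "(\<lambda>k. norm (x k)) summable_on UNIV" using x by (simp add: sol_def)
  have W0: "W \<ge> 0" by (simp add: W_def)
  have split: "z k = c (- k) * x 0 + c (m - k) * x m + shifted_sum c m s z k" for k
    unfolding z_def by (rule sol_split[OF x s])
  have zb: "norm (z k) \<le> M * (\<Sum>\<^sub>\<infinity>j. norm (x j))" for k
    unfolding z_def by (rule conv_summable(2)[OF xs])
  define Z where "Z = (SUP k. norm (z k))"
  \<comment> \<open>Finiteness of \<open>Z\<close>, a consequence of the absolute summability of
    \<open>x\<close>, is what makes the absorption below legitimate.\<close>
  have bdd: "bdd_above (range (\<lambda>k. norm (z k)))" by (rule bdd_aboveI2[OF zb])
  have zZ: "norm (z k) \<le> Z" for k unfolding Z_def by (rule cSUP_upper[OF UNIV_I bdd])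
  have Z0: "Z \<ge> 0" using zZ[of 0] norm_ge_zero order_trans by blast
  have first: "norm (c (- k) * x 0 + c (m - k) * x m) \<le> M * W" for k
    unfolding W_def distrib_left
    by (intro norm_triangle_le add_mono) (simp_all add: norm_mult mult_right_mono c_bound)
  have "Z \<le> M * W + 2 * M * sig m * Z"
    unfolding Z_def
  proof (rule cSUP_least)
    fix k
    show "norm (z k) \<le> M * W + 2 * M * sig m * (SUP k. norm (z k))"
      unfolding Z_def[symmetric]
      by (subst split, intro norm_triangle_le add_mono first) (rule shifted_sum_bound(1)[OF s zZ])
  qed simp
  moreover have "(4 * M * sig m) * Z \<le> 1 * Z" by (rule mult_right_mono[OF small Z0])
  ultimately have Zle: "Z \<le> 2 * M * W" by simp
  have zW: "norm (z k) \<le> 2 * M * W" for k using zZ[of k] Zle by linarith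
  then show "norm (z k) \<le> 2 * M * W" .
  show "norm (x k) \<le> 4 * M * W * (1 / \<bar>dd m k\<bar>)" if k: "k \<in> offres m"
  proof -
    have nz: "s + dd m k \<noteq> 0" by (rule shifted_dd(1)[OF s k])
    have "of_real (s + dd m k) * x k = z k" using x by (simp add: sol_def z_def)
    then have "\<bar>s + dd m k\<bar> * norm (x k) = norm (z k)" by (metis norm_mult norm_of_real)
    then have "norm (x k) = norm (z k) * (1 / \<bar>s + dd m k\<bar>)" using nz by (simp add: field_simps)
    also have "\<dots> \<le> (2 * M * W) * (2 * (1 / \<bar>dd m k\<bar>))"
      by (intro mult_mono zW shifted_dd(2)[OF s k]) (use M_nonneg W0 in auto)
    finally show ?thesis by simp
  qed
  define r1 where "r1 k = z k - (c (- k) * x 0 + c (m - k) * x m)" for k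
  have r1: "norm (r1 k) \<le> 4 * M\<^sup>2 * sig m * W" for k
  proof -
    have "r1 k = shifted_sum c m s z k"
      unfolding r1_def using split[of k] by simp
    then have "norm (r1 k) \<le> 2 * M * sig m * (2 * M * W)" using shifted_sum_bound(1)[OF s zW] by simp
    then show ?thesis by (simp add: power2_eq_square mult_ac)
  qed
  then show "norm (z k - (c (- k) * x 0 + c (m - k) * x m)) \<le> 4 * M\<^sup>2 * sig m * W"
    by (simp add: r1_def)
  show "norm (of_real s * x 0 - (Acoef c m * x 0 + Bcoef c m * x m)) \<le> err M m r * W"
    if sr: "\<bar>s\<bar> \<le> r" and c0: "c 0 = 0"
  proof -
    \<comment> \<open>Cost of dropping \<open>s\<close> from the denominators, proportional to |s|
      and \<open>tau\<close>.\<close>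
    define e where "e k = r1 k - Kop c m z k" for k
    define E where "E = 4 * M\<^sup>2 * r * tau m * W"
    have e: "norm (e k) \<le> E" for k
    proof -
      have "e k = shifted_sum c m s z k - Kop c m z k"
        unfolding e_def r1_def using split[of k] by simp
      then have "norm (e k) \<le> 2 * M * \<bar>s\<bar> * tau m * (2 * M * W)"
        using shifted_sum_bound(2)[OF s zW] by simp
      also have "\<dots> \<le> 2 * M * r * tau m * (2 * M * W)"
        using M_nonneg W0 tau_nonneg sr by (intro mult_right_mono mult_left_mono) auto
      finally show ?thesis by (simp add: E_def power2_eq_square mult_ac)
    qed
    let ?a = "\<lambda>j. c (- j)" and ?b = "\<lambda>j. c (m - j)"
    have zeq: "z = (\<lambda>k. (?a k * x 0 + ?b k * x m) + r1 k)" by (simp add: r1_def fun_eq_iff)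
    have ab: "norm (?a k * x 0) \<le> M * norm (x 0)" "norm (?b k * x m) \<le> M * norm (x m)" for k
      by (simp_all add: norm_mult mult_right_mono c_bound)
    have abs: "norm (?a k * x 0 + ?b k * x m) \<le> M * W" for k by (rule first)
    have Kz: "Kop c m z k = Kop c m ?a k * x 0 + Kop c m ?b k * x m + Kop c m r1 k" for k
      unfolding zeq Kop_add[OF abs r1] Kop_add[OF ab] Kop_cmult by simp
    have r1eq: "r1 = (\<lambda>k. Kop c m z k + e k)" by (simp add: e_def fun_eq_iff)
    have Ka: "norm (Kop c m ?a k * x 0) \<le> M * sig m * M * norm (x 0)" for k
      by (simp add: norm_mult mult_right_mono Kop_bound[OF c_bound])
    have Kb: "norm (Kop c m ?b k * x m) \<le> M * sig m * M * norm (x m)" for k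
      by (simp add: norm_mult mult_right_mono Kop_bound[OF c_bound])
    have Kab: "norm (Kop c m ?a k * x 0 + Kop c m ?b k * x m) \<le> M * sig m * M * norm (x 0) + M * sig m * M * norm (x m)" for k
      by (intro norm_triangle_le add_mono Ka Kb)
    have Kr: "norm (Kop c m r1 k) \<le> M * sig m * (4 * M\<^sup>2 * sig m * W)" for k
      by (rule Kop_bound[OF r1])
    have Kzb: "norm (Kop c m z k) \<le> M * sig m * (2 * M * W)" for k by (rule Kop_bound[OF zW])
    \<comment> \<open>Third elimination: \<open>z\<close> in \<open>r1 = Kop c m z + e\<close> is
      expanded once more. The remainder has two further \<open>Kop\<close> applied to
      \<open>r1\<close>, which already carries one factor \<open>sig\<close>.\<close>
    have Kr1: "Kop c m r1 k = Kop c m (Kop c m ?a) k * x 0 + Kop c m (Kop c m ?b) k * x m + Kop c m (Kop c m r1) k + Kop c m e k" for k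
    proof -
      have "Kop c m r1 k = Kop c m (\<lambda>k. Kop c m z k) k + Kop c m e k"
        by (subst r1eq) (rule Kop_add[OF Kzb e])
      also have "Kop c m (\<lambda>k. Kop c m z k) k = Kop c m (Kop c m ?a) k * x 0 + Kop c m (Kop c m ?b) k * x m + Kop c m (Kop c m r1) k"
        unfolding Kz Kop_add[OF Kab Kr] Kop_add[OF Ka Kb] Kop_cmult by simp
      finally show ?thesis .
    qed
    have "of_real (s + dd m 0) * x 0 = z 0" using x unfolding sol_def z_def by blast
    then have "of_real s * x 0 = z 0" by simp
    also have "\<dots> = c m * x m + Kop c m z 0 + e 0"
      using c0 by (simp add: r1_def e_def)
    also have "\<dots> = Acoef c m * x 0 + Bcoef c m * x m + (Kop c m (Kop c m r1) 0 + Kop c m e 0 + e 0)"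
      by (simp only: Kz[of 0] Kr1[of 0] Acoef_def Bcoef_def) (simp add: algebra_simps)
    finally have "norm (of_real s * x 0 - (Acoef c m * x 0 + Bcoef c m * x m)) = norm (Kop c m (Kop c m r1) 0 + Kop c m e 0 + e 0)"
      by simp
    also have "\<dots> \<le> M * sig m * (M * sig m * (4 * M\<^sup>2 * sig m * W)) + M * sig m * E + E"
      by (intro norm_triangle_le add_mono Kop_bound Kr e)
    also have "\<dots> = err M m r * W"
      by (simp add: err_def E_def power2_eq_square power3_eq_cube power4_eq_xxxx algebra_simps)
    finally show ?thesis .
  qed
qed

end

section \<open>Reflection and self-adjointness\<close>

lemma Kop_cnj: "Kop (\<lambda>k. cnj (c k)) m (\<lambda>k. cnj (w k)) = (\<lambda>j. cnj (Kop c m w j))"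
  unfolding Kop_def by (simp flip: infsum_cnj)

lemma Acoef_cnj: "Acoef (\<lambda>k. cnj (c k)) m = cnj (Acoef c m)"
  and Bcoef_cnj: "Bcoef (\<lambda>k. cnj (c k)) m = cnj (Bcoef c m)"
  unfolding Acoef_def Bcoef_def by (simp_all add: Kop_cnj)

locale hermitian_seq = bounded_seq +
  assumes c_cnj: "c (- k) = cnj (c k)" and c_zero: "c 0 = 0"
begin

text \<open>The map k to m - k preserves \<open>dd\<close> and reverses differences of indices,
  which conjugates \<open>c\<close>. It exchanges the resonant modes, so the equation for
  \<open>x m\<close> needs no elimination of its own.\<close>

lemma sol_refl:
  assumes "sol c m s x"
  shows "sol (\<lambda>k. cnj (c k)) m s (\<lambda>k. x (m - k))"
proof -
  have bij: "bij_betw (\<lambda>k. m - k) UNIV UNIV"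
    by (rule bij_betwI[where g="\<lambda>k. m - k"]) auto
  have "(\<lambda>k. norm (x (m - k))) summable_on UNIV"
    using assms summable_on_reindex_bij_betw[OF bij, of "\<lambda>k. norm (x k)"] by (simp add: sol_def)
  moreover have "of_real (s + dd m k) * x (m - k) = (\<Sum>\<^sub>\<infinity>j. cnj (c (j - k)) * x (m - j))" for k
  proof -
    have "of_real (s + dd m (m - k)) * x (m - k) = (\<Sum>\<^sub>\<infinity>j. c (j - (m - k)) * x j)"
      using assms by (simp add: sol_def)
    also have "\<dots> = (\<Sum>\<^sub>\<infinity>j. c ((m - j) - (m - k)) * x (m - j))"
      by (rule infsum_reindex_bij_betw[OF bij, symmetric])
    also have "\<dots> = (\<Sum>\<^sub>\<infinity>j. cnj (c (j - k)) * x (m - j))"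
      by (simp flip: c_cnj)
    finally show ?thesis by (simp add: dd_refl)
  qed
  ultimately show ?thesis by (simp add: sol_def)
qed

lemma cnj_seq: "bounded_seq (\<lambda>k. cnj (c k)) M m"
  by unfold_locales (use c_bound m_pos in auto)

lemma sol_error:
  assumes x: "sol c m s x" and s: "\<And>k. k \<in> offres m \<Longrightarrow> 2 * \<bar>s\<bar> \<le> \<bar>dd m k\<bar>"
    and small: "4 * M * sig m \<le> 1" and r: "\<bar>s\<bar> \<le> r"
  defines "W \<equiv> norm (x 0) + norm (x m)"
  shows "norm (of_real s * x 0 - (Acoef c m * x 0 + Bcoef c m * x m)) \<le> err M m r * W"
    and "norm (of_real s * x m - (cnj (Acoef c m) * x m + cnj (Bcoef c m) * x 0)) \<le> err M m r * W"
proof -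
  show "norm (of_real s * x 0 - (Acoef c m * x 0 + Bcoef c m * x m)) \<le> err M m r * W"
    unfolding W_def by (rule sol_bounds(4)[OF x s small r c_zero])
  interpret b: bounded_seq "\<lambda>k. cnj (c k)" M m by (rule cnj_seq)
  show "norm (of_real s * x m - (cnj (Acoef c m) * x m + cnj (Bcoef c m) * x 0)) \<le> err M m r * W"
    using b.sol_bounds(4)[OF sol_refl[OF x] s small r] c_zero
    by (simp add: W_def Acoef_cnj Bcoef_cnj add.commute)
qed

text \<open>A priori bound showing that \<open>s\<close> is small; it is what makes the remainder \<open>err\<close> negligible.\<close>

lemma sol_shift_bound:
  assumes x: "sol c m s x" and s: "\<And>k. k \<in> offres m \<Longrightarrow> 2 * \<bar>s\<bar> \<le> \<bar>dd m k\<bar>"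
    and small: "4 * M * sig m \<le> 1" and nz: "x \<noteq> (\<lambda>k. 0)"
  shows "norm (x 0) + norm (x m) > 0" and "\<bar>s\<bar> \<le> norm (c m) + 8 * M\<^sup>2 * sig m"
proof -
  define W where "W = norm (x 0) + norm (x m)"
  show W: "norm (x 0) + norm (x m) > 0"
  proof (rule ccontr)
    assume "\<not> norm (x 0) + norm (x m) > 0"
    then have *: "norm (x 0) + norm (x m) = 0" using norm_ge_zero by (smt (verit))
    then have "norm (x 0) = 0" "norm (x m) = 0"
      using norm_ge_zero[of "x 0"] norm_ge_zero[of "x m"] by linarith+
    then have "x k = 0" for k
      using sol_bounds(2)[OF x s small, of k] unfolding * by (cases "k \<in> offres m") (auto simp: offres_def)
    then show False using nz by auto
  qed
  interpret b: bounded_seq "\<lambda>k. cnj (c k)" M m by (rule cnj_seq)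
  have 1: "norm (of_real s * x 0 - c m * x m) \<le> 4 * M\<^sup>2 * sig m * W"
  proof -
    have "of_real (s + dd m 0) * x 0 = (\<Sum>\<^sub>\<infinity>j. c (j - 0) * x j)" using x unfolding sol_def by blast
    then show ?thesis using sol_bounds(3)[OF x s small, of 0] c_zero by (simp add: W_def)
  qed
  have 2: "norm (of_real s * x m - cnj (c m) * x 0) \<le> 4 * M\<^sup>2 * sig m * W"
  proof -
    have "of_real (s + dd m 0) * x (m - 0) = (\<Sum>\<^sub>\<infinity>j. cnj (c (j - 0)) * x (m - j))"
      using sol_refl[OF x] unfolding sol_def by blast
    then show ?thesis using b.sol_bounds(3)[OF sol_refl[OF x] s small, of 0] c_zero by (simp add: W_def add.commute)
  qed
  have "\<bar>s\<bar> * W \<le> (norm (c m) + 8 * M\<^sup>2 * sig m) * W"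
  proof -
    have "\<bar>s\<bar> * norm (x 0) \<le> norm (c m) * norm (x m) + 4 * M\<^sup>2 * sig m * W"
      using 1 norm_triangle_ineq2[of "of_real s * x 0" "c m * x m"] by (simp add: norm_mult)
    moreover have "\<bar>s\<bar> * norm (x m) \<le> norm (c m) * norm (x 0) + 4 * M\<^sup>2 * sig m * W"
      using 2 norm_triangle_ineq2[of "of_real s * x m" "cnj (c m) * x 0"] by (simp add: norm_mult)
    ultimately show ?thesis by (simp add: W_def algebra_simps)
  qed
  then show "\<bar>s\<bar> \<le> norm (c m) + 8 * M\<^sup>2 * sig m" using W by (simp add: W_def)
qed

text \<open>Self-adjointness on the level of coefficients: pairing each equation with the other
  solution gives the same double sum, up to an interchange justified by absolute summability, and
  the difference is (s - t) times the inner product.\<close>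

lemma sol_orthogonal:
  assumes x: "sol c m s x" and y: "sol c m t y" and st: "s \<noteq> t"
  shows "((\<lambda>k. x k * cnj (y k)) has_sum 0) UNIV"
proof -
  have xs: "(\<lambda>k. norm (x k)) summable_on UNIV" and ys: "(\<lambda>k. norm (y k)) summable_on UNIV"
    using x y by (simp_all add: sol_def)
  have xeq: "of_real (s + dd m k) * x k = (\<Sum>\<^sub>\<infinity>j. c (j - k) * x j)"
    and yeq: "of_real (t + dd m k) * y k = (\<Sum>\<^sub>\<infinity>j. c (j - k) * y j)" for k
    using x y by (simp_all add: sol_def)
  have F: "(\<lambda>(k, j). norm (c (j - k) * x j * cnj (y k))) summable_on UNIV \<times> UNIV"
  proof (rule summable_on_comparison_test)
    have "(\<lambda>(k, j). norm (y k) * norm (x j)) summable_on UNIV \<times> UNIV"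
      by (rule summable_on_times) (use xs ys in auto)
    then have "(\<lambda>p. M * (case p of (k, j) \<Rightarrow> norm (y k) * norm (x j))) summable_on UNIV \<times> UNIV"
      by (rule summable_on_cmult_right)
    then show "(\<lambda>(k, j). M * (norm (y k) * norm (x j))) summable_on UNIV \<times> UNIV"
      by (simp add: case_prod_unfold)
  next
    fix p :: "int \<times> int"
    obtain k j where p: "p = (k, j)" by force
    have "norm (c (j - k)) * (norm (y k) * norm (x j)) \<le> M * (norm (y k) * norm (x j))"
      by (rule mult_right_mono[OF c_bound]) simp
    then show "(case p of (k, j) \<Rightarrow> norm (c (j - k) * x j * cnj (y k))) \<le> (case p of (k, j) \<Rightarrow> M * (norm (y k) * norm (x j)))"
      by (simp add: p norm_mult mult_ac)
  qed auto
  have Fs: "(\<lambda>(k, j). c (j - k) * x j * cnj (y k)) summable_on UNIV \<times> UNIV"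
    by (rule abs_summable_summable) (use F in \<open>simp add: case_prod_unfold\<close>)
  have S1: "(\<Sum>\<^sub>\<infinity>k. of_real (s + dd m k) * x k * cnj (y k)) = (\<Sum>\<^sub>\<infinity>k. \<Sum>\<^sub>\<infinity>j. c (j - k) * x j * cnj (y k))"
    unfolding xeq by (simp add: infsum_cmult_left')
  have S2: "(\<Sum>\<^sub>\<infinity>k. x k * cnj (of_real (t + dd m k) * y k)) = (\<Sum>\<^sub>\<infinity>k. \<Sum>\<^sub>\<infinity>j. c (k - j) * x k * cnj (y j))"
  proof -
    have "x k * cnj (of_real (t + dd m k) * y k) = (\<Sum>\<^sub>\<infinity>j. c (k - j) * x k * cnj (y j))" for k
    proof -
      have "x k * cnj (of_real (t + dd m k) * y k) = x k * (\<Sum>\<^sub>\<infinity>j. cnj (c (j - k) * y j))"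
        unfolding yeq infsum_cnj ..
      also have "\<dots> = (\<Sum>\<^sub>\<infinity>j. x k * cnj (c (j - k) * y j))" by (rule infsum_cmult_right'[symmetric])
      also have "\<dots> = (\<Sum>\<^sub>\<infinity>j. c (k - j) * x k * cnj (y j))"
      proof (rule infsum_cong)
        fix j
        have "cnj (c (j - k)) = c (k - j)" using c_cnj[of "j - k"] by simp
        then show "x k * cnj (c (j - k) * y j) = c (k - j) * x k * cnj (y j)" by simp
      qed
      finally show ?thesis .
    qed
    then show ?thesis by simp
  qed
  have swap: "(\<Sum>\<^sub>\<infinity>k. \<Sum>\<^sub>\<infinity>j. c (j - k) * x j * cnj (y k)) = (\<Sum>\<^sub>\<infinity>j. \<Sum>\<^sub>\<infinity>k. c (j - k) * x j * cnj (y k))"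
    by (rule infsum_swap_banach[OF Fs])
  have zb: "norm (\<Sum>\<^sub>\<infinity>j. c (j - k) * w j) \<le> M * (\<Sum>\<^sub>\<infinity>j. norm (w j))" if "(\<lambda>k. norm (w k)) summable_on UNIV" for w k
    by (rule conv_summable(2)[OF that])
  \<comment> \<open>The multiplier is unbounded in k, but the equation turns its product with
    \<open>x k\<close> into a bounded convolution.\<close>
  have s1: "(\<lambda>k. of_real (s + dd m k) * x k * cnj (y k)) summable_on UNIV"
    by (rule dominated_by_summable(1)[OF _ ys, where C="M * (\<Sum>\<^sub>\<infinity>j. norm (x j))"])
       (simp add: xeq norm_mult mult_right_mono zb[OF xs] del: of_real_add)
  have s2: "(\<lambda>k. x k * cnj (of_real (t + dd m k) * y k)) summable_on UNIV"
    by (rule dominated_by_summable(1)[OF _ xs, where C="M * (\<Sum>\<^sub>\<infinity>j. norm (y j))"], unfold yeq norm_mult complex_mod_cnj,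
        subst mult.commute, rule mult_right_mono[OF zb[OF ys]]) simp
  have d: "(\<lambda>k. of_real (s + dd m k) * x k * cnj (y k) - x k * cnj (of_real (t + dd m k) * y k)) = (\<lambda>k. of_real (s - t) * (x k * cnj (y k)))"
    by (simp add: fun_eq_iff algebra_simps)
  have "(\<Sum>\<^sub>\<infinity>k. of_real (s - t) * (x k * cnj (y k))) = 0"
    unfolding d[symmetric] infsum_diff_complex[OF s1 s2] S1 S2 swap by simp
  then have "(\<Sum>\<^sub>\<infinity>k. x k * cnj (y k)) = 0" using st by (simp add: infsum_cmult_right')
  moreover have "(\<lambda>k. x k * cnj (y k)) summable_on UNIV"
  proof (rule dominated_by_summable(1)[OF _ xs])
    fix k
    have "norm (y k) \<le> (\<Sum>\<^sub>\<infinity>j. norm (y j))" using finite_sum_le_infsum[OF ys, of "{k}"] by simp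
    then show "norm (x k * cnj (y k)) \<le> (\<Sum>\<^sub>\<infinity>j. norm (y j)) * norm (x k)"
      by (simp add: norm_mult mult.commute mult_left_mono)
  qed
  ultimately show ?thesis using has_sum_iff by blast
qed

end

subsection \<open>The two by two problem\<close>

text \<open>The square of the matrix with zero diagonal and off-diagonal entries B and
  \<open>cnj B\<close> is |B|^2 times the identity. Hence |a^2 - |B|^2| is at most 2 e (|a| + |B|),
  and dividing by |a| + |B| leaves a statement on moduli.\<close>

lemma hermitian_eigen_approx:
  fixes u v B :: complex and a e :: real
  assumes "norm (of_real a * u - B * v) \<le> e * (norm u + norm v)"
    and "norm (of_real a * v - cnj B * u) \<le> e * (norm u + norm v)"
    and W: "norm u + norm v > 0"
  shows "\<bar>\<bar>a\<bar> - norm B\<bar> \<le> 2 * e"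
proof -
  \<comment> \<open>The larger component is divided out; the other case follows by exchanging the
    components and conjugating \<open>B\<close>.\<close>
  have main: "\<bar>\<bar>a\<bar> - norm B\<bar> \<le> 2 * e"
    if 1: "norm (of_real a * u - B * v) \<le> e * (norm u + norm v)"
      and 2: "norm (of_real a * v - cnj B * u) \<le> e * (norm u + norm v)"
      and uv: "norm v \<le> norm u" and u: "norm u > 0" for u v B :: complex
  proof -
    have e0: "e \<ge> 0"
    proof -
      have "0 \<le> e * (norm u + norm v)" using 1 norm_ge_zero order_trans by blast
      moreover have "norm u + norm v > 0" using u norm_ge_zero[of v] by linarith
      ultimately show ?thesis by (simp add: zero_le_mult_iff)
    qed
    have "B * cnj B = of_real ((norm B)\<^sup>2)" by (rule complex_norm_square[symmetric])
    then have "of_real (a\<^sup>2 - (norm B)\<^sup>2) * u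
        = of_real a * (of_real a * u - B * v) + B * (of_real a * v - cnj B * u)"
      by (simp add: algebra_simps power2_eq_square)
    then have "\<bar>a\<^sup>2 - (norm B)\<^sup>2\<bar> * norm u = norm (of_real a * (of_real a * u - B * v) + B * (of_real a * v - cnj B * u))"
      by (metis norm_mult norm_of_real)
    also have "\<dots> \<le> \<bar>a\<bar> * (e * (norm u + norm v)) + norm B * (e * (norm u + norm v))"
      by (intro norm_triangle_le add_mono) (auto simp: norm_mult intro!: mult_left_mono 1 2)
    also have "\<dots> = (\<bar>a\<bar> + norm B) * e * (norm u + norm v)" by (simp add: algebra_simps)
    also have "\<dots> \<le> (\<bar>a\<bar> + norm B) * e * (2 * norm u)"
      using uv e0 by (intro mult_left_mono) auto
    finally have "\<bar>a\<^sup>2 - (norm B)\<^sup>2\<bar> * norm u \<le> ((\<bar>a\<bar> + norm B) * (2 * e)) * norm u" by (simp add: mult_ac)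
    then have 3: "\<bar>a\<^sup>2 - (norm B)\<^sup>2\<bar> \<le> (\<bar>a\<bar> + norm B) * (2 * e)" using u by simp
    have "a\<^sup>2 - (norm B)\<^sup>2 = (\<bar>a\<bar> + norm B) * (\<bar>a\<bar> - norm B)"
      by (simp add: power2_eq_square algebra_simps)
    then have le: "(\<bar>a\<bar> + norm B) * \<bar>\<bar>a\<bar> - norm B\<bar> \<le> (\<bar>a\<bar> + norm B) * (2 * e)"
      using 3 by (simp add: abs_mult)
    show ?thesis
    proof (cases "\<bar>a\<bar> + norm B = 0")
      case True
      then have "a = 0" "norm B = 0" using norm_ge_zero[of B] by linarith+
      then show ?thesis using e0 by simp
    next
      case False
      then have "\<bar>a\<bar> + norm B > 0" using norm_ge_zero[of B] by linarith
      then show ?thesis by (rule mult_left_le_imp_le[OF le])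
    qed
  qed
  show ?thesis
  proof (cases "norm v \<le> norm u")
    case True
    then show ?thesis using main[OF assms(1,2)] W by linarith
  next
    case False
    then have "norm v > 0" using norm_ge_zero[of u] by linarith
    then show ?thesis using main[of v "cnj B" u] assms False by (simp add: add.commute)
  qed
qed

text \<open>The trace of the matrix is zero: (a1 + a2) times the determinant of the two vectors is a
  combination of the four residuals. A lower bound on the determinant thus makes a1 + a2 small, and
  a1 <= a2 assigns the signs.\<close>

lemma hermitian_pair_approx:
  fixes B u1 v1 u2 v2 :: complex and a1 a2 e :: real
  defines "W1 \<equiv> norm u1 + norm v1" and "W2 \<equiv> norm u2 + norm v2"
  assumes h1: "norm (of_real a1 * u1 - B * v1) \<le> e * W1" "norm (of_real a1 * v1 - cnj B * u1) \<le> e * W1"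
    and h2: "norm (of_real a2 * u2 - B * v2) \<le> e * W2" "norm (of_real a2 * v2 - cnj B * u2) \<le> e * W2"
    and W: "W1 > 0" "W2 > 0" and D: "2/5 * (W1 * W2) \<le> norm (u1 * v2 - v1 * u2)" and le: "a1 \<le> a2"
  shows "\<bar>a1 + norm B\<bar> \<le> 20 * e" "\<bar>a2 - norm B\<bar> \<le> 20 * e"
proof -
  have e1: "\<bar>\<bar>a1\<bar> - norm B\<bar> \<le> 2 * e" by (rule hermitian_eigen_approx[OF h1[unfolded W1_def] W(1)[unfolded W1_def]])
  have e2: "\<bar>\<bar>a2\<bar> - norm B\<bar> \<le> 2 * e" by (rule hermitian_eigen_approx[OF h2[unfolded W2_def] W(2)[unfolded W2_def]])
  have "of_real (a1 + a2) * (u1 * v2 - v1 * u2)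
      = (of_real a1 * u1 - B * v1) * v2 - (of_real a1 * v1 - cnj B * u1) * u2
        + (u1 * (of_real a2 * v2 - cnj B * u2) - v1 * (of_real a2 * u2 - B * v2))"
    by (simp add: algebra_simps)
  then have "\<bar>a1 + a2\<bar> * norm (u1 * v2 - v1 * u2) = norm ((of_real a1 * u1 - B * v1) * v2 - (of_real a1 * v1 - cnj B * u1) * u2
        + (u1 * (of_real a2 * v2 - cnj B * u2) - v1 * (of_real a2 * u2 - B * v2)))"
    by (metis norm_mult norm_of_real)
  also have "\<dots> \<le> ((e * W1) * norm v2 + (e * W1) * norm u2) + (norm u1 * (e * W2) + norm v1 * (e * W2))"
    by (intro norm_triangle_le norm_triangle_le_diff add_mono)
       (auto simp: norm_mult intro!: mult_left_mono mult_right_mono h1 h2)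
  also have "\<dots> = 2 * e * (W1 * W2)" by (simp add: W1_def W2_def algebra_simps)
  finally have 1: "\<bar>a1 + a2\<bar> * norm (u1 * v2 - v1 * u2) \<le> 2 * e * (W1 * W2)" .
  have "\<bar>a1 + a2\<bar> * (2/5 * (W1 * W2)) \<le> \<bar>a1 + a2\<bar> * norm (u1 * v2 - v1 * u2)"
    by (rule mult_left_mono[OF D]) simp
  from order_trans[OF this 1] have "(2/5 * \<bar>a1 + a2\<bar>) * (W1 * W2) \<le> (2 * e) * (W1 * W2)"
    by (simp only: mult_ac)
  then have "2/5 * \<bar>a1 + a2\<bar> \<le> 2 * e" using W by (simp only: mult_le_cancel_right_pos mult_pos_pos)
  then have "\<bar>a1 + a2\<bar> \<le> 5 * e" by simp
  \<comment> \<open>When a1 and a2 have equal signs, both of them and |B| are O(e); the constant 20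
    leaves room for this case.\<close>
  then show "\<bar>a1 + norm B\<bar> \<le> 20 * e" "\<bar>a2 - norm B\<bar> \<le> 20 * e"
    using e1 e2 le norm_ge_zero[of B] by linarith+
qed

lemma lagrange_complex:
  "(norm (u1 * v2 - v1 * u2))\<^sup>2 + (norm (u1 * cnj u2 + v1 * cnj v2))\<^sup>2
    = ((norm u1)\<^sup>2 + (norm v1)\<^sup>2) * ((norm u2)\<^sup>2 + (norm (v2 :: complex))\<^sup>2)"
  unfolding cmod_power2 by (simp add: power2_eq_square algebra_simps)

text \<open>With W the product of the two sums of norms, Lagrange's identity bounds the squared
  determinant below by W^2 / 4 - W^2 / 16 = 3/16 W^2, and 3/16 exceeds the square of 2/5.\<close>

lemma det_lower_bound:
  fixes u1 v1 u2 v2 :: complex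
  assumes "norm (u1 * cnj u2 + v1 * cnj v2) \<le> 1/4 * ((norm u1 + norm v1) * (norm u2 + norm v2))"
  shows "2/5 * ((norm u1 + norm v1) * (norm u2 + norm v2)) \<le> norm (u1 * v2 - v1 * u2)"
proof -
  define W where "W = (norm u1 + norm v1) * (norm u2 + norm v2)"
  have W: "W \<ge> 0" by (simp add: W_def)
  have h: "(norm a + norm b)\<^sup>2 / 2 \<le> (norm a)\<^sup>2 + (norm b)\<^sup>2" for a b :: complex
    using sum_squares_bound[of "norm a" "norm b"] by (simp add: power2_sum)
  have "W\<^sup>2 / 4 = ((norm u1 + norm v1)\<^sup>2 / 2) * ((norm u2 + norm v2)\<^sup>2 / 2)"
    by (simp add: W_def power_mult_distrib)
  also have "\<dots> \<le> ((norm u1)\<^sup>2 + (norm v1)\<^sup>2) * ((norm u2)\<^sup>2 + (norm v2)\<^sup>2)"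
    by (intro mult_mono h) auto
  also have "\<dots> = (norm (u1 * v2 - v1 * u2))\<^sup>2 + (norm (u1 * cnj u2 + v1 * cnj v2))\<^sup>2"
    by (rule lagrange_complex[symmetric])
  also have "(norm (u1 * cnj u2 + v1 * cnj v2))\<^sup>2 \<le> (1/4 * W)\<^sup>2"
    unfolding W_def by (rule power_mono[OF assms]) simp
  finally have "W\<^sup>2 / 4 \<le> (norm (u1 * v2 - v1 * u2))\<^sup>2 + (1/4 * W)\<^sup>2" by simp
  moreover have "(1/4 * W)\<^sup>2 = W\<^sup>2 / 16" "(2/5 * W)\<^sup>2 = 4/25 * W\<^sup>2"
    by (simp_all add: power_mult_distrib power_divide)
  ultimately have "(2/5 * W)\<^sup>2 \<le> (norm (u1 * v2 - v1 * u2))\<^sup>2"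
    using zero_le_power2[of W] by linarith
  then show ?thesis using abs_le_square_iff W by (simp add: W_def power2_le_iff_abs_le)
qed

context hermitian_seq
begin

section \<open>The diagonal entry\<close>

lemma triple_summable:
  "(\<lambda>(j, i). c j * c (i - j) * c (- i) / of_real (dd m j * dd m i)) summable_on offres m \<times> offres m"
proof -
  have "(\<lambda>(j, i). 1 / \<bar>dd m j\<bar> * (1 / \<bar>dd m i\<bar>)) summable_on offres m \<times> offres m"
    by (rule summable_on_times) (use summable_inverse_dd(1)[OF m_pos] in auto)
  then have *: "(\<lambda>p. M ^ 3 * (case p of (j, i) \<Rightarrow> 1 / \<bar>dd m j\<bar> * (1 / \<bar>dd m i\<bar>))) summable_on offres m \<times> offres m"
    by (rule summable_on_cmult_right)
  have "(\<lambda>p. norm (case p of (j, i) \<Rightarrow> c j * c (i - j) * c (- i) / of_real (dd m j * dd m i))) summable_on offres m \<times> offres m"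
  proof (rule summable_on_comparison_test[OF *])
    fix p :: "int \<times> int"
    obtain j i where p: "p = (j, i)" by force
    have "norm (c j) * norm (c (i - j)) * norm (c (- i)) \<le> M * M * M"
      using M_nonneg by (intro mult_mono c_bound) auto
    then have "norm (c j) * norm (c (i - j)) * norm (c (- i)) * (1 / \<bar>dd m j\<bar> * (1 / \<bar>dd m i\<bar>)) \<le> M ^ 3 * (1 / \<bar>dd m j\<bar> * (1 / \<bar>dd m i\<bar>))"
      by (intro mult_right_mono) (auto simp: power3_eq_cube)
    then show "norm (case p of (j, i) \<Rightarrow> c j * c (i - j) * c (- i) / of_real (dd m j * dd m i)) \<le> M ^ 3 * (case p of (j, i) \<Rightarrow> 1 / \<bar>dd m j\<bar> * (1 / \<bar>dd m i\<bar>))"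
      by (simp add: p norm_mult norm_divide abs_mult)
  qed simp
  then show ?thesis by (rule abs_summable_summable)
qed

lemma Acoef_first: "Kop c m (\<lambda>j. c (- j)) 0 = (\<Sum>\<^sub>\<infinity>k\<in>offres m. of_real ((norm (c k))\<^sup>2 / dd m k))"
  unfolding Kop_def
proof (rule infsum_cong)
  fix i
  have "c i * c (- i) = of_real ((norm (c i))\<^sup>2)" unfolding c_cnj by (rule complex_norm_square[symmetric])
  then show "c (i - 0) * c (- i) / of_real (dd m i) = of_real ((norm (c i))\<^sup>2 / dd m i)" by simp
qed

lemma Acoef_second_iterated:
  "Kop c m (Kop c m (\<lambda>j. c (- j))) 0
    = (\<Sum>\<^sub>\<infinity>j\<in>offres m. \<Sum>\<^sub>\<infinity>i\<in>offres m. c j * c (i - j) * c (- i) / of_real (dd m j * dd m i))"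
proof -
  have "c (j - 0) * Kop c m (\<lambda>j. c (- j)) j / of_real (dd m j)
     = (\<Sum>\<^sub>\<infinity>i\<in>offres m. c j * c (i - j) * c (- i) / of_real (dd m j * dd m i))" for j
  proof -
    have "c (j - 0) * Kop c m (\<lambda>j. c (- j)) j / of_real (dd m j) = (c j / of_real (dd m j)) * Kop c m (\<lambda>j. c (- j)) j" by simp
    also have "\<dots> = (\<Sum>\<^sub>\<infinity>i\<in>offres m. (c j / of_real (dd m j)) * (c (i - j) * c (- i) / of_real (dd m i)))"
      unfolding Kop_def by (rule infsum_cmult_right'[symmetric])
    finally show ?thesis by (simp add: mult_ac)
  qed
  then show ?thesis by (subst Kop_def) (simp only:)
qed

text \<open>Conjugation exchanges the two summation indices, which absolute summability permits.
  Reality makes the two diagonal entries equal and the matrix Hermitian.\<close>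

lemma Acoef_real: "cnj (Acoef c m) = Acoef c m"
proof -
  let ?F = "\<lambda>j i. c j * c (i - j) * c (- i) / of_real (dd m j * dd m i)"
  have F: "cnj (?F j i) = ?F i j" for i j
  proof -
    have "cnj (c (i - j)) = c (j - i)" using c_cnj[of "i - j"] by simp
    then show ?thesis by (simp add: c_cnj mult_ac)
  qed
  have "cnj (\<Sum>\<^sub>\<infinity>j\<in>offres m. \<Sum>\<^sub>\<infinity>i\<in>offres m. ?F j i) = (\<Sum>\<^sub>\<infinity>j\<in>offres m. \<Sum>\<^sub>\<infinity>i\<in>offres m. ?F i j)"
    unfolding infsum_cnj[symmetric] F ..
  also have "\<dots> = (\<Sum>\<^sub>\<infinity>j\<in>offres m. \<Sum>\<^sub>\<infinity>i\<in>offres m. ?F j i)"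
    by (rule infsum_swap_banach[symmetric, OF triple_summable])
  finally show ?thesis
    unfolding Acoef_def Acoef_first Acoef_second_iterated complex_cnj_add
    by (simp flip: infsum_cnj)
qed

text \<open>The substitution i = k + l turns the iterated sum into the double series of A_2; the
  terms with l = 0 vanish because c 0 = 0.\<close>

lemma Acoef_eq:
  "Acoef c m = (\<Sum>\<^sub>\<infinity>k\<in>offres m. of_real ((norm (c k))\<^sup>2 / dd m k)) +
     (\<Sum>\<^sub>\<infinity>(k, l)\<in>{(k, l). l \<noteq> 0 \<and> k \<in> offres m \<and> k + l \<in> offres m}.
        c k * c l * c (- k - l) / of_real (dd m k * dd m (k + l)))"
proof -
  let ?F = "\<lambda>(j, i). c j * c (i - j) * c (- i) / of_real (dd m j * dd m i)"
  let ?G = "\<lambda>(k, l). c k * c l * c (- k - l) / of_real (dd m k * dd m (k + l))"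
  let ?P = "{(k, l). k \<in> offres m \<and> k + l \<in> offres m}"
  have "Kop c m (Kop c m (\<lambda>j. c (- j))) 0 = infsum ?F (offres m \<times> offres m)"
    unfolding Acoef_second_iterated by (rule infsum_Sigma'_banach[OF triple_summable])
  also have "\<dots> = infsum (\<lambda>p. ?F (case p of (k, l) \<Rightarrow> (k, k + l))) ?P"
  proof (rule infsum_reindex_bij_betw[symmetric])
    show "bij_betw (\<lambda>p. case p of (k, l) \<Rightarrow> (k, k + l)) ?P (offres m \<times> offres m)"
      by (rule bij_betwI[where g="\<lambda>(j, i). (j, i - j)"]) auto
  qed
  also have "\<dots> = infsum ?G {(k, l). l \<noteq> 0 \<and> k \<in> offres m \<and> k + l \<in> offres m}"
    by (rule infsum_cong_neutral) (auto simp: c_zero)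
  finally show ?thesis unfolding Acoef_def Acoef_first by simp
qed

section \<open>Locating two eigenvalues from two solutions\<close>

lemma two_sols:
  assumes x: "sol c m s x" and y: "sol c m t y"
    and s: "\<And>k. k \<in> offres m \<Longrightarrow> 2 * \<bar>s\<bar> \<le> \<bar>dd m k\<bar>" and t: "\<And>k. k \<in> offres m \<Longrightarrow> 2 * \<bar>t\<bar> \<le> \<bar>dd m k\<bar>"
    and small: "4 * M * sig m \<le> 1" and r: "\<bar>s\<bar> \<le> r" "\<bar>t\<bar> \<le> r" and st: "s \<le> t"
    and Wx: "norm (x 0) + norm (x m) > 0" and Wy: "norm (y 0) + norm (y m) > 0"
    and D: "2/5 * ((norm (x 0) + norm (x m)) * (norm (y 0) + norm (y m))) \<le> norm (x 0 * y m - x m * y 0)"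
  shows "norm (of_real s - (Acoef c m - of_real (norm (Bcoef c m)))) \<le> 20 * err M m r"
    and "norm (of_real t - (Acoef c m + of_real (norm (Bcoef c m)))) \<le> 20 * err M m r"
proof -
  define A where "A = Re (Acoef c m)"
  have A: "Acoef c m = of_real A" using Acoef_real unfolding A_def
    by (simp add: complex_eq_iff)
  note ex = sol_error[OF x s small r(1)] and ey = sol_error[OF y t small r(2)]
  have gen: "of_real (p - A) * u - b * v = of_real p * u - (of_real A * u + b * v)" for p :: real and u v b :: complex
    by (simp add: algebra_simps)
  have h: "norm (of_real (s - A) * x 0 - Bcoef c m * x m) \<le> err M m r * (norm (x 0) + norm (x m))"
    "norm (of_real (s - A) * x m - cnj (Bcoef c m) * x 0) \<le> err M m r * (norm (x 0) + norm (x m))"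
    "norm (of_real (t - A) * y 0 - Bcoef c m * y m) \<le> err M m r * (norm (y 0) + norm (y m))"
    "norm (of_real (t - A) * y m - cnj (Bcoef c m) * y 0) \<le> err M m r * (norm (y 0) + norm (y m))"
    unfolding gen using ex ey unfolding A complex_cnj_complex_of_real by simp_all
  have "\<bar>(s - A) + norm (Bcoef c m)\<bar> \<le> 20 * err M m r" "\<bar>(t - A) - norm (Bcoef c m)\<bar> \<le> 20 * err M m r"
    by (rule hermitian_pair_approx[OF h Wx Wy D]; use st in simp)+
  moreover have "of_real s - (Acoef c m - of_real (norm (Bcoef c m))) = of_real ((s - A) + norm (Bcoef c m))"
    and "of_real t - (Acoef c m + of_real (norm (Bcoef c m))) = of_real ((t - A) - norm (Bcoef c m))"
    by (simp_all add: A)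
  ultimately show "norm (of_real s - (Acoef c m - of_real (norm (Bcoef c m)))) \<le> 20 * err M m r"
    and "norm (of_real t - (Acoef c m + of_real (norm (Bcoef c m)))) \<le> 20 * err M m r"
    by (simp_all only: norm_of_real)
qed

lemma sol_lincomb:
  assumes x: "sol c m s x" and y: "sol c m s y"
  shows "sol c m s (\<lambda>k. a * x k + b * y k)"
proof -
  have xs: "(\<lambda>k. norm (x k)) summable_on UNIV" and ys: "(\<lambda>k. norm (y k)) summable_on UNIV"
    using x y by (simp_all add: sol_def)
  have "(\<lambda>k. norm a * norm (x k) + norm b * norm (y k)) summable_on UNIV"
    by (intro summable_on_add summable_on_cmult_right xs ys)
  then have 1: "(\<lambda>k. norm (a * x k + b * y k)) summable_on UNIV"
    by (rule summable_on_comparison_test) (auto intro!: norm_triangle_le simp: norm_mult)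
  have "of_real (s + dd m k) * (a * x k + b * y k) = (\<Sum>\<^sub>\<infinity>j. c (j - k) * (a * x j + b * y j))" for k
  proof -
    have "of_real (s + dd m k) * (a * x k + b * y k) = a * (of_real (s + dd m k) * x k) + b * (of_real (s + dd m k) * y k)"
      by (simp add: algebra_simps)
    also have "\<dots> = a * (\<Sum>\<^sub>\<infinity>j. c (j - k) * x j) + b * (\<Sum>\<^sub>\<infinity>j. c (j - k) * y j)"
      using x y unfolding sol_def by metis
    also have "\<dots> = (\<Sum>\<^sub>\<infinity>j. a * (c (j - k) * x j)) + (\<Sum>\<^sub>\<infinity>j. b * (c (j - k) * y j))"
      by (simp only: infsum_cmult_right')
    also have "\<dots> = (\<Sum>\<^sub>\<infinity>j. a * (c (j - k) * x j) + b * (c (j - k) * y j))"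
      by (rule infsum_add[symmetric]) (intro summable_on_cmult_right conv_summable xs ys)+
    finally show ?thesis by (simp add: algebra_simps)
  qed
  then show ?thesis using 1 by (simp add: sol_def)
qed

text \<open>A nonzero solution has a nonzero resonant part, so on a two-dimensional solution space
  the resonant parts fill the plane. Both conclusions for the same \<open>s\<close> together force
  \<open>Bcoef\<close> to be small.\<close>

lemma two_sols_same:
  assumes x: "sol c m s x" and y: "sol c m s y"
    and s: "\<And>k. k \<in> offres m \<Longrightarrow> 2 * \<bar>s\<bar> \<le> \<bar>dd m k\<bar>"
    and small: "4 * M * sig m \<le> 1" and r: "norm (c m) + 8 * M\<^sup>2 * sig m \<le> r"
    and indep: "\<And>a b. (\<lambda>k. a * x k + b * y k) = (\<lambda>k. 0) \<Longrightarrow> a = 0 \<and> b = 0"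
  shows "norm (of_real s - (Acoef c m - of_real (norm (Bcoef c m)))) \<le> 20 * err M m r"
    and "norm (of_real s - (Acoef c m + of_real (norm (Bcoef c m)))) \<le> 20 * err M m r"
proof -
  define d where "d = x 0 * y m - x m * y 0"
  have inj: "norm (a * x 0 + b * y 0) + norm (a * x m + b * y m) > 0" if "a \<noteq> 0 \<or> b \<noteq> 0" for a b
    using sol_shift_bound(1)[OF sol_lincomb[OF x y, of a b] s small] indep[of a b] that by blast
  have d: "d \<noteq> 0"
  proof
    assume d0: "d = 0"
    show False
    proof (cases "y 0 = 0 \<and> y m = 0")
      case True
      then show False using inj[of 0 1] by simp
    next
      case False
      have "x 0 * y m = x m * y 0" using d0 by (simp add: d_def)
      then show False using inj[of "y 0" "- x 0"] inj[of "y m" "- x m"] False by (auto simp: mult.commute)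
    qed
  qed
  \<comment> \<open>Cramer's rule: the resonant parts become (1, 0) and (0, 1), with determinant
    1.\<close>
  define x' where "x' k = (y m / d) * x k + (- x m / d) * y k" for k
  define y' where "y' k = (- y 0 / d) * x k + (x 0 / d) * y k" for k
  have sx: "sol c m s x'" and sy: "sol c m s y'"
    unfolding x'_def y'_def by (rule sol_lincomb[OF x y])+
  have v: "x' 0 = 1" "x' m = 0" "y' 0 = 0" "y' m = 1"
    using d by (simp_all add: x'_def y'_def d_def divide_simps)
  have nz: "x' \<noteq> (\<lambda>k. 0)" using v(1) by auto
  have sr: "\<bar>s\<bar> \<le> r" using sol_shift_bound(2)[OF sx s small nz] r by linarith
  show "norm (of_real s - (Acoef c m - of_real (norm (Bcoef c m)))) \<le> 20 * err M m r"
    and "norm (of_real s - (Acoef c m + of_real (norm (Bcoef c m)))) \<le> 20 * err M m r"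
    by (rule two_sols[OF sx sy s s small sr sr order_refl]; simp add: v)+
qed

lemma two_sols_distinct:
  assumes x: "sol c m s x" and y: "sol c m t y"
    and s: "\<And>k. k \<in> offres m \<Longrightarrow> 2 * \<bar>s\<bar> \<le> \<bar>dd m k\<bar>" and t: "\<And>k. k \<in> offres m \<Longrightarrow> 2 * \<bar>t\<bar> \<le> \<bar>dd m k\<bar>"
    and small: "4 * M * sig m \<le> 1" "64 * M\<^sup>2 * tau m \<le> 1" and r: "norm (c m) + 8 * M\<^sup>2 * sig m \<le> r"
    and st: "s < t" and nz: "x \<noteq> (\<lambda>k. 0)" "y \<noteq> (\<lambda>k. 0)"
  shows "norm (of_real s - (Acoef c m - of_real (norm (Bcoef c m)))) \<le> 20 * err M m r"
    and "norm (of_real t - (Acoef c m + of_real (norm (Bcoef c m)))) \<le> 20 * err M m r"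
proof -
  note bx = sol_shift_bound[OF x s small(1) nz(1)] and by' = sol_shift_bound[OF y t small(1) nz(2)]
  define Wx where "Wx = norm (x 0) + norm (x m)"
  define Wy where "Wy = norm (y 0) + norm (y m)"
  have W: "Wx > 0" "Wy > 0" using bx(1) by'(1) by (simp_all add: Wx_def Wy_def)
  have orth: "((\<lambda>k. x k * cnj (y k)) has_sum 0) UNIV" by (rule sol_orthogonal[OF x y]) (use st in simp)
  have sm: "(\<lambda>k. x k * cnj (y k)) summable_on UNIV" using orth by (rule has_sum_imp_summable)
  have U: "UNIV = {0, m} \<union> offres m" by (auto simp: offres_def)
  have "0 = (\<Sum>\<^sub>\<infinity>k\<in>{0, m} \<union> offres m. x k * cnj (y k))" unfolding U[symmetric] using infsumI[OF orth] by simp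
  also have "\<dots> = (\<Sum>\<^sub>\<infinity>k\<in>{0, m}. x k * cnj (y k)) + (\<Sum>\<^sub>\<infinity>k\<in>offres m. x k * cnj (y k))"
    by (rule infsum_Un_disjoint) (use summable_on_subset[OF sm] in \<open>auto simp: offres_def\<close>)
  also have "(\<Sum>\<^sub>\<infinity>k\<in>{0, m}. x k * cnj (y k)) = x 0 * cnj (y 0) + x m * cnj (y m)" using m_pos by simp
  finally have "x 0 * cnj (y 0) + x m * cnj (y m) = - (\<Sum>\<^sub>\<infinity>k\<in>offres m. x k * cnj (y k))"
    by (simp add: eq_neg_iff_add_eq_0)
  then have "norm (x 0 * cnj (y 0) + x m * cnj (y m)) = norm (\<Sum>\<^sub>\<infinity>k\<in>offres m. x k * cnj (y k))" by simp
  also have "\<dots> \<le> (16 * M\<^sup>2 * (Wx * Wy)) * tau m"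
    unfolding tau_def
  proof (rule dominated_by_summable(3)[OF _ summable_inverse_dd(2)[OF m_pos]])
    fix k assume k: "k \<in> offres m"
    have "norm (x k * cnj (y k)) \<le> (4 * M * Wx * (1 / \<bar>dd m k\<bar>)) * (4 * M * Wy * (1 / \<bar>dd m k\<bar>))"
      unfolding norm_mult complex_mod_cnj Wx_def Wy_def
      by (intro mult_mono sol_bounds(2)[OF x s small(1) k] sol_bounds(2)[OF y t small(1) k]) (use M_nonneg in auto)
    also have "\<dots> = (16 * M\<^sup>2 * (Wx * Wy)) * (1 / (dd m k)\<^sup>2)" by (simp add: power2_eq_square)
    finally show "norm (x k * cnj (y k)) \<le> (16 * M\<^sup>2 * (Wx * Wy)) * (1 / (dd m k)\<^sup>2)" .
  qed
  also have "\<dots> = (64 * M\<^sup>2 * tau m) * (1/4 * (Wx * Wy))" by simp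
  also have "\<dots> \<le> 1 * (1/4 * (Wx * Wy))" using small(2) W by (intro mult_right_mono) auto
  finally have "norm (x 0 * cnj (y 0) + x m * cnj (y m)) \<le> 1/4 * (Wx * Wy)" by simp
  then have D: "2/5 * ((norm (x 0) + norm (x m)) * (norm (y 0) + norm (y m))) \<le> norm (x 0 * y m - x m * y 0)"
    unfolding Wx_def Wy_def by (rule det_lower_bound)
  have r': "\<bar>s\<bar> \<le> r" "\<bar>t\<bar> \<le> r" using bx(2) by'(2) r by linarith+
  show "norm (of_real s - (Acoef c m - of_real (norm (Bcoef c m)))) \<le> 20 * err M m r"
    and "norm (of_real t - (Acoef c m + of_real (norm (Bcoef c m)))) \<le> 20 * err M m r"
    by (rule two_sols[OF x y s t small(1) r' less_imp_le[OF st] bx(1) by'(1) D]; simp)+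
qed

end

subsection \<open>From eigenfunctions to coefficient sequences\<close>

lemma fc_resolv_summable:
  assumes f: "L1 f" and m: "m > 0"
  shows "(\<lambda>k. norm (fc (resolv m f) k)) summable_on UNIV"
proof -
  have "(\<lambda>k. norm (fc (resolv m f) k)) summable_on offres m"
  proof (rule dominated_by_summable(2)[OF _ summable_inverse_dd(1)[OF m]])
    fix k assume "k \<in> offres m"
    then have "norm (fc (resolv m f) k) = norm (fc f k) * (1 / \<bar>dd m k\<bar>)"
      using fc_resolv[OF f, of m k] m by (simp add: offres_def norm_divide)
    then show "norm (fc (resolv m f) k) \<le> nrm1 f * (1 / \<bar>dd m k\<bar>)"
      using mult_right_mono[OF fc_bound[OF f, of k], of "1 / \<bar>dd m k\<bar>"] by simp
  qed
  then show ?thesis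
    by (rule summable_on_cong_neutral[THEN iffD1, rotated -1])
       (use fc_resolv[OF f, of m] m in \<open>auto simp: offres_def\<close>)
qed

text \<open>\<open>Kop\<close> correlates with \<open>c\<close>, since its kernel is
  \<open>c (i - j)\<close>. Reflecting the index by m turns this into a convolution, that is, into
  multiplication by \<open>q\<close> after \<open>resolv\<close>.\<close>

lemma Kop_fc:
  assumes q: "L1 q" and f: "L1 f" and m: "m > 0"
  shows "Kop (fc q) m (\<lambda>i. fc f (m - i)) = (\<lambda>j. fc (\<lambda>x. q x * resolv m f x) (m - j))"
proof (rule ext)
  fix j
  have bij: "bij_betw (\<lambda>k. m - k) (offres m) (offres m)"
    by (rule bij_betw_imageI[OF _ offres_refl]) (auto simp: inj_on_def)
  have "Kop (fc q) m (\<lambda>i. fc f (m - i)) j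
      = (\<Sum>\<^sub>\<infinity>i\<in>offres m. fc q ((m - i) - j) * fc f (m - (m - i)) / of_real (dd m (m - i)))"
    unfolding Kop_def by (rule infsum_reindex_bij_betw[OF bij, symmetric])
  also have "\<dots> = (\<Sum>\<^sub>\<infinity>k. fc (resolv m f) k * fc q ((m - j) - k))"
    by (rule infsum_cong_neutral)
       (use fc_resolv[OF f, of m] m in \<open>auto simp: offres_def dd_refl algebra_simps\<close>)
  also have "\<dots> = fc (\<lambda>x. q x * resolv m f x) (m - j)"
    by (rule infsumI[OF fc_mult_has_sum[OF continuous_on_resolv[OF f] fc_resolv_summable[OF f m] q]])
  finally show "Kop (fc q) m (\<lambda>i. fc f (m - i)) j = fc (\<lambda>x. q x * resolv m f x) (m - j)" .
qed

lemma Bcoef_fc: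
  assumes q: "L1 q" and m: "m > 0"
  shows "Bcoef (fc q) m = fc q m + fc (\<lambda>x. q x * resolv m q x) m
    + fc (\<lambda>x. q x * resolv m (\<lambda>x. q x * resolv m q x) x) m"
proof -
  have "L1 (\<lambda>x. q x * resolv m q x)"
    by (rule AI_mult_cont[OF q continuous_on_resolv[OF q]])
  then show ?thesis unfolding Bcoef_def by (simp add: Kop_fc[OF q _ m] q)
qed

section \<open>Identification of the matrix entries with the stated quantities\<close>

lemma AI_of_real:
  "q absolutely_integrable_on S \<Longrightarrow> (\<lambda>x. complex_of_real (q x)) absolutely_integrable_on S"
  by (drule absolutely_integrable_linear[OF _ bounded_linear_of_real]) (simp add: o_def)

lemma integral_HK_of_real:
  "q integrable_on S \<Longrightarrow> integral S (\<lambda>x. complex_of_real (q x)) = of_real (integral S q)"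
  by (drule integral_linear[OF _ bounded_linear_of_real]) (simp add: o_def)

text \<open>The quantity in the theorem is exactly the first and second order part of
  \<open>Bcoef\<close>, by \<open>fc_mult_resolv_gap\<close>.\<close>

lemma gap_coeff_eq:
  fixes n :: nat
  assumes q: "L1 q" and q0: "integral {0..1} q = 0"
  defines "Q \<equiv> \<lambda>x. complex_of_real (q x)" and "m \<equiv> 2 * int n + 1"
  shows "gap_coeff q n = fc Q m + fc (\<lambda>x. Q x * resolv m Q x) m"
proof -
  have QI: "L1 Q" unfolding Q_def by (rule AI_of_real[OF q])
  have Q0: "fc Q 0 = 0"
    unfolding fc_def Q_def using integral_HK_of_real[OF integrable_of_AI[OF q]] q0 by simp
  have prim: "complex_of_real (prim q x) = integral {0..x} Q" if "x \<in> {0..1}" for x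
    unfolding prim_def Q_def
    by (rule integral_HK_of_real[symmetric], rule integrable_subinterval_real[OF integrable_of_AI[OF q]]) (use that in auto)
  have m: "m \<noteq> 0" by (simp add: m_def)
  have "fourier_coeff (\<lambda>x. (prim q x)\<^sup>2) m = fc (\<lambda>x. (integral {0..x} Q)\<^sup>2) m"
    unfolding fourier_coeff_eq by (rule fc_cong) (simp add: prim)
  moreover have "fourier_coeff (prim q) k = fc (\<lambda>x. integral {0..x} Q) k" for k
    unfolding fourier_coeff_eq by (rule fc_cong) (simp add: prim)
  moreover have "fourier_coeff q m = fc Q m" unfolding fourier_coeff_eq Q_def ..
  ultimately show ?thesis
    using fc_mult_resolv_gap[OF QI Q0 m refl] unfolding gap_coeff_def m_def[symmetric] by simp
qed

lemma lam_diff: "lam (int n) - lam (int n - k) = dd (2 * int n + 1) k"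
  by (simp add: lam_def dd_def power2_eq_square algebra_simps)

lemma A2_eq:
  assumes "hermitian_seq (fc (\<lambda>x. of_real (q x))) M (2 * int n + 1)"
  shows "A2 q n = Acoef (fc (\<lambda>x. of_real (q x))) (2 * int n + 1)"
proof -
  interpret hermitian_seq "fc (\<lambda>x. of_real (q x))" M "2 * int n + 1" by fact
  have 1: "{k. k \<noteq> 0 \<and> k \<noteq> 2 * int n + 1} = offres (2 * int n + 1)" by (simp add: offres_def)
  have 2: "{(k, l). l \<noteq> 0 \<and> k \<noteq> 0 \<and> k \<noteq> 2 * int n + 1 \<and> k + l \<noteq> 0 \<and> k + l \<noteq> 2 * int n + 1}
      = {(k, l). l \<noteq> 0 \<and> k \<in> offres (2 * int n + 1) \<and> k + l \<in> offres (2 * int n + 1)}"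
    by (auto simp: offres_def)
  have 3: "lam (int n) - lam (int n - k - l) = dd (2 * int n + 1) (k + l)" for k l
    using lam_diff[of n "k + l"] by (simp add: diff_diff_eq)
  show ?thesis
    unfolding A2_def Acoef_eq 1 2 3 lam_diff fourier_coeff_eq ..
qed

lemma hermitian_seq_fc:
  assumes q: "L1 q" and q0: "integral {0..1} q = 0" and m: "m > 0"
  shows "hermitian_seq (fc (\<lambda>x. of_real (q x))) (nrm1 (\<lambda>x. complex_of_real (q x))) m"
proof
  let ?Q = "\<lambda>x. complex_of_real (q x)"
  have QI: "L1 ?Q" by (rule AI_of_real[OF q])
  show "norm (fc ?Q k) \<le> nrm1 (\<lambda>x. complex_of_real (q x))" for k by (rule fc_bound[OF QI])
  show "fc ?Q (- k) = cnj (fc ?Q k)" for k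
    unfolding fc_def using integral_linear[OF integrable_of_AI[OF AI_mult_ch[OF QI]] bounded_linear_cnj, of "-k"]
    by (simp add: o_def cnj_ch)
  show "fc ?Q 0 = 0" unfolding fc_def using integral_HK_of_real[OF integrable_of_AI[OF q]] q0 by simp
qed (rule m)

section \<open>The coefficients of an eigenfunction\<close>

lemma integral_AE_cong:
  fixes f g :: "real \<Rightarrow> complex"
  assumes f: "L1 f" and g: "L1 g"
    and ae: "AE x in lebesgue_on {0..1}. f x = g x"
  shows "integral {0..1} f = integral {0..1} g"
proof -
  have F: "integrable (lebesgue_on {0..1}) f" "integrable (lebesgue_on {0..1}) g"
    using f g by (simp_all add: AI_iff_integrable_lebesgue_on)
  have "integral\<^sup>L (lebesgue_on {0..1}) f = integral\<^sup>L (lebesgue_on {0..1}) g"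
    by (rule integral_cong_AE) (use F ae in auto)
  then show ?thesis by (simp add: lebesgue_integral_eq_integral F)
qed

text \<open>Splitting off the factor e^(i pi x) turns antiperiodic exponentials into the periodic
  \<open>ch\<close>.\<close>

definition aper :: "(real \<Rightarrow> complex) \<Rightarrow> real \<Rightarrow> complex" where
  "aper y x = y x * cis (- pi * x)"

lemma antiperiodic_op_continuous:
  assumes "antiperiodic_op q y f"
  shows "continuous_on {0..1} y"
proof -
  obtain y' where "\<forall>x\<in>{0..1}. (y has_vector_derivative y' x) (at x within {0..1})"
    using assms unfolding antiperiodic_op_def by blast
  then show ?thesis
    using has_vector_derivative_continuous continuous_on_eq_continuous_within by blast
qed

lemma continuous_on_aper: "continuous_on {0..1} y \<Longrightarrow> continuous_on {0..1} (aper y)"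
  unfolding aper_def cis_conv_exp by (intro continuous_intros)

text \<open>Two integrations by parts against an antiperiodic exponential: the boundary terms cancel
  since both factors change sign from 0 to 1. The differential equation enters under the integral
  only, so its validity almost everywhere suffices.\<close>

lemma eigen_fc:
  assumes op: "antiperiodic_op q y (\<lambda>x. of_real z * y x)" and q: "L1 q"
  shows "of_real (z - lam j) * fc (aper y) j = fc (\<lambda>x. of_real (q x) * aper y x) j"
proof -
  obtain y' y'' where D: "\<And>x. x \<in> {0..1} \<Longrightarrow> (y has_vector_derivative y' x) (at x within {0..1})"
    and AC: "has_AC_derivative y' y''"
    and ae: "AE x in lebesgue_on {0..1}. of_real z * y x = - y'' x + of_real (q x) * y x"
    and bc: "y 1 = - y 0" "y' 1 = - y' 0"
    using op unfolding antiperiodic_op_def by blast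
  have yc: "continuous_on {0..1} y" by (rule antiperiodic_op_continuous[OF op])
  have ACy: "has_AC_derivative y y'"
    by (rule has_AC_derivative_cont_deriv[OF D has_AC_derivative_continuous[OF AC]])
  define w where "w = 2 * pi * of_int j + pi"
  define E where "E x = exp (- (\<i> * of_real w) * of_real x)" for x :: real
  have Ec: "continuous_on {0..1} E" unfolding E_def by (intro continuous_intros)
  have DE: "(E has_vector_derivative (- (\<i> * of_real w) * E x)) (at x within {0..1})" for x
    unfolding E_def
    by (rule has_vector_derivative_real_field derivative_eq_intros | simp add: algebra_simps)+
  have ACE: "has_AC_derivative E (\<lambda>x. - (\<i> * of_real w) * E x)"
    by (rule has_AC_derivative_cont_deriv[OF DE]) (intro continuous_intros Ec)
  have E01: "E 0 = 1" "E 1 = -1"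
  proof -
    have "E 1 = cis (- w)" by (simp add: E_def cis_conv_exp)
    also have "\<dots> = cis (2 * pi * of_int (- j)) * cis (- pi)" by (simp add: w_def cis_mult algebra_simps)
    also have "cis (2 * pi * of_int (- j)) = 1" by (rule cis_multiple_2pi) simp
    finally show "E 1 = -1" by (simp add: complex_eq_iff)
  qed (simp add: E_def)
  have yE: "aper y x * ch (- j) x = y x * E x" for x
    by (simp add: aper_def ch_def E_def w_def cis_conv_exp exp_add[symmetric] algebra_simps)
  have p1: "integral {0..1} (\<lambda>x. y' x * E x) = (\<i> * of_real w) * integral {0..1} (\<lambda>x. E x * y x)"
    using integral_by_parts_AC[OF ACy ACE] E01 bc by (simp add: mult.assoc)
  have p2: "integral {0..1} (\<lambda>x. y'' x * E x) = (\<i> * of_real w) * integral {0..1} (\<lambda>x. E x * y' x)"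
    using integral_by_parts_AC[OF AC ACE] E01 bc by (simp add: mult.assoc)
  have "integral {0..1} (\<lambda>x. y'' x * E x) = (\<i> * of_real w) * integral {0..1} (\<lambda>x. y' x * E x)"
    using p2 by (simp add: mult.commute)
  also have "\<dots> = - of_real (lam j) * integral {0..1} (\<lambda>x. y x * E x)"
  proof -
    have "(\<i> * a) * ((\<i> * a) * b) = - (a * a) * b" for a b :: complex
    proof -
      have "(\<i> * a) * ((\<i> * a) * b) = (\<i> * \<i>) * (a * a) * b" by (simp only: mult_ac)
      then show ?thesis by simp
    qed
    moreover have "lam j = w * w" by (simp add: w_def lam_def power2_eq_square)
    ultimately show ?thesis unfolding p1 by (simp only: of_real_mult mult.commute[of "E _"])
  qed
  finally have p3: "integral {0..1} (\<lambda>x. y'' x * E x) = - of_real (lam j) * integral {0..1} (\<lambda>x. y x * E x)" .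
  have I1: "L1 (\<lambda>x. y'' x * E x)"
    by (rule AI_mult_cont[OF has_AC_derivative_AI[OF AC] Ec])
  have I2: "L1 (\<lambda>x. of_real (q x) * y x * E x)"
    by (rule AI_mult_cont[OF AI_mult_cont[OF AI_of_real[OF q] yc] Ec])
  have I3: "L1 (\<lambda>x. of_real z * (y x * E x))"
    by (rule AI_continuous) (intro continuous_intros yc Ec)
  have I4: "L1 (\<lambda>x. of_real (q x) * y x * E x - y'' x * E x)"
    by (rule set_integral_diff(1)[OF I2 I1])
  have "integral {0..1} (\<lambda>x. of_real z * (y x * E x)) = integral {0..1} (\<lambda>x. of_real (q x) * y x * E x - y'' x * E x)"
  proof (rule integral_AE_cong[OF I3 I4])
    show "AE x in lebesgue_on {0..1}. of_real z * (y x * E x) = of_real (q x) * y x * E x - y'' x * E x"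
      using ae
    proof eventually_elim
      case (elim x)
      have "of_real z * (y x * E x) = (of_real z * y x) * E x" by simp
      then show ?case unfolding elim by (simp add: algebra_simps)
    qed
  qed
  also have "\<dots> = integral {0..1} (\<lambda>x. of_real (q x) * y x * E x) - integral {0..1} (\<lambda>x. y'' x * E x)"
    by (rule HK_integral_diff[OF integrable_of_AI[OF I2] integrable_of_AI[OF I1]])
  finally have "of_real (z - lam j) * integral {0..1} (\<lambda>x. y x * E x) = integral {0..1} (\<lambda>x. of_real (q x) * y x * E x)"
    by (simp add: p3 left_diff_distrib diff_eq_eq)
  then show ?thesis unfolding fc_def by (simp add: yE mult.assoc)
qed

text \<open>Summability has to come first: the coefficients of \<open>q y\<close> are bounded, so
  those of \<open>y\<close> are O(1 / |dd|) off resonance. This summability then licenses the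
  convolution formula for \<open>q y\<close>.\<close>

lemma eigen_sol:
  assumes op: "antiperiodic_op q y (\<lambda>x. of_real z * y x)" and q: "L1 q"
    and s: "\<And>k. k \<in> offres (2 * int n + 1) \<Longrightarrow> 2 * \<bar>z - lam (int n)\<bar> \<le> \<bar>dd (2 * int n + 1) k\<bar>"
  shows "sol (fc (\<lambda>x. of_real (q x))) (2 * int n + 1) (z - lam (int n)) (\<lambda>k. fc (aper y) (int n - k))"
    and "(\<lambda>k. norm (fc (aper y) k)) summable_on UNIV"
proof -
  let ?Q = "\<lambda>x. complex_of_real (q x)"
  let ?m = "2 * int n + 1"
  let ?s = "z - lam (int n)"
  have QI: "L1 ?Q" by (rule AI_of_real[OF q])
  have ac: "continuous_on {0..1} (aper y)" by (rule continuous_on_aper[OF antiperiodic_op_continuous[OF op]])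
  have QyI: "L1 (\<lambda>x. ?Q x * aper y x)" by (rule AI_mult_cont[OF QI ac])
  have lam: "z - lam (int n - k) = ?s + dd ?m k" for k using lam_diff[of n k] by simp
  have eq: "of_real (?s + dd ?m k) * fc (aper y) (int n - k) = fc (\<lambda>x. ?Q x * aper y x) (int n - k)" for k
    using eigen_fc[OF op q, of "int n - k"] unfolding lam .
  have bij: "bij_betw (\<lambda>k. int n - k) UNIV UNIV"
    by (rule bij_betwI[where g="\<lambda>k. int n - k"]) auto
  let ?C = "nrm1 (\<lambda>x. ?Q x * aper y x)"
  have C: "?C \<ge> 0" by (rule integral_norm_nonneg[OF QyI])
  have off: "(\<lambda>k. norm (fc (aper y) (int n - k))) summable_on offres ?m"
  proof (rule dominated_by_summable(2)[OF _ summable_inverse_dd(1), where C = "2 * ?C"])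
    fix k assume k: "k \<in> offres ?m"
    have d: "\<bar>dd ?m k\<bar> > 0" using dd_nonzero[OF k] by simp
    have h: "\<bar>dd ?m k\<bar> / 2 \<le> \<bar>?s + dd ?m k\<bar>"
    proof -
      have "\<bar>b\<bar> / 2 \<le> \<bar>a + b\<bar>" if "2 * \<bar>a\<bar> \<le> \<bar>b\<bar>" for a b :: real using that by linarith
      from this[OF s[OF k]] show ?thesis .
    qed
    have "\<bar>?s + dd ?m k\<bar> * norm (fc (aper y) (int n - k)) \<le> ?C"
      using fc_bound[OF QyI, of "int n - k"] unfolding eq[symmetric] norm_mult norm_of_real .
    moreover have "\<bar>dd ?m k\<bar> / 2 * norm (fc (aper y) (int n - k)) \<le> \<bar>?s + dd ?m k\<bar> * norm (fc (aper y) (int n - k))"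
      by (rule mult_right_mono[OF h]) simp
    ultimately have "\<bar>dd ?m k\<bar> * norm (fc (aper y) (int n - k)) \<le> 2 * ?C" by linarith
    then show "norm (fc (aper y) (int n - k)) \<le> 2 * ?C * (1 / \<bar>dd ?m k\<bar>)"
      using d by (simp add: field_simps)
  qed simp
  have "UNIV = {0, ?m} \<union> offres ?m" by (auto simp: offres_def)
  then have sm: "(\<lambda>k. norm (fc (aper y) (int n - k))) summable_on UNIV"
    using summable_on_union[OF summable_on_finite off, of "{0, ?m}"] by simp
  then show sy: "(\<lambda>k. norm (fc (aper y) k)) summable_on UNIV"
    using summable_on_reindex_bij_betw[OF bij, of "\<lambda>k. norm (fc (aper y) k)"] by simp
  have "of_real (?s + dd ?m k) * fc (aper y) (int n - k) = (\<Sum>\<^sub>\<infinity>j. fc ?Q (j - k) * fc (aper y) (int n - j))" for k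
  proof -
    have "fc (\<lambda>x. ?Q x * aper y x) (int n - k) = (\<Sum>\<^sub>\<infinity>i. fc (aper y) i * fc ?Q ((int n - k) - i))"
      by (rule infsumI[OF fc_mult_has_sum[OF ac sy QI], symmetric])
    also have "\<dots> = (\<Sum>\<^sub>\<infinity>j. fc (aper y) (int n - j) * fc ?Q ((int n - k) - (int n - j)))"
      by (rule infsum_reindex_bij_betw[OF bij, symmetric])
    finally show ?thesis unfolding eq by (simp add: mult.commute)
  qed
  then show "sol (fc ?Q) ?m ?s (\<lambda>k. fc (aper y) (int n - k))"
    using sm by (simp add: sol_def)
qed

lemma fc_aper_zero_imp_zero:
  assumes y: "\<And>x. x \<notin> {0..1} \<Longrightarrow> y x = 0" and c: "continuous_on {0..1} y" and fc0: "\<And>k. fc (aper y) k = 0"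
  shows "y = (\<lambda>x. 0)"
proof
  fix x
  show "y x = 0"
  proof (cases "x \<in> {0..1}")
    case True
    have "aper y x = 0" by (rule fc_zero_imp_zero[OF continuous_on_aper[OF c] fc0 True])
    then show ?thesis by (simp add: aper_def)
  qed (rule y)
qed

lemma fc_aper_lincomb:
  assumes "continuous_on {0..1} y1" "continuous_on {0..1} y2"
  shows "fc (aper (\<lambda>x. a * y1 x + b * y2 x)) k = a * fc (aper y1) k + b * fc (aper y2) k"
proof -
  have "fc (aper (\<lambda>x. a * y1 x + b * y2 x)) k = fc (\<lambda>x. a * aper y1 x + b * aper y2 x) k"
    by (rule fc_cong) (simp add: aper_def algebra_simps)
  also have "\<dots> = fc (\<lambda>x. a * aper y1 x) k + fc (\<lambda>x. b * aper y2 x) k"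
    by (intro fc_add AI_continuous continuous_intros continuous_on_aper assms)
  finally show ?thesis by (simp add: fc_cmult)
qed

section \<open>Eigenfunctions supplied by the multiplicity\<close>

lemma eig_mult_pos:
  assumes "eig_mult q z \<ge> 1"
  shows "\<exists>y\<in>eigenspace q z. y \<noteq> (\<lambda>x. 0)"
proof -
  interpret V: vector_space "\<lambda>(c::complex) (f::real \<Rightarrow> complex) x. c * f x"
    by (rule vector_space_complex_fun)
  obtain B where B: "B \<subseteq> eigenspace q z" "V.independent B"
      "eigenspace q z \<subseteq> V.span B" "card B = V.dim (eigenspace q z)"
    by (rule V.basis_exists)
  have "card B \<ge> 1" using assms B(4) by (simp add: eig_mult_def)
  then have "B \<noteq> {}" by auto
  then obtain y where y: "y \<in> B" by blast
  have "y \<noteq> 0" using V.dependent_zero B(2) y by blast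
  then have "y \<noteq> (\<lambda>x. 0)" by (simp only: zero_fun_def not_False_eq_True)
  then show ?thesis using B(1) y by blast
qed

lemma eig_mult_two:
  assumes "eig_mult q z \<ge> 2"
  shows "\<exists>y1\<in>eigenspace q z. \<exists>y2\<in>eigenspace q z. \<forall>a b. (\<lambda>x. a * y1 x + b * y2 x) = (\<lambda>x. 0) \<longrightarrow> a = 0 \<and> b = 0"
proof -
  interpret V: vector_space "\<lambda>(c::complex) (f::real \<Rightarrow> complex) x. c * f x"
    by (rule vector_space_complex_fun)
  obtain B where B: "B \<subseteq> eigenspace q z" "V.independent B"
      "eigenspace q z \<subseteq> V.span B" "card B = V.dim (eigenspace q z)"
    by (rule V.basis_exists)
  have "card B \<ge> 2" using assms B(4) by (simp add: eig_mult_def)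
  then obtain T where "T \<subseteq> B" "card T = 2" by (rule obtain_subset_with_card_n)
  then obtain y1 y2 where y: "y1 \<in> B" "y2 \<in> B" "y1 \<noteq> y2" by (auto simp: card_2_iff)
  have "a = 0 \<and> b = 0" if 0: "(\<lambda>x. a * y1 x + b * y2 x) = (\<lambda>x. 0)" for a b
  proof -
    let ?u = "\<lambda>v. if v = y1 then a else b"
    have "(\<Sum>v\<in>{y1, y2}. (\<lambda>x. ?u v * v x)) = 0"
      using y 0 by (simp add: plus_fun_def zero_fun_def)
    note I = V.independentD[OF B(2) _ _ this]
    have "?u y1 = 0" by (rule I) (use y in auto)
    moreover have "?u y2 = 0" by (rule I) (use y in auto)
    ultimately show ?thesis using y(3) by (auto split: if_splits)
  qed
  then show ?thesis using y B(1) by blast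
qed

subsection \<open>Asymptotics\<close>

lemma lam_growth: "lam (int n) - real n \<ge> real n"
proof -
  have "2 * real n + 1 \<le> 2 * pi * real n + pi"
    using pi_gt3 by (intro add_mono mult_right_mono) auto
  then have "(2 * real n + 1)\<^sup>2 \<le> lam (int n)" unfolding lam_def by (intro power_mono) auto
  then show ?thesis by (simp add: power2_eq_square algebra_simps) (use mult_nonneg_nonneg[of "real n" "real n"] in linarith)
qed

text \<open>The intervals of radius n about \<open>lam n\<close> are disjoint; eventually they
  contain the eigenvalues, whose deviation is O(sqrt n).\<close>

lemma lam_separated:
  assumes "n < n'"
  shows "lam (int n) + real n < lam (int n') - real n'"
proof -
  have 1: "real n + 1 \<le> real n'" using assms by simp
  have "lam (int n') - lam (int n) = (2 * pi * (real n' - real n)) * (2 * pi * (real n' + real n + 1))"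
    by (simp add: lam_def power2_eq_square algebra_simps)
  also have "\<dots> \<ge> (1 * 1) * (1 * (real n' + real n + 1))"
  proof -
    have p: "1 \<le> 2 * pi" using pi_gt3 by simp
    show ?thesis
      using 1 p by (intro mult_mono) auto
  qed
  finally show ?thesis by simp
qed

text \<open>For large n no other index n' attains the value \<open>\<mu> n j\<close>: boundedly many
  n' give bounded values, the others lie in disjoint intervals. The counting identity therefore
  counts only j = 1, 2 at this n.\<close>

lemma large_eigenvalues_count:
  assumes L: "large_eigenvalues q N0 \<mu>"
  shows "\<exists>N2. \<forall>n\<ge>N2. n \<ge> N0 \<and> \<mu> n 1 \<le> \<mu> n 2 \<and> (\<forall>j\<in>{1, 2}. \<bar>\<mu> n j - lam (int n)\<bar> \<le> real n \<and>
    eig_mult q (of_real (\<mu> n j)) = (if \<mu> n 1 = \<mu> n 2 then 2 else 1))"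
proof -
  from L obtain R where le: "\<And>n. n \<ge> N0 \<Longrightarrow> \<mu> n 1 \<le> \<mu> n 2"
    and R: "\<And>t::real. card {(n, j). n \<ge> N0 \<and> j \<in> {1, 2} \<and> \<mu> n j = t} = (if t > R then eig_mult q (of_real t) else 0)"
    and O: "\<And>j. j \<in> {1, 2} \<Longrightarrow> (\<lambda>n. \<mu> n j - lam (int n)) \<in> O(\<lambda>n. sqrt (real n))"
    unfolding large_eigenvalues_def by blast
  have ev: "\<forall>\<^sub>F n in sequentially. \<bar>\<mu> n j - lam (int n)\<bar> \<le> real n" if j: "j \<in> {1, 2}" for j
  proof -
    from landau_o.bigE[OF O[OF j]] obtain c where c: "c > 0"
      "\<forall>\<^sub>F n in sequentially. norm (\<mu> n j - lam (int n)) \<le> c * norm (sqrt (real n))" by blast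
    obtain K :: nat where K: "c\<^sup>2 \<le> real K" using real_arch_simple by blast
    show ?thesis using c(2) eventually_ge_at_top[of K]
    proof eventually_elim
      case (elim n)
      have "c \<le> sqrt (real n)" using K elim(2) c(1) by (intro real_le_rsqrt) linarith
      then have "c * sqrt (real n) \<le> sqrt (real n) * sqrt (real n)" by (intro mult_right_mono) auto
      then show ?case using elim(1) by simp
    qed
  qed
  have "\<forall>\<^sub>F n in sequentially. \<bar>\<mu> n 1 - lam (int n)\<bar> \<le> real n \<and> \<bar>\<mu> n 2 - lam (int n)\<bar> \<le> real n"
    using ev[of 1] ev[of 2] by (simp add: eventually_conj)
  then obtain K0 where K0: "\<And>n. n \<ge> K0 \<Longrightarrow> \<bar>\<mu> n 1 - lam (int n)\<bar> \<le> real n \<and> \<bar>\<mu> n 2 - lam (int n)\<bar> \<le> real n"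
    by (auto simp: eventually_sequentially)
  then have near: "\<bar>\<mu> n j - lam (int n)\<bar> \<le> real n" if "n \<ge> K0" "j \<in> {1, 2}" for n j
    using that by auto
  \<comment> \<open>A bound for the values at all indices up to \<open>K0\<close>, including those
    below \<open>N0\<close>; since \<open>\<mu> n j\<close> is at least n, taking n past this bound
    excludes them.\<close>
  define Mx where "Mx = Max ((\<lambda>(n, j). \<mu> n j) ` ({..K0} \<times> {1, 2::nat}))"
  have Mx: "\<mu> n j \<le> Mx" if "n \<le> K0" "j \<in> {1, 2}" for n j
    unfolding Mx_def by (rule Max_ge) (use that in auto)
  obtain K1 :: nat where K1: "Mx < real K1" using reals_Archimedean2 by blast
  define N2 where "N2 = max (max K0 N0) K1"
  have uniq: "n' = n" if n: "n \<ge> N2" and j: "j \<in> {1, 2}" and j': "j' \<in> {1, 2}" and eq: "\<mu> n' j' = \<mu> n j" for n n' j j'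
  proof (rule ccontr)
    assume ne: "n' \<noteq> n"
    have nK: "n \<ge> K0" using n by (simp add: N2_def)
    have lo: "\<mu> n j \<ge> real n" using near[OF nK j] lam_growth[of n] by linarith
    have "n' > K0"
    proof (rule ccontr)
      assume "\<not> n' > K0"
      then have "\<mu> n' j' \<le> Mx" using Mx j' by simp
      moreover have "real K1 \<le> real n" using n by (simp add: N2_def)
      ultimately show False using eq lo K1 by linarith
    qed
    then have nn: "\<bar>\<mu> n' j' - lam (int n')\<bar> \<le> real n'" using near j' by simp
    show False
      using lam_separated[of n n'] lam_separated[of n' n] ne nn near[OF nK j] eq by (cases "n < n'") (auto simp: abs_le_iff)
  qed
  show ?thesis
  proof (intro exI[of _ N2] allI impI conjI ballI)
    fix n assume n: "N2 \<le> n"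
    then show N0: "N0 \<le> n" by (simp add: N2_def)
    show "\<mu> n 1 \<le> \<mu> n 2" using le N0 .
    fix j :: nat assume j: "j \<in> {1, 2}"
    show "\<bar>\<mu> n j - lam (int n)\<bar> \<le> real n" using near j n by (simp add: N2_def)
    have "{(n', j'). n' \<ge> N0 \<and> j' \<in> {1, 2} \<and> \<mu> n' j' = \<mu> n j} = Pair n ` {j'\<in>{1, 2}. \<mu> n j' = \<mu> n j}"
      using uniq[OF n j] N0 by auto
    then have "card {(n', j'). n' \<ge> N0 \<and> j' \<in> {1, 2} \<and> \<mu> n' j' = \<mu> n j} = card {j'\<in>{1, 2::nat}. \<mu> n j' = \<mu> n j}"
      by (simp add: card_image inj_on_def)
    also have "{j'\<in>{1, 2::nat}. \<mu> n j' = \<mu> n j} = (if \<mu> n 1 = \<mu> n 2 then {1, 2} else {j})"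
      using j by auto
    \<comment> \<open>The count is at least 1, so the value exceeds the threshold \<open>R\<close>
      and the count is the multiplicity.\<close>
    finally have "(if \<mu> n j > R then eig_mult q (of_real (\<mu> n j)) else 0) = (if \<mu> n 1 = \<mu> n 2 then 2 else 1)"
      unfolding R by (simp split: if_splits)
    then show "eig_mult q (of_real (\<mu> n j)) = (if \<mu> n 1 = \<mu> n 2 then 2 else 1)"
      by (simp split: if_splits)
  qed
qed

text \<open>For a = |k| and b = |m - k|, both at least 1 with sum at least 2n + 1, (a - 1)(b - 1) >=
  0 gives ab >= 2n. With |s| <= n this is the standing condition 2 |s| <= |dd m k| of the
  elimination.\<close>

lemma dd_lower:
  assumes "k \<in> offres (2 * int n + 1)"
  shows "2 * real n \<le> \<bar>dd (2 * int n + 1) k\<bar>"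
proof -
  define a b where "a = \<bar>k\<bar>" and "b = \<bar>2 * int n + 1 - k\<bar>"
  have ab: "a \<ge> 1" "b \<ge> 1" "a + b \<ge> 2 * int n + 1" using assms by (auto simp: offres_def a_def b_def)
  have "(a - 1) * (b - 1) \<ge> 0" using ab by simp
  then have "a * b \<ge> 2 * int n" using ab by (simp add: algebra_simps)
  then have "real_of_int (a * b) \<ge> real_of_int (2 * int n)" by (simp only: of_int_le_iff)
  then show ?thesis using abs_dd_ge[of k "2 * int n + 1"] by (simp add: a_def b_def)
qed

text \<open>The multiplicities supply either two independent eigenfunctions of a common eigenvalue
  or one for each of two distinct eigenvalues. As a continuous function is determined by its
  coefficients, independence and nonvanishing pass to the sequences.\<close>

lemma eigenvalue_pair:
  fixes q :: "real \<Rightarrow> real" and n :: nat and z1 z2 :: real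
  defines "m \<equiv> 2 * int n + 1" and "c \<equiv> fc (\<lambda>x. of_real (q x))" and "M \<equiv> nrm1 (\<lambda>x. complex_of_real (q x))"
  assumes q: "L1 q" and q0: "integral {0..1} q = 0"
    and z: "z1 \<le> z2" "\<bar>z1 - lam (int n)\<bar> \<le> real n" "\<bar>z2 - lam (int n)\<bar> \<le> real n"
    and mult: "eig_mult q (of_real z1) = (if z1 = z2 then 2 else 1)" "eig_mult q (of_real z2) = (if z1 = z2 then 2 else 1)"
    and small: "4 * M * sig m \<le> 1" "64 * M\<^sup>2 * tau m \<le> 1" and r: "norm (c m) + 8 * M\<^sup>2 * sig m \<le> r"
  shows "norm (of_real z1 - (of_real (lam (int n)) + A2 q n - of_real (norm (Bcoef c m)))) \<le> 20 * err M m r"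
    and "norm (of_real z2 - (of_real (lam (int n)) + A2 q n + of_real (norm (Bcoef c m)))) \<le> 20 * err M m r"
proof -
  have m: "m > 0" by (simp add: m_def)
  interpret hermitian_seq c M m unfolding c_def M_def by (rule hermitian_seq_fc[OF q q0 m])
  have A2: "A2 q n = Acoef c m"
    unfolding c_def m_def by (rule A2_eq, fold m_def c_def) (rule hermitian_seq_axioms)
  define sq where "sq y k = fc (aper y) (int n - k)" for y k
  have sd: "2 * \<bar>z1 - lam (int n)\<bar> \<le> \<bar>dd m k\<bar>" "2 * \<bar>z2 - lam (int n)\<bar> \<le> \<bar>dd m k\<bar>" if "k \<in> offres m" for k
  proof -
    have d: "2 * real n \<le> \<bar>dd m k\<bar>" using dd_lower[of k n] that unfolding m_def by blast
    have z': "2 * \<bar>z1 - lam (int n)\<bar> \<le> 2 * real n" "2 * \<bar>z2 - lam (int n)\<bar> \<le> 2 * real n" using z by simp_all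
    show "2 * \<bar>z1 - lam (int n)\<bar> \<le> \<bar>dd m k\<bar>" by (rule order_trans[OF z'(1) d])
    show "2 * \<bar>z2 - lam (int n)\<bar> \<le> \<bar>dd m k\<bar>" by (rule order_trans[OF z'(2) d])
  qed
  have cont: "continuous_on {0..1} y" if "y \<in> eigenspace q w" for y w
    using that antiperiodic_op_continuous unfolding eigenspace_def by blast
  have out: "y x = 0" if "y \<in> eigenspace q w" "x \<notin> {0..1}" for y w x
    using that unfolding eigenspace_def by blast
  have sol1: "sol c m (z1 - lam (int n)) (sq y)" if "y \<in> eigenspace q (of_real z1)" for y
  proof -
    have "antiperiodic_op q y (\<lambda>x. of_real z1 * y x)" using that by (simp add: eigenspace_def)
    from eigen_sol(1)[OF this q, of n] show ?thesis using sd(1) unfolding m_def c_def sq_def by blast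
  qed
  have sol2: "sol c m (z2 - lam (int n)) (sq y)" if "y \<in> eigenspace q (of_real z2)" for y
  proof -
    have "antiperiodic_op q y (\<lambda>x. of_real z2 * y x)" using that by (simp add: eigenspace_def)
    from eigen_sol(1)[OF this q, of n] show ?thesis using sd(2) unfolding m_def c_def sq_def by blast
  qed
  have zero: "y = (\<lambda>x. 0)" if "sq y = (\<lambda>k. 0)" "continuous_on {0..1} y" "\<And>x. x \<notin> {0..1} \<Longrightarrow> y x = 0" for y
  proof (rule fc_aper_zero_imp_zero[OF that(3,2)])
    fix k show "fc (aper y) k = 0" using fun_cong[OF that(1), of "int n - k"] by (simp add: sq_def)
  qed
  have e1: "of_real z1 - (of_real (lam (int n)) + A2 q n - of_real (norm (Bcoef c m))) = of_real (z1 - lam (int n)) - (Acoef c m - of_real (norm (Bcoef c m)))"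
    and e2: "of_real z2 - (of_real (lam (int n)) + A2 q n + of_real (norm (Bcoef c m))) = of_real (z2 - lam (int n)) - (Acoef c m + of_real (norm (Bcoef c m)))"
    by (simp_all add: A2)
  have main: "norm (of_real (z1 - lam (int n)) - (Acoef c m - of_real (norm (Bcoef c m)))) \<le> 20 * err M m r \<and>
    norm (of_real (z2 - lam (int n)) - (Acoef c m + of_real (norm (Bcoef c m)))) \<le> 20 * err M m r"
  proof (cases "z1 = z2")
    case True
    then have "eig_mult q (of_real z1) \<ge> 2" using mult by simp
    then obtain y1 y2 where y: "y1 \<in> eigenspace q (of_real z1)" "y2 \<in> eigenspace q (of_real z1)"
      and ind: "\<And>a b. (\<lambda>x. a * y1 x + b * y2 x) = (\<lambda>x. 0) \<Longrightarrow> a = 0 \<and> b = 0"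
      using eig_mult_two by blast
    have indep: "a = 0 \<and> b = 0" if e: "(\<lambda>k. a * sq y1 k + b * sq y2 k) = (\<lambda>k. 0)" for a b
    proof (rule ind, rule zero)
      show "sq (\<lambda>x. a * y1 x + b * y2 x) = (\<lambda>k. 0)"
        using e by (simp add: sq_def fc_aper_lincomb[OF cont[OF y(1)] cont[OF y(2)]] fun_eq_iff)
      show "continuous_on {0..1} (\<lambda>x. a * y1 x + b * y2 x)"
        by (intro continuous_intros cont[OF y(1)] cont[OF y(2)])
      show "a * y1 x + b * y2 x = 0" if "x \<notin> {0..1}" for x
        using out[OF y(1) that] out[OF y(2) that] by simp
    qed
    note S = two_sols_same[OF sol1[OF y(1)] sol1[OF y(2)] sd(1) small(1) r indep]
    show ?thesis using S True by simp
  next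
    case False
    then have "eig_mult q (of_real z1) \<ge> 1" "eig_mult q (of_real z2) \<ge> 1" using mult by simp_all
    then obtain y1 y2 where y: "y1 \<in> eigenspace q (of_real z1)" "y2 \<in> eigenspace q (of_real z2)"
      and nz: "y1 \<noteq> (\<lambda>x. 0)" "y2 \<noteq> (\<lambda>x. 0)"
      using eig_mult_pos by metis
    have nzs: "sq y1 \<noteq> (\<lambda>k. 0)" "sq y2 \<noteq> (\<lambda>k. 0)"
      using zero[of y1] zero[of y2] nz cont[OF y(1)] cont[OF y(2)] out[OF y(1)] out[OF y(2)] by blast+
    have lt: "z1 - lam (int n) < z2 - lam (int n)" using False z(1) by simp
    note S = two_sols_distinct[OF sol1[OF y(1)] sol2[OF y(2)] sd small r lt nzs]
    show ?thesis using S by blast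
  qed
  show "norm (of_real z1 - (of_real (lam (int n)) + A2 q n - of_real (norm (Bcoef c m)))) \<le> 20 * err M m r"
    unfolding e1 using main by (rule conjunct1)
  show "norm (of_real z2 - (of_real (lam (int n)) + A2 q n + of_real (norm (Bcoef c m)))) \<le> 20 * err M m r"
    unfolding e2 using main by (rule conjunct2)
qed

lemma filterlim_odd: "filterlim (\<lambda>n. real_of_int (2 * int n + 1)) at_top sequentially"
  by (rule filterlim_at_top_mono[OF filterlim_real_sequentially]) simp

lemma sig_tau_tendsto:
  "(\<lambda>n. sig (2 * int n + 1)) \<longlonglongrightarrow> 0" "(\<lambda>n. tau (2 * int n + 1)) \<longlonglongrightarrow> 0"
proof -
  obtain C where C: "\<And>m. m > 0 \<Longrightarrow> sig m \<le> C * of_int m powr (- 3/4) \<and> tau m \<le> C / (of_int m)\<^sup>2"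
    using sig_tau_bounds by blast
  have b: "norm (sig (2 * int n + 1)) \<le> C * real_of_int (2 * int n + 1) powr (- 3/4)"
    "norm (tau (2 * int n + 1)) \<le> C / (real_of_int (2 * int n + 1))\<^sup>2" for n
    unfolding real_norm_def abs_of_nonneg[OF sig_nonneg] abs_of_nonneg[OF tau_nonneg]
    using C[of "2 * int n + 1"] by linarith+
  have "(\<lambda>n. C * real_of_int (2 * int n + 1) powr (- 3/4)) \<longlonglongrightarrow> C * 0"
    by (intro tendsto_mult tendsto_const tendsto_neg_powr filterlim_odd) simp
  then have "(\<lambda>n. C * real_of_int (2 * int n + 1) powr (- 3/4)) \<longlonglongrightarrow> 0" by (simp only: mult_zero_right)
  then show "(\<lambda>n. sig (2 * int n + 1)) \<longlonglongrightarrow> 0"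
    by (rule Lim_null_comparison[OF always_eventually[OF allI[OF b(1)]]])
  have "(\<lambda>n. C / (real_of_int (2 * int n + 1))\<^sup>2) \<longlonglongrightarrow> 0"
    by (intro real_tendsto_divide_at_top[OF tendsto_const] filterlim_pow_at_top filterlim_odd) simp
  then show "(\<lambda>n. tau (2 * int n + 1)) \<longlonglongrightarrow> 0"
    by (rule Lim_null_comparison[OF always_eventually[OF allI[OF b(2)]]])
qed

text \<open>Since m^2 \<open>tau\<close> is bounded, the part with \<open>tau\<close> is O(r); the
  part with the cube of \<open>sig\<close> becomes O(m^(2 - 9/4)) = O(m^(-1/4)).\<close>

lemma err_tendsto:
  assumes r: "r \<longlonglongrightarrow> 0" "\<And>n. r n \<ge> 0" and M: "M \<ge> 0"
  shows "(\<lambda>n. (real_of_int (2 * int n + 1))\<^sup>2 * err M (2 * int n + 1) (r n)) \<longlonglongrightarrow> 0"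
proof -
  obtain C where C: "\<And>m. m > 0 \<Longrightarrow> sig m \<le> C * of_int m powr (- 3/4) \<and> tau m \<le> C / (of_int m)\<^sup>2"
    using sig_tau_bounds by blast
  define g where "g n = 4 * M\<^sup>2 * r n * C * (1 + M * sig (2 * int n + 1))
    + 4 * M ^ 4 * C ^ 3 * real_of_int (2 * int n + 1) powr (- 1/4)" for n
  have "g \<longlonglongrightarrow> 4 * M\<^sup>2 * 0 * C * (1 + M * 0) + 4 * M ^ 4 * C ^ 3 * 0"
    unfolding g_def
    by (intro tendsto_intros r sig_tau_tendsto tendsto_neg_powr filterlim_odd) simp
  then have g: "g \<longlonglongrightarrow> 0" by simp
  have le: "(real_of_int (2 * int n + 1))\<^sup>2 * err M (2 * int n + 1) (r n) \<le> g n" for n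
  proof -
    define m where "m = 2 * int n + 1"
    define x where "x = real_of_int m"
    have x: "x \<ge> 1" by (simp add: x_def m_def)
    have s: "sig m \<le> C * x powr (- 3/4)" and t: "tau m \<le> C / x\<^sup>2" using C[of m] by (simp_all add: x_def m_def)
    have "x\<^sup>2 * tau m \<le> x\<^sup>2 * (C / x\<^sup>2)" by (rule mult_left_mono[OF t]) simp
    then have t2: "x\<^sup>2 * tau m \<le> C" using x by simp
    have "x\<^sup>2 * sig m ^ 3 \<le> x\<^sup>2 * (C * x powr (- 3/4)) ^ 3"
      by (intro mult_left_mono power_mono s sig_nonneg) simp
    also have "\<dots> = C ^ 3 * (x powr 2 * (x powr (- 3/4)) powr 3)"
      using x by (simp add: power_mult_distrib mult_ac flip: powr_numeral)
    also have "x powr 2 * (x powr (- 3/4)) powr 3 = x powr (- 1/4)"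
      by (simp add: powr_powr flip: powr_add)
    finally have s2: "x\<^sup>2 * sig m ^ 3 \<le> C ^ 3 * x powr (- 1/4)" .
    have "x\<^sup>2 * err M m (r n) = 4 * M\<^sup>2 * r n * (x\<^sup>2 * tau m) * (1 + M * sig m) + 4 * M ^ 4 * (x\<^sup>2 * sig m ^ 3)"
      by (simp add: err_def algebra_simps)
    also have "\<dots> \<le> 4 * M\<^sup>2 * r n * C * (1 + M * sig m) + 4 * M ^ 4 * (C ^ 3 * x powr (- 1/4))"
      using r(2)[of n] M sig_nonneg[of m] s2 t2 by (intro add_mono mult_left_mono mult_right_mono) auto
    finally show ?thesis by (simp add: g_def m_def x_def mult_ac)
  qed
  have ge: "0 \<le> (real_of_int (2 * int n + 1))\<^sup>2 * err M (2 * int n + 1) (r n)" for n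
    unfolding err_def using r(2)[of n] M sig_nonneg tau_nonneg by (intro mult_nonneg_nonneg add_nonneg_nonneg) auto
  show ?thesis
    by (rule tendsto_sandwich[OF _ _ tendsto_const g]) (use le ge in \<open>auto intro!: always_eventually\<close>)
qed

abbreviation (input) remainder :: "(real \<Rightarrow> real) \<Rightarrow> (nat \<Rightarrow> nat \<Rightarrow> real) \<Rightarrow> nat \<Rightarrow> nat \<Rightarrow> complex" where
  "remainder q \<mu> n j \<equiv> of_real (\<mu> n j) - (of_real (lam (int n)) + A2 q n + (-1) ^ j * of_real (cmod (gap_coeff q n)))"

text \<open>\<open>Bcoef\<close> and \<open>gap_coeff\<close> differ by the third order term
  \<open>T n\<close>, so their moduli differ by o(n^-2). The estimate holds along the whole
  sequence; membership in \<open>N4\<close> enters afterwards, to separate the two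
  eigenvalues.\<close>

lemma eigenvalue_asymptotics:
  assumes q: "L1 q" and q0: "integral {0..1} q = 0"
    and L: "large_eigenvalues q N0 \<mu>" and e: "e > 0"
  shows "\<exists>N. \<forall>n\<ge>N. n \<ge> N0 \<and> (\<forall>j\<in>{1, 2}. eig_mult q (of_real (\<mu> n j)) = (if \<mu> n 1 = \<mu> n 2 then 2 else 1) \<and>
     norm (remainder q \<mu> n j) \<le> e / (real n)\<^sup>2)"
proof -
  define Q where "Q x = complex_of_real (q x)" for x
  define M where "M = nrm1 Q"
  define m where "m n = 2 * int n + 1" for n
  define c where "c = fc Q"
  define r where "r n = norm (c (m n)) + 8 * M\<^sup>2 * sig (m n)" for n
  define T where "T n = fc (\<lambda>x. Q x * resolv (m n) (\<lambda>x. Q x * resolv (m n) Q x) x) (m n)" for n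
  have Qe: "Q = (\<lambda>x. complex_of_real (q x))" by (simp add: Q_def fun_eq_iff)
  have QI: "L1 Q" unfolding Q_def by (rule AI_of_real[OF q])
  have M: "M \<ge> 0" unfolding M_def by (rule integral_norm_nonneg[OF QI])
  have inj: "inj m" by (simp add: inj_on_def m_def)
  have cl: "(\<lambda>n. norm (c (m n))) \<longlonglongrightarrow> 0"
    unfolding c_def by (rule tendsto_norm_zero[OF fc_tendsto_zero[OF QI inj]])
  have "r \<longlonglongrightarrow> 0 + 8 * M\<^sup>2 * 0"
    unfolding r_def by (intro tendsto_intros cl) (simp add: m_def sig_tau_tendsto)
  then have r: "r \<longlonglongrightarrow> 0" by simp
  have r0: "r n \<ge> 0" for n by (simp add: r_def sig_nonneg)
  have E: "(\<lambda>n. (real_of_int (m n))\<^sup>2 * err M (m n) (r n)) \<longlonglongrightarrow> 0"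
    unfolding m_def by (rule err_tendsto[OF r r0 M])
  have S: "(\<lambda>n. 4 * M * sig (m n)) \<longlonglongrightarrow> 0" "(\<lambda>n. 64 * M\<^sup>2 * tau (m n)) \<longlonglongrightarrow> 0"
    unfolding m_def by (rule tendsto_mult_right_zero, rule sig_tau_tendsto)+
  obtain NT where NT: "\<And>k. k \<ge> NT \<Longrightarrow> norm (of_int k ^ 2 * fc (\<lambda>x. Q x * resolv k (\<lambda>x. Q x * resolv k Q x) x) k) \<le> e / 2"
    using resolv_twice_small[OF QI, of "e / 2"] e by auto
  obtain N2 where N2: "\<And>n. n \<ge> N2 \<Longrightarrow> n \<ge> N0 \<and> \<mu> n 1 \<le> \<mu> n 2 \<and> (\<forall>j\<in>{1, 2}. \<bar>\<mu> n j - lam (int n)\<bar> \<le> real n \<and>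
    eig_mult q (of_real (\<mu> n j)) = (if \<mu> n 1 = \<mu> n 2 then 2 else 1))"
    using large_eigenvalues_count[OF L] by blast
  \<comment> \<open>Half of \<open>e\<close> pays for 20 \<open>err\<close>, the other half for the
    third order term.\<close>
  have e': "e / 40 > 0" using e by simp
  have "\<forall>\<^sub>F n in sequentially. 4 * M * sig (m n) \<le> 1 \<and> 64 * M\<^sup>2 * tau (m n) \<le> 1 \<and>
      (real_of_int (m n))\<^sup>2 * err M (m n) (r n) \<le> e / 40 \<and> n \<ge> N2 \<and> n \<ge> nat NT \<and> n \<ge> 1"
    by (intro eventually_conj eventually_ge_at_top
        eventually_mono[OF order_tendstoD(2)[OF S(1) zero_less_one] less_imp_le]
        eventually_mono[OF order_tendstoD(2)[OF S(2) zero_less_one] less_imp_le]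
        eventually_mono[OF order_tendstoD(2)[OF E e'] less_imp_le])
  then obtain N where N: "\<And>n. n \<ge> N \<Longrightarrow> 4 * M * sig (m n) \<le> 1 \<and> 64 * M\<^sup>2 * tau (m n) \<le> 1 \<and>
      (real_of_int (m n))\<^sup>2 * err M (m n) (r n) \<le> e / 40 \<and> n \<ge> N2 \<and> n \<ge> nat NT \<and> n \<ge> 1"
    by (auto simp: eventually_sequentially)
  show ?thesis
  proof (intro exI[of _ N] allI impI conjI ballI)
    fix n assume "N \<le> n"
    note H = N[OF this]
    have n1: "n \<ge> 1" and H2: "n \<ge> N2" using H by auto
    note K = N2[OF H2]
    show "N0 \<le> n" using K by blast
    fix j :: nat assume j: "j \<in> {1, 2}"
    show "eig_mult q (of_real (\<mu> n j)) = (if \<mu> n 1 = \<mu> n 2 then 2 else 1)" using K j by blast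
    have mn: "m n \<ge> NT" "real_of_int (m n) \<ge> real n" using H by (auto simp: m_def)
    have sq: "(real n)\<^sup>2 \<le> (real_of_int (m n))\<^sup>2" by (rule power_mono[OF mn(2)]) simp
    have np: "(real n)\<^sup>2 > 0" using n1 by simp
    have err0: "err M (m n) (r n) \<ge> 0"
      unfolding err_def using r0[of n] M sig_nonneg tau_nonneg by (intro mult_nonneg_nonneg add_nonneg_nonneg) auto
    have "(real n)\<^sup>2 * err M (m n) (r n) \<le> (real_of_int (m n))\<^sup>2 * err M (m n) (r n)"
      by (rule mult_right_mono[OF sq err0])
    then have a: "20 * err M (m n) (r n) \<le> e / 2 / (real n)\<^sup>2"
      using H np by (simp add: pos_le_divide_eq mult.commute)
    have "(real n)\<^sup>2 * norm (T n) \<le> (real_of_int (m n))\<^sup>2 * norm (T n)"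
      by (rule mult_right_mono[OF sq]) simp
    also have "\<dots> \<le> e / 2" using NT[OF mn(1)] by (simp add: T_def norm_mult norm_power)
    finally have b: "norm (T n) \<le> e / 2 / (real n)\<^sup>2"
      using np by (simp add: pos_le_divide_eq mult.commute)
    have B: "Bcoef c (m n) = gap_coeff q n + T n"
      using Bcoef_fc[OF QI, of "m n"] gap_coeff_eq[OF q q0, of n]
      unfolding c_def T_def m_def Qe by simp
    have Bg: "\<bar>norm (Bcoef c (m n)) - norm (gap_coeff q n)\<bar> \<le> norm (T n)"
      unfolding B using norm_triangle_ineq3[of "gap_coeff q n + T n" "gap_coeff q n"] by simp
    have "norm (of_real (\<mu> n 1) - (of_real (lam (int n)) + A2 q n - of_real (norm (Bcoef c (m n))))) \<le> 20 * err M (m n) (r n)"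
      and "norm (of_real (\<mu> n 2) - (of_real (lam (int n)) + A2 q n + of_real (norm (Bcoef c (m n))))) \<le> 20 * err M (m n) (r n)"
      using eigenvalue_pair[OF q q0, of "\<mu> n 1" "\<mu> n 2" n "r n"] K H
      unfolding M_def Q_def m_def c_def r_def by auto
    then have P: "norm (of_real (\<mu> n j) - (of_real (lam (int n)) + A2 q n + (-1) ^ j * of_real (norm (Bcoef c (m n))))) \<le> 20 * err M (m n) (r n)"
      using j by auto
    have "remainder q \<mu> n j
        = (of_real (\<mu> n j) - (of_real (lam (int n)) + A2 q n + (-1) ^ j * of_real (norm (Bcoef c (m n)))))
          + (-1) ^ j * of_real (norm (Bcoef c (m n)) - norm (gap_coeff q n))"
      by (simp add: algebra_simps)
    also have "norm \<dots> \<le> 20 * err M (m n) (r n) + norm (T n)"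
      by (intro norm_triangle_le add_mono P) (use Bg in \<open>simp add: norm_mult norm_power del: of_real_diff\<close>)
    also have "\<dots> \<le> e / 2 / (real n)\<^sup>2 + e / 2 / (real n)\<^sup>2" by (rule add_mono[OF a b])
    also have "\<dots> = e / (real n)\<^sup>2" by (simp add: add_divide_distrib[symmetric])
    finally show "norm (remainder q \<mu> n j) \<le> e / (real n)\<^sup>2" .
  qed
qed

theorem theorem7:
  fixes q :: "real \<Rightarrow> real" and N0 :: nat and \<mu> :: "nat \<Rightarrow> nat \<Rightarrow> real" and \<epsilon> :: real
  assumes "\<And>x. q (x + 1) = q x"
    and "q absolutely_integrable_on {0..1}"
    and "integral {0..1} q = 0"
    and "large_eigenvalues q N0 \<mu>"
    and "\<epsilon> > 0"
  shows "\<exists>N1>0. \<forall>N\<ge>N1.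
           (\<forall>n\<in>N4 q \<epsilon> N. n \<ge> N0 \<and> (\<forall>j\<in>{1, 2}. eig_mult q (of_real (\<mu> n j)) = 1)) \<and>
           (\<forall>j\<in>{1, 2}.
              (\<lambda>n. of_real (\<mu> n j)
                   - (of_real (lam (int n)) + A2 q n + (-1) ^ j * of_real (cmod (gap_coeff q n))))
              \<in> o[inf at_top (principal (N4 q \<epsilon> N))](\<lambda>n. of_real (1 / (real n)\<^sup>2) :: complex))"
proof -
  note asymp = eigenvalue_asymptotics[OF assms(2,3,4)]
  obtain K where K: "\<And>n. n \<ge> K \<Longrightarrow> n \<ge> N0 \<and> (\<forall>j\<in>{1, 2}. eig_mult q (of_real (\<mu> n j)) = (if \<mu> n 1 = \<mu> n 2 then 2 else 1) \<and>
     norm (remainder q \<mu> n j) \<le> (\<epsilon> / 2) / (real n)\<^sup>2)"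
    using asymp[of "\<epsilon> / 2"] assms(5) by auto
  have simple: "n \<ge> N0 \<and> (\<forall>j\<in>{1, 2}. eig_mult q (of_real (\<mu> n j)) = 1)" if n: "n \<in> N4 q \<epsilon> N" and N: "N \<ge> max K 1" for n N
  proof -
    have nK: "n \<ge> K" and np: "n > 0" and gap: "cmod (gap_coeff q n) \<ge> \<epsilon> / (real n)\<^sup>2"
      using n N by (auto simp: N4_def)
    note H = K[OF nK]
    define X where "X = of_real (lam (int n)) + A2 q n"
    have A: "\<forall>j\<in>{1, 2}. norm (of_real (\<mu> n j) - (X + (-1) ^ j * of_real (cmod (gap_coeff q n)))) \<le> (\<epsilon> / 2) / (real n)\<^sup>2"
      using H unfolding X_def by blast
    have 1: "norm (of_real (\<mu> n 1) - (X - of_real (cmod (gap_coeff q n)))) \<le> (\<epsilon> / 2) / (real n)\<^sup>2"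
      and 2: "norm (of_real (\<mu> n 2) - (X + of_real (cmod (gap_coeff q n)))) \<le> (\<epsilon> / 2) / (real n)\<^sup>2"
      using bspec[OF A, of 1] bspec[OF A, of 2] by simp_all
    \<comment> \<open>Both remainders are at most half of \<open>\<epsilon>\<close> / n^2, so a
      double eigenvalue would give 2 |gap| <= \<open>\<epsilon>\<close> / n^2, against the lower
      bound that defines \<open>N4\<close>.\<close>
    have ne: "\<mu> n 1 \<noteq> \<mu> n 2"
    proof
      assume eq: "\<mu> n 1 = \<mu> n 2"
      have "2 * of_real (cmod (gap_coeff q n)) = (of_real (\<mu> n 1) - (X - of_real (cmod (gap_coeff q n)))) - (of_real (\<mu> n 2) - (X + of_real (cmod (gap_coeff q n))))"
        using eq by simp
      then have "norm (2 * complex_of_real (cmod (gap_coeff q n))) \<le> (\<epsilon> / 2) / (real n)\<^sup>2 + (\<epsilon> / 2) / (real n)\<^sup>2"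
        by (simp only:) (intro norm_triangle_le_diff add_mono 1 2)
      also have "\<dots> = \<epsilon> / (real n)\<^sup>2" by (simp add: add_divide_distrib[symmetric])
      finally have "2 * cmod (gap_coeff q n) \<le> \<epsilon> / (real n)\<^sup>2" by (simp add: norm_mult)
      moreover have "\<epsilon> / (real n)\<^sup>2 > 0" using assms(5) np by simp
      ultimately show False using gap by linarith
    qed
    show ?thesis using H unfolding if_not_P[OF ne] by blast
  qed
  \<comment> \<open>The asymptotics along all n restrict to any set \<open>A\<close> of indices,
    because the filter only becomes finer.\<close>
  have small: "(\<lambda>n. remainder q \<mu> n j)
      \<in> o[inf at_top (principal A)](\<lambda>n. of_real (1 / (real n)\<^sup>2) :: complex)" if j: "j \<in> {1, 2}" for j A
  proof (rule landau_o.smallI)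
    fix d :: real assume "d > 0"
    then obtain N where "\<And>n. n \<ge> N \<Longrightarrow> norm (remainder q \<mu> n j) \<le> d / (real n)\<^sup>2"
      using asymp[of d] j by blast
    then have "\<forall>\<^sub>F n in at_top. norm (remainder q \<mu> n j) \<le> d / (real n)\<^sup>2"
      by (auto simp: eventually_sequentially)
    then have "\<forall>\<^sub>F n in at_top. norm (remainder q \<mu> n j) \<le> d * norm (of_real (1 / (real n)\<^sup>2) :: complex)"
      by (simp add: norm_divide norm_power)
    then show "\<forall>\<^sub>F n in inf at_top (principal A). norm (remainder q \<mu> n j) \<le> d * norm (of_real (1 / (real n)\<^sup>2) :: complex)"
      by (rule filter_leD[OF inf_le1])
  qed
  show ?thesis
    by (intro exI[of _ "max K 1"] conjI allI impI ballI simple small) auto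
qed

end
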